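(* Let $\kappa$ be a field, $G$ a group, $A$ a unital $\kappa$-algebra, $\theta$ a unital partial action of $G$ on $A$ with $\kappa$-valued twist $\sigma$ such that $\sigma(g,g^{-1})\in\{0,1\}$ for all $g\in G$ with $g^2\ne1$, and let $\Lambda=A\ast_{\theta,\sigma}G$. Consider the functors $$F_1=A\otimes_{A^e}-:\Lambda^e\text{-Mod}\to\kappa_{par}^{\sigma''}G\text{-Mod},\qquad F_2=B^\sigma\otimes_{\kappa_{par}^{\sigma''}G}-:\kappa_{par}^{\sigma''}G\text{-Mod}\to\kappa\text{-Mod},$$ $$F=\Lambda\otimes_{\Lambda^e}-:\Lambda^e\text{-Mod}\to\kappa\text{-Mod}.$$ Then the functors $F_2F_1$ and $F$ are naturally isomorphic.
   Context: All algebras are associative and unital with $1\ne 0$; $R^e=R\otimes_\kappa R^{op}$; $R$-bimodules are identified with left $R^e$-modules via $(r\otimes s)\cdot m=rms$, and with right $R^e$-modules via $m\cdot(r\otimes s)=smr$. Unital partial action of $G$ on $A$: a family of $\kappa$-algebra isomorphisms $\theta_g:D_{g^{-1}}\to D_g$ ($g\in G$), where $D_g$ is an ideal of $A$ generated by a central idempotent $1_g$ of $A$ ($D_g=0$ allowed), such that $D_1=A$, $\theta_1=\mathrm{id}_A$, $\theta_g(D_{g^{-1}}D_h)=D_gD_{gh}$, and $\theta_g\theta_h(a)=\theta_{gh}(a)$ for $a\in D_{h^{-1}}D_{(gh)^{-1}}$. A $\kappa$-valued twist of $\theta$ is a function $\sigma:G\times G\to\kappa$ with $\sigma(g,h)=0\iff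 1_g1_{gh}=0$ such that $\varsigma_{g,h}:=\sigma(g,h)1_g1_{gh}$ satisfies $\varsigma_{1,g}=\varsigma_{g,1}=1_g$ and $\theta_g(1_{g^{-1}}\varsigma_{h,t})\varsigma_{g,ht}=\varsigma_{g,h}\varsigma_{gh,t}$ for all $g,h,t\in G$. $A\ast_{\theta,\sigma}G=\bigoplus_{g\in G}D_g\delta_g$ with $(a_g\delta_g)(b_h\delta_h)=\sigma(g,h)\,a_g\theta_g(1_{g^{-1}}b_h)\,\delta_{gh}$; $A$ embeds via $a\mapsto a\delta_1$. For a $\kappa$-valued twist $\rho$ of some unital partial action of $G$, $\kappa_{par}^\rho G$ is the universal unital $\kappa$-algebra generated by symbols $[g]^\rho$ ($g\in G$) subject to: $[g^{-1}]^\rho[gh]^\rho=[gh]^\rho[h^{-1}]^\rho=0$ whenever $\rho(g,h)=0$; $[g^{-1}]^\rho[g]^\rho[h]^\rho=\rho(g,h)[g^{-1}]^\rho[gh]^\rho$; $[g]^\rho[h]^\rho[h^{-1}]^\rho=\rho(g,h)[gh]^\rho[h^{-1}]^\rho$; $[g]^\rho[1]^\rho=[1]^\rho[g]^\rho=[g]^\rho$. Set $e_g^\rho=\rho(g^{-1},g)^{-1}[g]^\rho[g^{-1}]^\rho$ if $\rho(g^{-1},g)\neq0$ and $e_g^\rho=0$ otherwise; these are commuting idempotents, and $B^\rho$ is the (commutative) subalgebra they generate. Let $\sigma'(g,h)=\sigma(g,h)\sigma(h^{-1},g^{-1})$; let $\xi(g)=\sigma(g,g)^{-1}$ if $g^2=1$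 and $\sigma(g,g)\ne0$, and $\xi(g)=1$ otherwise; let $\sigma''(g,h)=\frac{\xi(g)\xi(h)}{\xi(gh)}\sigma'(g,h)$. Then $\sigma',\sigma''$ are again such twists and $\sigma''$ takes values in $\{0,1\}$. Module structures. $B^\sigma$ is a right $\kappa_{par}^{\sigma''}G$-module via $b\cdot[g]^{\sigma''}=\xi(g)[g^{-1}]^\sigma b[g]^\sigma$. Any $\Lambda$-bimodule $M$ is a left $\kappa_{par}^{\sigma''}G$-module via $[g]^{\sigma''}\cdot m=\xi(g)(1_g\delta_g)m(1_{g^{-1}}\delta_{g^{-1}})$. For $F_1$, $A\otimes_{A^e}M$ is a left $\kappa_{par}^{\sigma''}G$-module via $[g]^{\sigma''}\cdot(a\otimes m)=\theta_g(1_{g^{-1}}a)\otimes[g]^{\sigma''}\cdot m$. *)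

theory Defs
  imports
    "HOL-Algebra.Module"
    "HOL-Algebra.QuotRing"
    "HOL-Algebra.Ideal_Product"
    "HOL-Algebra.Subrings"
begin

section \<open>Algebras and modules\<close>

text \<open>The library locale \<^locale>\<open>algebra\<close> is restricted to commutative algebras, and
  \<^locale>\<open>module\<close> to commutative base rings.\<close>

locale kalgebra = module K A + ring A
  for K :: "('k, 'c) ring_scheme" and A :: "('k, 'a) module" (structure) +
  assumes smult_mult_left:
      "\<lbrakk>c \<in> carrier K; x \<in> carrier A; y \<in> carrier A\<rbrakk> \<Longrightarrow> (c \<odot> x) \<otimes> y = c \<odot> (x \<otimes> y)"
    and smult_mult_right:
      "\<lbrakk>c \<in> carrier K; x \<in> carrier A; y \<in> carrier A\<rbrakk> \<Longrightarrow> x \<otimes> (c \<odot> y) = c \<odot> (x \<otimes> y)"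
    and one_neq_zero: "\<one> \<noteq> \<zero>"

locale left_module = R?: ring R + M?: abelian_group M
  for R :: "('r, 'c) ring_scheme" and M :: "('r, 'm) module" (structure) +
  assumes lsmult_closed:
      "\<lbrakk>r \<in> carrier R; x \<in> carrier M\<rbrakk> \<Longrightarrow> r \<odot> x \<in> carrier M"
    and lsmult_l_distr:
      "\<lbrakk>r \<in> carrier R; s \<in> carrier R; x \<in> carrier M\<rbrakk> \<Longrightarrow> (r \<oplus>\<^bsub>R\<^esub> s) \<odot> x = r \<odot> x \<oplus> s \<odot> x"
    and lsmult_r_distr:
      "\<lbrakk>r \<in> carrier R; x \<in> carrier M; y \<in> carrier M\<rbrakk> \<Longrightarrow> r \<odot> (x \<oplus> y) = r \<odot> x \<oplus> r \<odot> y"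
    and lsmult_assoc:
      "\<lbrakk>r \<in> carrier R; s \<in> carrier R; x \<in> carrier M\<rbrakk> \<Longrightarrow> (r \<otimes>\<^bsub>R\<^esub> s) \<odot> x = r \<odot> (s \<odot> x)"
    and lsmult_one:
      "x \<in> carrier M \<Longrightarrow> \<one>\<^bsub>R\<^esub> \<odot> x = x"

definition module_hom :: "('r, 'c) ring_scheme \<Rightarrow> ('r, 'm) module \<Rightarrow> ('r, 'n) module \<Rightarrow> ('m \<Rightarrow> 'n) set"
  where "module_hom R M N =
    {f \<in> carrier M \<rightarrow> carrier N.
      (\<forall>x\<in>carrier M. \<forall>y\<in>carrier M. f (x \<oplus>\<^bsub>M\<^esub> y) = f x \<oplus>\<^bsub>N\<^esub> f y) \<and>
      (\<forall>r\<in>carrier R. \<forall>x\<in>carrier M. f (r \<odot>\<^bsub>M\<^esub> x) = r \<odot>\<^bsub>N\<^esub> f x)}"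

definition with_smult :: "('m, 'c) ring_scheme \<Rightarrow> ('r \<Rightarrow> 'm \<Rightarrow> 'm) \<Rightarrow> ('r, 'm) module"
  where "with_smult M s =
    \<lparr>carrier = carrier M, mult = monoid.mult M, one = one M,
     zero = zero M, add = add M, smult = s\<rparr>"

definition self_algebra :: "('k, 'c) ring_scheme \<Rightarrow> ('k, 'k) module"
  where "self_algebra K = with_smult K (monoid.mult K)"

definition opp :: "('k, 'a) module \<Rightarrow> ('k, 'a) module"
  where "opp A = A\<lparr>mult := (\<lambda>x y. y \<otimes>\<^bsub>A\<^esub> x)\<rparr>"

definition subalgebra_gen :: "('k, 'c) ring_scheme \<Rightarrow> ('k, 'a) module \<Rightarrow> 'a set \<Rightarrow> 'a set"
  where "subalgebra_gen K A S =
    \<Inter>{B. subring B A \<and> (\<forall>c\<in>carrier K. \<forall>b\<in>B. c \<odot>\<^bsub>A\<^esub> b \<in> B) \<and> S \<subseteq> B}"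

definition submodule_gen :: "('k, 'c) ring_scheme \<Rightarrow> ('k, 'a) module \<Rightarrow> 'a set \<Rightarrow> 'a set"
  where "submodule_gen K V S = \<Inter>{W. submodule W K V \<and> S \<subseteq> W}"

text \<open>Quotient by a submodule or by a two-sided ideal; in the former case the fields \<open>mult\<close>
  and \<open>one\<close> carry no information. The scalar \<open>0\<close> sends a coset to \<open>{0}\<close>, hence the summand \<open>I\<close>.\<close>

definition quot_module :: "('k, 'a) module \<Rightarrow> 'a set \<Rightarrow> ('k, 'a set) module"
  where "quot_module A I = with_smult (A Quot I) (\<lambda>c X. I <+>\<^bsub>A\<^esub> ((\<lambda>x. c \<odot>\<^bsub>A\<^esub> x) ` X))"


section \<open>Free modules, free algebras and linear extension\<close>

definition free_module :: "('k, 'c) ring_scheme \<Rightarrow> 'x set \<Rightarrow> ('k, 'x \<Rightarrow> 'k) module"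
  where "free_module K S =
    \<lparr>carrier = {f. (\<forall>x. f x \<in> carrier K) \<and> finite {x. f x \<noteq> \<zero>\<^bsub>K\<^esub>} \<and> {x. f x \<noteq> \<zero>\<^bsub>K\<^esub>} \<subseteq> S},
     mult = undefined, one = undefined,
     zero = (\<lambda>x. \<zero>\<^bsub>K\<^esub>),
     add = (\<lambda>f h x. f x \<oplus>\<^bsub>K\<^esub> h x),
     smult = (\<lambda>c f x. c \<otimes>\<^bsub>K\<^esub> f x)\<rparr>"

definition kdelta :: "('k, 'c) ring_scheme \<Rightarrow> 'x \<Rightarrow> 'x \<Rightarrow> 'k"
  where "kdelta K x = (\<lambda>y. if y = x then \<one>\<^bsub>K\<^esub> else \<zero>\<^bsub>K\<^esub>)"

definition free_algebra :: "('k, 'c) ring_scheme \<Rightarrow> 'x set \<Rightarrow> ('k, 'x list \<Rightarrow> 'k) module"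
  where "free_algebra K S = (free_module K (lists S))
    \<lparr>mult := (\<lambda>f h w. \<Oplus>\<^bsub>K\<^esub>i\<in>{..length w}. f (take i w) \<otimes>\<^bsub>K\<^esub> h (drop i w)),
     one := kdelta K []\<rparr>"

definition lin_ext :: "('k, 'c) ring_scheme \<Rightarrow> ('k, 'v) module \<Rightarrow> ('x \<Rightarrow> 'v) \<Rightarrow> ('x \<Rightarrow> 'k) \<Rightarrow> 'v"
  where "lin_ext K V b f = (\<Oplus>\<^bsub>V\<^esub>x\<in>{x. f x \<noteq> \<zero>\<^bsub>K\<^esub>}. f x \<odot>\<^bsub>V\<^esub> b x)"

text \<open>The map induced by \<open>lin_ext K V b\<close> on a quotient of a free module. It is meaningful when
  the linear extension of \<open>b\<close> vanishes on the submodule divided out, so that it is constant on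
  each coset \<open>X\<close>.\<close>

definition quot_lift :: "('k, 'c) ring_scheme \<Rightarrow> ('k, 'v) module \<Rightarrow> ('x \<Rightarrow> 'v) \<Rightarrow> ('x \<Rightarrow> 'k) set \<Rightarrow> 'v"
  where "quot_lift K V b X = the_elem (lin_ext K V b ` X)"


section \<open>Tensor products\<close>

text \<open>Below, \<open>R\<close> is a \<open>K\<close>-algebra, \<open>M\<close> a right and \<open>N\<close> a left \<open>R\<close>-module. For a right module,
  \<open>r \<odot>\<^bsub>M\<^esub> m\<close> denotes \<open>m \<cdot> r\<close>. The scalar action of \<open>K\<close> on modules is the one through \<open>R\<close>, so that
  the quotient of the free \<open>K\<close>-module on pairs is the usual tensor product over \<open>R\<close>
  with its \<open>K\<close>-module structure.\<close>

definition scalars :: "('k, 'r) module \<Rightarrow> ('r, 'm) module \<Rightarrow> ('k, 'm) module"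
  where "scalars R M = with_smult M (\<lambda>c m. (c \<odot>\<^bsub>R\<^esub> \<one>\<^bsub>R\<^esub>) \<odot>\<^bsub>M\<^esub> m)"

definition tensor_free ::
    "('k, 'c) ring_scheme \<Rightarrow> ('r, 'm) module \<Rightarrow> ('r, 'n) module \<Rightarrow> ('k, 'm \<times> 'n \<Rightarrow> 'k) module"
  where "tensor_free K M N = free_module K (carrier M \<times> carrier N)"

definition tensor_rels ::
    "('k, 'c) ring_scheme \<Rightarrow> ('k, 'r) module \<Rightarrow> ('r, 'm) module \<Rightarrow> ('r, 'n) module \<Rightarrow> ('m \<times> 'n \<Rightarrow> 'k) set"
  where "tensor_rels K R M N =
    (let V = tensor_free K M N; d = kdelta K in
      {d (m \<oplus>\<^bsub>M\<^esub> m', n) \<ominus>\<^bsub>V\<^esub> (d (m, n) \<oplus>\<^bsub>V\<^esub> d (m', n)) | m m' n.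
        m \<in> carrier M \<and> m' \<in> carrier M \<and> n \<in> carrier N} \<union>
      {d (m, n \<oplus>\<^bsub>N\<^esub> n') \<ominus>\<^bsub>V\<^esub> (d (m, n) \<oplus>\<^bsub>V\<^esub> d (m, n')) | m n n'.
        m \<in> carrier M \<and> n \<in> carrier N \<and> n' \<in> carrier N} \<union>
      {d (r \<odot>\<^bsub>M\<^esub> m, n) \<ominus>\<^bsub>V\<^esub> d (m, r \<odot>\<^bsub>N\<^esub> n) | r m n.
        r \<in> carrier R \<and> m \<in> carrier M \<and> n \<in> carrier N} \<union>
      {d (c \<odot>\<^bsub>scalars R M\<^esub> m, n) \<ominus>\<^bsub>V\<^esub> (c \<odot>\<^bsub>V\<^esub> d (m, n)) | c m n.
        c \<in> carrier K \<and> m \<in> carrier M \<and> n \<in> carrier N})"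

definition tensor_null ::
    "('k, 'c) ring_scheme \<Rightarrow> ('k, 'r) module \<Rightarrow> ('r, 'm) module \<Rightarrow> ('r, 'n) module \<Rightarrow> ('m \<times> 'n \<Rightarrow> 'k) set"
  where "tensor_null K R M N = submodule_gen K (tensor_free K M N) (tensor_rels K R M N)"

definition tensor ::
    "('k, 'c) ring_scheme \<Rightarrow> ('k, 'r) module \<Rightarrow> ('r, 'm) module \<Rightarrow> ('r, 'n) module
      \<Rightarrow> ('k, ('m \<times> 'n \<Rightarrow> 'k) set) module"
  where "tensor K R M N = quot_module (tensor_free K M N) (tensor_null K R M N)"

definition pure_tensor ::
    "('k, 'c) ring_scheme \<Rightarrow> ('k, 'r) module \<Rightarrow> ('r, 'm) module \<Rightarrow> ('r, 'n) module
      \<Rightarrow> 'm \<Rightarrow> 'n \<Rightarrow> ('m \<times> 'n \<Rightarrow> 'k) set"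
  where "pure_tensor K R M N m n = tensor_null K R M N +>\<^bsub>tensor_free K M N\<^esub> kdelta K (m, n)"

definition algebra_tensor ::
    "('k, 'c) ring_scheme \<Rightarrow> ('k, 'r) module \<Rightarrow> ('k, 's) module \<Rightarrow> ('k, ('r \<times> 's \<Rightarrow> 'k) set) module"
  where "algebra_tensor K R S =
    (let T = tensor K (self_algebra K) R S; t = pure_tensor K (self_algebra K) R S in
      T\<lparr>mult := (\<lambda>X Y. quot_lift K T (\<lambda>(r, s). quot_lift K T
                  (\<lambda>(r', s'). t (r \<otimes>\<^bsub>R\<^esub> r') (s \<otimes>\<^bsub>S\<^esub> s')) Y) X),
        one := t \<one>\<^bsub>R\<^esub> \<one>\<^bsub>S\<^esub>\<rparr>)"

definition env :: "('k, 'c) ring_scheme \<Rightarrow> ('k, 'r) module \<Rightarrow> ('k, ('r \<times> 'r \<Rightarrow> 'k) set) module"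
  where "env K R = algebra_tensor K R (opp R)"

definition env_tensor :: "('k, 'c) ring_scheme \<Rightarrow> ('k, 'r) module \<Rightarrow> 'r \<Rightarrow> 'r \<Rightarrow> ('r \<times> 'r \<Rightarrow> 'k) set"
  where "env_tensor K R r s = pure_tensor K (self_algebra K) R (opp R) r s"

text \<open>\<open>R\<close> as a right module over its enveloping algebra, \<open>a \<cdot> (r \<otimes> s) = s a r\<close>.\<close>

definition right_regular ::
    "('k, 'c) ring_scheme \<Rightarrow> ('k, 'r) module \<Rightarrow> (('r \<times> 'r \<Rightarrow> 'k) set, 'r) module"
  where "right_regular K R =
    with_smult R (\<lambda>X a. quot_lift K R (\<lambda>(r, s). s \<otimes>\<^bsub>R\<^esub> a \<otimes>\<^bsub>R\<^esub> r) X)"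

text \<open>Restriction of a bimodule along an algebra homomorphism \<open>j : A \<rightarrow> R\<close>.\<close>

definition restrict_env ::
    "('k, 'c) ring_scheme \<Rightarrow> ('k, 'r) module \<Rightarrow> ('a \<Rightarrow> 'r) \<Rightarrow> (('r \<times> 'r \<Rightarrow> 'k) set, 'm) module
      \<Rightarrow> (('a \<times> 'a \<Rightarrow> 'k) set, 'm) module"
  where "restrict_env K R j M =
    with_smult M (\<lambda>X. smult M (quot_lift K (env K R) (\<lambda>(a, b). env_tensor K R (j a) (j b)) X))"


section \<open>Functors between module categories\<close>

text \<open>A functor consists of its values on objects and on morphisms \<open>f : M \<rightarrow> N\<close>; the latter also
  receive \<open>M\<close> and \<open>N\<close>, and only their values on carriers matter.\<close>

record ('r, 'm, 's, 'n) mod_functor =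
  obj_map :: "('r, 'm) module \<Rightarrow> ('s, 'n) module"
  mor_map :: "('r, 'm) module \<Rightarrow> ('r, 'm) module \<Rightarrow> ('m \<Rightarrow> 'm) \<Rightarrow> 'n \<Rightarrow> 'n"

definition is_functor ::
    "('r, 'c) ring_scheme \<Rightarrow> ('s, 'd) ring_scheme \<Rightarrow> ('r, 'm, 's, 'n) mod_functor \<Rightarrow> bool"
  where "is_functor R S F \<longleftrightarrow>
    (\<forall>M. left_module R M \<longrightarrow> left_module S (obj_map F M)) \<and>
    (\<forall>M N f. left_module R M \<and> left_module R N \<and> f \<in> module_hom R M N \<longrightarrow>
      mor_map F M N f \<in> module_hom S (obj_map F M) (obj_map F N)) \<and>
    (\<forall>M N f g. left_module R M \<and> left_module R N \<and> f \<in> module_hom R M N \<and> (\<forall>x\<in>carrier M. f x = g x) \<longrightarrow>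
      (\<forall>y\<in>carrier (obj_map F M). mor_map F M N f y = mor_map F M N g y)) \<and>
    (\<forall>M. left_module R M \<longrightarrow>
      (\<forall>y\<in>carrier (obj_map F M). mor_map F M M (\<lambda>x. x) y = y)) \<and>
    (\<forall>M N P f g. left_module R M \<and> left_module R N \<and> left_module R P \<and>
      f \<in> module_hom R M N \<and> g \<in> module_hom R N P \<longrightarrow>
      (\<forall>y\<in>carrier (obj_map F M). mor_map F M P (\<lambda>x. g (f x)) y = mor_map F N P g (mor_map F M N f y)))"

definition comp_functor ::
    "('s, 'n, 't, 'p) mod_functor \<Rightarrow> ('r, 'm, 's, 'n) mod_functor \<Rightarrow> ('r, 'm, 't, 'p) mod_functor"
  where "comp_functor F2 F1 =
    \<lparr>obj_map = (\<lambda>M. obj_map F2 (obj_map F1 M)),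
     mor_map = (\<lambda>M N f. mor_map F2 (obj_map F1 M) (obj_map F1 N) (mor_map F1 M N f))\<rparr>"

definition naturally_isomorphic ::
    "('r, 'c) ring_scheme \<Rightarrow> ('s, 'd) ring_scheme
      \<Rightarrow> ('r, 'm, 's, 'n) mod_functor \<Rightarrow> ('r, 'm, 's, 'p) mod_functor \<Rightarrow> bool"
  where "naturally_isomorphic R S F F' \<longleftrightarrow>
    (\<exists>\<eta>. (\<forall>M. left_module R M \<longrightarrow>
            \<eta> M \<in> module_hom S (obj_map F M) (obj_map F' M) \<and>
            bij_betw (\<eta> M) (carrier (obj_map F M)) (carrier (obj_map F' M))) \<and>
         (\<forall>M N f. left_module R M \<and> left_module R N \<and> f \<in> module_hom R M N \<longrightarrow>
            (\<forall>y\<in>carrier (obj_map F M). \<eta> N (mor_map F M N f y) = mor_map F' M N f (\<eta> M y))))"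

definition tensor_map ::
    "('k, 'c) ring_scheme \<Rightarrow> ('k, 'r) module \<Rightarrow> ('r, 'x) module \<Rightarrow> ('r, 'n) module
      \<Rightarrow> ('m \<Rightarrow> 'n) \<Rightarrow> ('x \<times> 'm \<Rightarrow> 'k) set \<Rightarrow> ('x \<times> 'n \<Rightarrow> 'k) set"
  where "tensor_map K R X N f =
    quot_lift K (tensor K R X N) (\<lambda>(x, m). pure_tensor K R X N x (f m))"

definition tensor_functor ::
    "('k, 'c) ring_scheme \<Rightarrow> ('k, 'r) module \<Rightarrow> ('r, 'x) module
      \<Rightarrow> ('r, 'm, 'k, ('x \<times> 'm \<Rightarrow> 'k) set) mod_functor"
  where "tensor_functor K R X =
    \<lparr>obj_map = tensor K R X, mor_map = (\<lambda>M N f. tensor_map K R X N f)\<rparr>"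


section \<open>Twisted partial actions and crossed products\<close>

text \<open>The family \<open>u\<close> consists of the central idempotents \<open>1\<^sub>g\<close>, and \<open>D\<^sub>g\<close> is \<open>Idl\<^bsub>A\<^esub> {u g}\<close>.\<close>

definition partial_dom :: "('k, 'a) module \<Rightarrow> ('g \<Rightarrow> 'a) \<Rightarrow> 'g \<Rightarrow> 'a set"
  where "partial_dom A u g = Idl\<^bsub>A\<^esub> {u g}"

definition partial_dom_ring :: "('k, 'a) module \<Rightarrow> ('g \<Rightarrow> 'a) \<Rightarrow> 'g \<Rightarrow> ('k, 'a) module"
  where "partial_dom_ring A u g = A\<lparr>carrier := partial_dom A u g, one := u g\<rparr>"

locale unital_partial_action =
  fixes K :: "'k ring" and G :: "'g monoid" and A :: "('k, 'a) module"
    and u :: "'g \<Rightarrow> 'a" and \<theta> :: "'g \<Rightarrow> 'a \<Rightarrow> 'a"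
  assumes field_K: "field K" and group_G: "group G" and algebra_A: "kalgebra K A"
    and u_closed: "g \<in> carrier G \<Longrightarrow> u g \<in> carrier A"
    and u_idem: "g \<in> carrier G \<Longrightarrow> u g \<otimes>\<^bsub>A\<^esub> u g = u g"
    and u_central: "\<lbrakk>g \<in> carrier G; a \<in> carrier A\<rbrakk> \<Longrightarrow> u g \<otimes>\<^bsub>A\<^esub> a = a \<otimes>\<^bsub>A\<^esub> u g"
    and theta_iso: "g \<in> carrier G \<Longrightarrow>
      \<theta> g \<in> ring_iso (partial_dom_ring A u (inv\<^bsub>G\<^esub> g)) (partial_dom_ring A u g)"
    and theta_smult: "\<lbrakk>g \<in> carrier G; c \<in> carrier K; a \<in> partial_dom A u (inv\<^bsub>G\<^esub> g)\<rbrakk> \<Longrightarrow>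
      \<theta> g (c \<odot>\<^bsub>A\<^esub> a) = c \<odot>\<^bsub>A\<^esub> \<theta> g a"
    and dom_one: "partial_dom A u \<one>\<^bsub>G\<^esub> = carrier A"
    and theta_one: "a \<in> carrier A \<Longrightarrow> \<theta> \<one>\<^bsub>G\<^esub> a = a"
    and theta_dom: "\<lbrakk>g \<in> carrier G; h \<in> carrier G\<rbrakk> \<Longrightarrow>
      \<theta> g ` (ideal_prod A (partial_dom A u (inv\<^bsub>G\<^esub> g)) (partial_dom A u h)) =
      ideal_prod A (partial_dom A u g) (partial_dom A u (g \<otimes>\<^bsub>G\<^esub> h))"
    and theta_comp: "\<lbrakk>g \<in> carrier G; h \<in> carrier G;
        a \<in> ideal_prod A (partial_dom A u (inv\<^bsub>G\<^esub> h)) (partial_dom A u (inv\<^bsub>G\<^esub> (g \<otimes>\<^bsub>G\<^esub> h)))\<rbrakk> \<Longrightarrow>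
      \<theta> g (\<theta> h a) = \<theta> (g \<otimes>\<^bsub>G\<^esub> h) a"

definition twist_elem ::
    "'g monoid \<Rightarrow> ('k, 'a) module \<Rightarrow> ('g \<Rightarrow> 'a) \<Rightarrow> ('g \<Rightarrow> 'g \<Rightarrow> 'k) \<Rightarrow> 'g \<Rightarrow> 'g \<Rightarrow> 'a"
  where "twist_elem G A u \<sigma> g h = \<sigma> g h \<odot>\<^bsub>A\<^esub> (u g \<otimes>\<^bsub>A\<^esub> u (g \<otimes>\<^bsub>G\<^esub> h))"

locale twisted_partial_action = unital_partial_action K G A u \<theta>
  for K :: "'k ring" and G :: "'g monoid" and A :: "('k, 'a) module"
    and u :: "'g \<Rightarrow> 'a" and \<theta> :: "'g \<Rightarrow> 'a \<Rightarrow> 'a" +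
  fixes \<sigma> :: "'g \<Rightarrow> 'g \<Rightarrow> 'k"
  assumes twist_closed: "\<lbrakk>g \<in> carrier G; h \<in> carrier G\<rbrakk> \<Longrightarrow> \<sigma> g h \<in> carrier K"
    and twist_zero_iff: "\<lbrakk>g \<in> carrier G; h \<in> carrier G\<rbrakk> \<Longrightarrow>
      \<sigma> g h = \<zero>\<^bsub>K\<^esub> \<longleftrightarrow> u g \<otimes>\<^bsub>A\<^esub> u (g \<otimes>\<^bsub>G\<^esub> h) = \<zero>\<^bsub>A\<^esub>"
    and twist_one_left: "g \<in> carrier G \<Longrightarrow> twist_elem G A u \<sigma> \<one>\<^bsub>G\<^esub> g = u g"
    and twist_one_right: "g \<in> carrier G \<Longrightarrow> twist_elem G A u \<sigma> g \<one>\<^bsub>G\<^esub> = u g"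
    and twist_cocycle: "\<lbrakk>g \<in> carrier G; h \<in> carrier G; t \<in> carrier G\<rbrakk> \<Longrightarrow>
      \<theta> g (u (inv\<^bsub>G\<^esub> g) \<otimes>\<^bsub>A\<^esub> twist_elem G A u \<sigma> h t) \<otimes>\<^bsub>A\<^esub> twist_elem G A u \<sigma> g (h \<otimes>\<^bsub>G\<^esub> t) =
      twist_elem G A u \<sigma> g h \<otimes>\<^bsub>A\<^esub> twist_elem G A u \<sigma> (g \<otimes>\<^bsub>G\<^esub> h) t"

definition hom_elem :: "('k, 'a) module \<Rightarrow> 'a \<Rightarrow> 'g \<Rightarrow> 'g \<Rightarrow> 'a"
  where "hom_elem A a g = (\<lambda>t. if t = g then a else \<zero>\<^bsub>A\<^esub>)"

text \<open>The element \<open>\<Sum>\<^sub>g a\<^sub>g \<delta>\<^sub>g\<close> is the function \<open>g \<mapsto> a\<^sub>g\<close>, and \<open>hom_elem A a g\<close> is \<open>a \<delta>\<^sub>g\<close>. In the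
  product, the coefficient of \<open>\<delta>\<^sub>t\<close> collects the pairs \<open>(g, h)\<close> with \<open>h = g\<^sup>-\<^sup>1 t\<close>.\<close>

definition crossed_product ::
    "'g monoid \<Rightarrow> ('k, 'a) module \<Rightarrow> ('g \<Rightarrow> 'a) \<Rightarrow> ('g \<Rightarrow> 'a \<Rightarrow> 'a) \<Rightarrow> ('g \<Rightarrow> 'g \<Rightarrow> 'k)
      \<Rightarrow> ('k, 'g \<Rightarrow> 'a) module"
  where "crossed_product G A u \<theta> \<sigma> =
    \<lparr>carrier = {f. (\<forall>g\<in>carrier G. f g \<in> partial_dom A u g) \<and> (\<forall>g. g \<notin> carrier G \<longrightarrow> f g = \<zero>\<^bsub>A\<^esub>) \<and>
                   finite {g. f g \<noteq> \<zero>\<^bsub>A\<^esub>}},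
     mult = (\<lambda>f f' t. if t \<in> carrier G then
       (\<Oplus>\<^bsub>A\<^esub>g\<in>{g. f g \<noteq> \<zero>\<^bsub>A\<^esub>}.
         \<sigma> g (inv\<^bsub>G\<^esub> g \<otimes>\<^bsub>G\<^esub> t) \<odot>\<^bsub>A\<^esub>
           (f g \<otimes>\<^bsub>A\<^esub> \<theta> g (u (inv\<^bsub>G\<^esub> g) \<otimes>\<^bsub>A\<^esub> f' (inv\<^bsub>G\<^esub> g \<otimes>\<^bsub>G\<^esub> t))))
       else \<zero>\<^bsub>A\<^esub>),
     one = hom_elem A \<one>\<^bsub>A\<^esub> \<one>\<^bsub>G\<^esub>,
     zero = (\<lambda>g. \<zero>\<^bsub>A\<^esub>),
     add = (\<lambda>f f' g. f g \<oplus>\<^bsub>A\<^esub> f' g),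
     smult = (\<lambda>c f g. c \<odot>\<^bsub>A\<^esub> f g)\<rparr>"

definition xi :: "'k ring \<Rightarrow> 'g monoid \<Rightarrow> ('g \<Rightarrow> 'g \<Rightarrow> 'k) \<Rightarrow> 'g \<Rightarrow> 'k"
  where "xi K G \<sigma> g =
    (if g \<otimes>\<^bsub>G\<^esub> g = \<one>\<^bsub>G\<^esub> \<and> \<sigma> g g \<noteq> \<zero>\<^bsub>K\<^esub> then inv\<^bsub>K\<^esub> (\<sigma> g g) else \<one>\<^bsub>K\<^esub>)"

definition twist' :: "'k ring \<Rightarrow> 'g monoid \<Rightarrow> ('g \<Rightarrow> 'g \<Rightarrow> 'k) \<Rightarrow> 'g \<Rightarrow> 'g \<Rightarrow> 'k"
  where "twist' K G \<sigma> g h = \<sigma> g h \<otimes>\<^bsub>K\<^esub> \<sigma> (inv\<^bsub>G\<^esub> h) (inv\<^bsub>G\<^esub> g)"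

definition twist'' :: "'k ring \<Rightarrow> 'g monoid \<Rightarrow> ('g \<Rightarrow> 'g \<Rightarrow> 'k) \<Rightarrow> 'g \<Rightarrow> 'g \<Rightarrow> 'k"
  where "twist'' K G \<sigma> g h =
    xi K G \<sigma> g \<otimes>\<^bsub>K\<^esub> xi K G \<sigma> h \<otimes>\<^bsub>K\<^esub> inv\<^bsub>K\<^esub> (xi K G \<sigma> (g \<otimes>\<^bsub>G\<^esub> h)) \<otimes>\<^bsub>K\<^esub> twist' K G \<sigma> g h"


section \<open>The twisted partial group algebra\<close>

definition par_rels :: "'k ring \<Rightarrow> 'g monoid \<Rightarrow> ('g \<Rightarrow> 'g \<Rightarrow> 'k) \<Rightarrow> ('g list \<Rightarrow> 'k) set"
  where "par_rels K G \<rho> =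
    (let F = free_algebra K (carrier G); b = (\<lambda>g. kdelta K [g]) in
      {b (inv\<^bsub>G\<^esub> g) \<otimes>\<^bsub>F\<^esub> b (g \<otimes>\<^bsub>G\<^esub> h) | g h. g \<in> carrier G \<and> h \<in> carrier G \<and> \<rho> g h = \<zero>\<^bsub>K\<^esub>} \<union>
      {b (g \<otimes>\<^bsub>G\<^esub> h) \<otimes>\<^bsub>F\<^esub> b (inv\<^bsub>G\<^esub> h) | g h. g \<in> carrier G \<and> h \<in> carrier G \<and> \<rho> g h = \<zero>\<^bsub>K\<^esub>} \<union>
      {(b (inv\<^bsub>G\<^esub> g) \<otimes>\<^bsub>F\<^esub> b g \<otimes>\<^bsub>F\<^esub> b h) \<ominus>\<^bsub>F\<^esub> (\<rho> g h \<odot>\<^bsub>F\<^esub> (b (inv\<^bsub>G\<^esub> g) \<otimes>\<^bsub>F\<^esub> b (g \<otimes>\<^bsub>G\<^esub> h))) | g h.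
        g \<in> carrier G \<and> h \<in> carrier G} \<union>
      {(b g \<otimes>\<^bsub>F\<^esub> b h \<otimes>\<^bsub>F\<^esub> b (inv\<^bsub>G\<^esub> h)) \<ominus>\<^bsub>F\<^esub> (\<rho> g h \<odot>\<^bsub>F\<^esub> (b (g \<otimes>\<^bsub>G\<^esub> h) \<otimes>\<^bsub>F\<^esub> b (inv\<^bsub>G\<^esub> h))) | g h.
        g \<in> carrier G \<and> h \<in> carrier G} \<union>
      {(b g \<otimes>\<^bsub>F\<^esub> b \<one>\<^bsub>G\<^esub>) \<ominus>\<^bsub>F\<^esub> b g | g. g \<in> carrier G} \<union>
      {(b \<one>\<^bsub>G\<^esub> \<otimes>\<^bsub>F\<^esub> b g) \<ominus>\<^bsub>F\<^esub> b g | g. g \<in> carrier G})"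

definition par_ideal :: "'k ring \<Rightarrow> 'g monoid \<Rightarrow> ('g \<Rightarrow> 'g \<Rightarrow> 'k) \<Rightarrow> ('g list \<Rightarrow> 'k) set"
  where "par_ideal K G \<rho> = Idl\<^bsub>free_algebra K (carrier G)\<^esub> (par_rels K G \<rho>)"

definition kpar :: "'k ring \<Rightarrow> 'g monoid \<Rightarrow> ('g \<Rightarrow> 'g \<Rightarrow> 'k) \<Rightarrow> ('k, ('g list \<Rightarrow> 'k) set) module"
  where "kpar K G \<rho> = quot_module (free_algebra K (carrier G)) (par_ideal K G \<rho>)"

definition par_gen :: "'k ring \<Rightarrow> 'g monoid \<Rightarrow> ('g \<Rightarrow> 'g \<Rightarrow> 'k) \<Rightarrow> 'g \<Rightarrow> ('g list \<Rightarrow> 'k) set"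
  where "par_gen K G \<rho> g = par_ideal K G \<rho> +>\<^bsub>free_algebra K (carrier G)\<^esub> kdelta K [g]"

definition par_idem :: "'k ring \<Rightarrow> 'g monoid \<Rightarrow> ('g \<Rightarrow> 'g \<Rightarrow> 'k) \<Rightarrow> 'g \<Rightarrow> ('g list \<Rightarrow> 'k) set"
  where "par_idem K G \<rho> g =
    (if \<rho> (inv\<^bsub>G\<^esub> g) g \<noteq> \<zero>\<^bsub>K\<^esub>
     then inv\<^bsub>K\<^esub> (\<rho> (inv\<^bsub>G\<^esub> g) g) \<odot>\<^bsub>kpar K G \<rho>\<^esub>
       (par_gen K G \<rho> g \<otimes>\<^bsub>kpar K G \<rho>\<^esub> par_gen K G \<rho> (inv\<^bsub>G\<^esub> g))
     else \<zero>\<^bsub>kpar K G \<rho>\<^esub>)"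

definition par_B :: "'k ring \<Rightarrow> 'g monoid \<Rightarrow> ('g \<Rightarrow> 'g \<Rightarrow> 'k) \<Rightarrow> ('k, ('g list \<Rightarrow> 'k) set) module"
  where "par_B K G \<rho> =
    (kpar K G \<rho>)\<lparr>carrier := subalgebra_gen K (kpar K G \<rho>) (par_idem K G \<rho> ` carrier G)\<rparr>"


section \<open>The functors\<close>

text \<open>An action of \<open>kpar K G (twist'' K G \<sigma>)\<close> is given by the actions of the generators: a word
  acts by iteration (from the right end for left modules, from the left end for right modules),
  and this is extended linearly and passed to the quotient.

  \<open>par_B_right\<close> is the right module with \<open>b \<cdot> [g] = \<xi>(g) [g\<^sup>-\<^sup>1] b [g]\<close>.\<close>

definition par_B_right ::
    "'k ring \<Rightarrow> 'g monoid \<Rightarrow> ('g \<Rightarrow> 'g \<Rightarrow> 'k) \<Rightarrow> (('g list \<Rightarrow> 'k) set, ('g list \<Rightarrow> 'k) set) module"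
  where "par_B_right K G \<sigma> =
    (let B = par_B K G \<sigma>;
         act = (\<lambda>g b. xi K G \<sigma> g \<odot>\<^bsub>B\<^esub> (par_gen K G \<sigma> (inv\<^bsub>G\<^esub> g) \<otimes>\<^bsub>B\<^esub> b \<otimes>\<^bsub>B\<^esub> par_gen K G \<sigma> g))
     in with_smult B (\<lambda>X b. quot_lift K B (\<lambda>w. fold act w b) X))"

definition bimodule_act ::
    "'k ring \<Rightarrow> 'g monoid \<Rightarrow> ('k, 'a) module \<Rightarrow> ('g \<Rightarrow> 'a) \<Rightarrow> ('g \<Rightarrow> 'a \<Rightarrow> 'a) \<Rightarrow> ('g \<Rightarrow> 'g \<Rightarrow> 'k)
      \<Rightarrow> ((('g \<Rightarrow> 'a) \<times> ('g \<Rightarrow> 'a) \<Rightarrow> 'k) set, 'm) module \<Rightarrow> 'g \<Rightarrow> 'm \<Rightarrow> 'm"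
  where "bimodule_act K G A u \<theta> \<sigma> M g m =
    (let L = crossed_product G A u \<theta> \<sigma> in
      xi K G \<sigma> g \<odot>\<^bsub>scalars (env K L) M\<^esub>
        (env_tensor K L (hom_elem A (u g) g) (hom_elem A (u (inv\<^bsub>G\<^esub> g)) (inv\<^bsub>G\<^esub> g)) \<odot>\<^bsub>M\<^esub> m))"

definition functor_F1 ::
    "'k ring \<Rightarrow> 'g monoid \<Rightarrow> ('k, 'a) module \<Rightarrow> ('g \<Rightarrow> 'a) \<Rightarrow> ('g \<Rightarrow> 'a \<Rightarrow> 'a) \<Rightarrow> ('g \<Rightarrow> 'g \<Rightarrow> 'k)
      \<Rightarrow> ((('g \<Rightarrow> 'a) \<times> ('g \<Rightarrow> 'a) \<Rightarrow> 'k) set, 'm,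
          ('g list \<Rightarrow> 'k) set, ('a \<times> 'm \<Rightarrow> 'k) set) mod_functor"
  where "functor_F1 K G A u \<theta> \<sigma> =
    (let res = restrict_env K (crossed_product G A u \<theta> \<sigma>) (\<lambda>a. hom_elem A a \<one>\<^bsub>G\<^esub>);
         T = (\<lambda>M. tensor K (env K A) (right_regular K A) (res M));
         t = (\<lambda>M. pure_tensor K (env K A) (right_regular K A) (res M));
         act = (\<lambda>M g. quot_lift K (T M) (\<lambda>(a, m).
                  t M (\<theta> g (u (inv\<^bsub>G\<^esub> g) \<otimes>\<^bsub>A\<^esub> a)) (bimodule_act K G A u \<theta> \<sigma> M g m)))
     in \<lparr>obj_map = (\<lambda>M. with_smult (T M) (\<lambda>X y. quot_lift K (T M) (\<lambda>w. foldr (act M) w y) X)),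
         mor_map = (\<lambda>M N f. tensor_map K (env K A) (right_regular K A) (res N) f)\<rparr>)"

definition functor_F2 ::
    "'k ring \<Rightarrow> 'g monoid \<Rightarrow> ('g \<Rightarrow> 'g \<Rightarrow> 'k)
      \<Rightarrow> (('g list \<Rightarrow> 'k) set, 'n, 'k, (('g list \<Rightarrow> 'k) set \<times> 'n \<Rightarrow> 'k) set) mod_functor"
  where "functor_F2 K G \<sigma> = tensor_functor K (kpar K G (twist'' K G \<sigma>)) (par_B_right K G \<sigma>)"

definition functor_F ::
    "'k ring \<Rightarrow> ('k, 'l) module
      \<Rightarrow> (('l \<times> 'l \<Rightarrow> 'k) set, 'm, 'k, ('l \<times> 'm \<Rightarrow> 'k) set) mod_functor"
  where "functor_F K L = tensor_functor K (env K L) (right_regular K L)"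

end

theory Submission
  imports Defs
begin

text \<open>
For an algebra \<open>R\<close> and an \<open>R\<close>-bimodule \<open>N\<close>, the tensor product \<open>R \<otimes> N\<close> over \<open>R\<^sup>e\<close> is the quotient
\<open>N/[R, N]\<close>: every element is \<open>1 \<otimes> n\<close>, and \<open>1 \<otimes> r n = 1 \<otimes> n r\<close>. So the theorem compares
\<open>F M = M/[\<Lambda>, M]\<close> with what \<open>F\<^sub>2\<close> makes of \<open>F\<^sub>1 M = M/[A, M]\<close>. Write \<open>d\<^sub>g\<close> for \<open>1\<^sub>g \<delta>\<^sub>g\<close>.

On \<open>M/[A, M]\<close> the generator \<open>[g]\<close> acts by \<open>m \<mapsto> \<xi>(g) d\<^sub>g m d\<^sub>h\<close> with \<open>h = g\<^sup>-\<^sup>1\<close>. As \<open>\<Lambda>\<close> is generated by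
\<open>A\<close> and the \<open>d\<^sub>g\<close>, passing to \<open>M/[\<Lambda>, M]\<close> means imposing \<open>d\<^sub>g m = m d\<^sub>g\<close>. The scalars are chosen such
that \<open>\<xi>(g) d\<^sub>g d\<^sub>h = 1\<^sub>g\<close>, whether or not \<open>1\<^sub>g\<close> vanishes (lemma \<open>xi_d_inv\<close>, resting on \<open>xi_norm\<close>);
substituting \<open>m = n d\<^sub>h\<close> therefore turns the condition into \<open>[g] n = 1\<^sub>h n\<close>. Tensoring with \<open>B\<close> imposes
exactly this: \<open>B\<close> is generated by \<open>1\<close> as a right module, \<open>1 \<cdot> [g] = e\<^sub>h\<close>, and multiplication
by \<open>e\<^sub>h\<close> is the action of \<open>[h] [g]\<close>, which on \<open>M/[A, M]\<close> is multiplication by \<open>1\<^sub>h\<close>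
(lemmas \<open>conj_B_one_elem\<close>, \<open>B_act_e\<close>, \<open>BT_e\<close>, \<open>cls2_conj_M\<close>).

Explicitly, the relations of \<open>\<kappa>\<^sub>p\<^sub>a\<^sub>r G\<close> for the twist \<open>\<sigma>\<close> hold for the \<open>d\<^sub>g\<close>, which gives a homomorphism
\<open>\<Psi>\<close> to \<open>\<Lambda>\<close> with \<open>\<Psi>(e\<^sub>g) = 1\<^sub>g\<close>. The natural isomorphism is \<open>\<eta>(b \<otimes> (a \<otimes> m)) = \<Psi>(b) a \<otimes> m\<close>
with inverse \<open>\<zeta>(l \<otimes> m) = 1 \<otimes> (1 \<otimes> l m)\<close>. That \<open>\<zeta>\<close> is well defined is the computation just sketched
(\<open>cls2_d\<close>, \<open>cls2_comm\<close>); for \<open>\<eta>\<close> it is \<open>eta_at_conj_B\<close>. The composite \<open>\<eta> \<circ> \<zeta>\<close> is visibly the identity, and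
\<open>\<zeta> \<circ> \<eta>\<close> is the identity by induction on the products of idempotents that span \<open>B\<close> (\<open>BT_Psi\<close>).

Before that, the objects have to be shown to exist: the crossed product is associative
(\<open>mon_assoc\<close>), the \<open>e\<^sub>g\<close> commute and \<open>B\<close> is stable under conjugation (\<open>gen_e\<close>, \<open>B_gen\<close>), and conjugation
satisfies the relations for \<open>\<sigma>''\<close> on \<open>B\<close> and on \<open>M/[A, M]\<close> (\<open>conj_B_rel\<close>, \<open>conj_M_rel\<close>). The last two
statements become module structures through the universal property of \<open>\<kappa>\<^sub>p\<^sub>a\<^sub>r G\<close> (locale \<open>word_action\<close>), and
maps out of tensor products come from the universal property of tensor products (\<open>lift_coset\<close>).
\<close>

section \<open>Linear maps, generated submodules and quotient modules\<close>

lemma module_homI: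
  assumes "\<And>x. x \<in> carrier M \<Longrightarrow> f x \<in> carrier N"
    and "\<And>x y. \<lbrakk>x \<in> carrier M; y \<in> carrier M\<rbrakk> \<Longrightarrow> f (x \<oplus>\<^bsub>M\<^esub> y) = f x \<oplus>\<^bsub>N\<^esub> f y"
    and "\<And>r x. \<lbrakk>r \<in> carrier R; x \<in> carrier M\<rbrakk> \<Longrightarrow> f (r \<odot>\<^bsub>M\<^esub> x) = r \<odot>\<^bsub>N\<^esub> f x"
  shows "f \<in> module_hom R M N"
  using assms by (auto simp: module_hom_def)

lemma module_hom_closed: "\<lbrakk>f \<in> module_hom R M N; x \<in> carrier M\<rbrakk> \<Longrightarrow> f x \<in> carrier N"
  and module_hom_add:
    "\<lbrakk>f \<in> module_hom R M N; x \<in> carrier M; y \<in> carrier M\<rbrakk> \<Longrightarrow> f (x \<oplus>\<^bsub>M\<^esub> y) = f x \<oplus>\<^bsub>N\<^esub> f y"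
  and module_hom_smult:
    "\<lbrakk>f \<in> module_hom R M N; r \<in> carrier R; x \<in> carrier M\<rbrakk> \<Longrightarrow> f (r \<odot>\<^bsub>M\<^esub> x) = r \<odot>\<^bsub>N\<^esub> f x"
  by (auto simp: module_hom_def)

lemma module_hom_zero:
  assumes "module K V" "module K W" "f \<in> module_hom K V W"
  shows "f \<zero>\<^bsub>V\<^esub> = \<zero>\<^bsub>W\<^esub>"
proof -
  interpret V: module K V by fact
  interpret W: module K W by fact
  have "f \<zero>\<^bsub>V\<^esub> = f (\<zero>\<^bsub>K\<^esub> \<odot>\<^bsub>V\<^esub> \<zero>\<^bsub>V\<^esub>)" by simp
  also have "\<dots> = \<zero>\<^bsub>K\<^esub> \<odot>\<^bsub>W\<^esub> f \<zero>\<^bsub>V\<^esub>" by (rule module_hom_smult[OF assms(3)]) auto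
  also have "\<dots> = \<zero>\<^bsub>W\<^esub>" using module_hom_closed[OF assms(3)] by simp
  finally show ?thesis .
qed

lemma module_hom_uminus:
  assumes "module K V" "module K W" "f \<in> module_hom K V W" "x \<in> carrier V"
  shows "f (\<ominus>\<^bsub>V\<^esub> x) = \<ominus>\<^bsub>W\<^esub> f x"
proof -
  interpret V: module K V by fact
  interpret W: module K W by fact
  have fx: "f x \<in> carrier W" by (rule module_hom_closed[OF assms(3,4)])
  have "f (\<ominus>\<^bsub>V\<^esub> x) \<oplus>\<^bsub>W\<^esub> f x = f (\<ominus>\<^bsub>V\<^esub> x \<oplus>\<^bsub>V\<^esub> x)"
    using assms(4) by (simp add: module_hom_add[OF assms(3)])
  also have "\<dots> = \<zero>\<^bsub>W\<^esub>" using assms(4) by (simp add: V.M.l_neg module_hom_zero[OF assms(1-3)])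
  finally show ?thesis
    using fx assms(4) module_hom_closed[OF assms(3)] by (intro W.M.minus_equality[symmetric]) auto
qed

lemma module_hom_minus:
  assumes "module K V" "module K W" "f \<in> module_hom K V W" "x \<in> carrier V" "y \<in> carrier V"
  shows "f (x \<ominus>\<^bsub>V\<^esub> y) = f x \<ominus>\<^bsub>W\<^esub> f y"
proof -
  interpret V: module K V by fact
  show ?thesis using assms
    by (simp add: a_minus_def module_hom_add[OF assms(3)] module_hom_uminus[OF assms(1-3)])
qed

lemma kernel_submodule:
  assumes "module K V" "module K W" "f \<in> module_hom K V W"
  shows "submodule {x \<in> carrier V. f x = \<zero>\<^bsub>W\<^esub>} K V"
proof -
  interpret V: module K V by fact
  interpret W: module K W by fact
  show ?thesis
    by (rule V.submoduleI)
      (auto simp: module_hom_zero[OF assms] module_hom_uminus[OF assms] module_hom_add[OF assms(3)]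
        module_hom_smult[OF assms(3)])
qed

lemma submodule_gen_minimal: "\<lbrakk>submodule W K V; S \<subseteq> W\<rbrakk> \<Longrightarrow> submodule_gen K V S \<subseteq> W"
  by (auto simp: submodule_gen_def)

lemma submodule_gen_incl: "S \<subseteq> submodule_gen K V S"
  by (auto simp: submodule_gen_def)

lemma submodule_gen_submodule:
  assumes "module K V" "S \<subseteq> carrier V"
  shows "submodule (submodule_gen K V S) K V"
proof -
  interpret V: module K V by fact
  note E = V.submoduleE
  show ?thesis
  proof (rule V.submoduleI)
    show "submodule_gen K V S \<subseteq> carrier V"
      by (rule submodule_gen_minimal[OF V.carrier_is_submodule assms(2)])
    show "\<zero>\<^bsub>V\<^esub> \<in> submodule_gen K V S"
      by (auto simp: submodule_gen_def dest!: submodule.axioms(1) subgroup.one_closed)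
  qed (auto simp: submodule_gen_def intro: E)
qed

lemma with_smult_simps [simp]:
  "carrier (with_smult M s) = carrier M" "monoid.mult (with_smult M s) = monoid.mult M"
  "one (with_smult M s) = one M" "zero (with_smult M s) = zero M"
  "add (with_smult M s) = add M" "smult (with_smult M s) = s"
  by (auto simp: with_smult_def)

lemma abelian_group_cong:
  assumes "abelian_group V" "carrier W = carrier V" "zero W = zero V" "add W = add V"
  shows "abelian_group W"
  using abelian_groupE[OF assms(1)] by (intro abelian_groupI) (simp_all add: assms(2-4))

lemma module_cong:
  assumes "module K V" "carrier W = carrier V" "zero W = zero V" "add W = add V" "smult W = smult V"
  shows "module K W"
proof -
  interpret V: module K V by fact
  show ?thesis
    by (rule moduleI)
      (use assms(2-5) in \<open>auto simp: V.smult_l_distr V.smult_r_distr V.smult_assoc1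
          intro: V.R.is_cring abelian_group_cong[OF V.M.abelian_group_axioms]\<close>)
qed

lemma ring_cong:
  assumes "ring R" "carrier S = carrier R" "zero S = zero R" "add S = add R"
    "monoid.mult S = monoid.mult R" "one S = one R"
  shows "ring S"
proof -
  interpret R: ring R by fact
  show ?thesis
    by (rule ringI, rule abelian_group_cong[OF R.abelian_group_axioms], auto simp: assms(2-6)
      R.l_distr R.r_distr intro!: monoidI R.m_assoc)
qed

lemma left_module_of_module:
  assumes "module K V" shows "left_module K V"
proof -
  interpret V: module K V by fact
  show ?thesis
    by unfold_locales (auto simp: V.smult_l_distr V.smult_r_distr V.smult_assoc1)
qed

text \<open>Every operation on cosets is expressed through representatives once and for all, so that later
arguments never look inside a coset.\<close>

locale quotient_module = V?: module K V + W?: submodule W K V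
  for K :: "('k, 'c) ring_scheme" and V :: "('k, 'v) module" and W
begin

abbreviation coset :: "'v \<Rightarrow> 'v set"
  where "coset x \<equiv> W +>\<^bsub>V\<^esub> x"

lemma abelian_subgroup_W: "abelian_subgroup W V"
  by (rule abelian_subgroupI3) (auto intro: additive_subgroup.intro W.subgroup_axioms V.M.abelian_group_axioms)

sublocale S: abelian_subgroup W V by (rule abelian_subgroup_W)

lemma quot_carrier: "carrier (quot_module V W) = coset ` carrier V"
  by (auto simp: quot_module_def FactRing_def A_RCOSETS_def')

lemma coset_closed: "x \<in> carrier V \<Longrightarrow> coset x \<in> carrier (quot_module V W)"
  by (auto simp: quot_carrier)

lemma quot_add:
  "\<lbrakk>x \<in> carrier V; y \<in> carrier V\<rbrakk> \<Longrightarrow> coset x \<oplus>\<^bsub>quot_module V W\<^esub> coset y = coset (x \<oplus>\<^bsub>V\<^esub> y)"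
  by (simp add: quot_module_def FactRing_def S.a_rcos_sum)

lemma coset_zero: "coset \<zero>\<^bsub>V\<^esub> = \<zero>\<^bsub>quot_module V W\<^esub>"
  using S.a_subset by (auto simp: quot_module_def FactRing_def intro: V.M.a_coset_add_zero)

lemma coset_mem: "\<lbrakk>w \<in> W; x \<in> carrier V\<rbrakk> \<Longrightarrow> coset (w \<oplus>\<^bsub>V\<^esub> x) = coset x"
  using V.M.a_coset_add_assoc[of W w x] V.M.a_coset_join2[of w W] S.a_subset W.subgroup_axioms
  by (auto dest!: subsetD)

lemma coset_eqI:
  assumes "x \<ominus>\<^bsub>V\<^esub> y \<in> W" "x \<in> carrier V" "y \<in> carrier V"
  shows "coset x = coset y"
proof -
  have "x = (x \<ominus>\<^bsub>V\<^esub> y) \<oplus>\<^bsub>V\<^esub> y" using assms(2,3) by (simp add: a_minus_def V.M.a_assoc V.M.l_neg)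
  thus ?thesis using coset_mem[OF assms(1,3)] by simp
qed

lemma coset_zeroI: "w \<in> W \<Longrightarrow> coset w = \<zero>\<^bsub>quot_module V W\<^esub>"
  using coset_mem[of w "\<zero>\<^bsub>V\<^esub>"] S.a_subset coset_zero by (metis V.M.r_zero V.M.zero_closed subsetD)

lemma quot_smult:
  assumes "c \<in> carrier K" "x \<in> carrier V"
  shows "c \<odot>\<^bsub>quot_module V W\<^esub> coset x = coset (c \<odot>\<^bsub>V\<^esub> x)"
proof -
  have "W <+>\<^bsub>V\<^esub> ((\<lambda>v. c \<odot>\<^bsub>V\<^esub> v) ` coset x) = coset (c \<odot>\<^bsub>V\<^esub> x)"
  proof (rule equalityI; rule subsetI)
    fix z assume "z \<in> W <+>\<^bsub>V\<^esub> ((\<lambda>v. c \<odot>\<^bsub>V\<^esub> v) ` coset x)"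
    then obtain w w' where w: "w \<in> W" "w' \<in> W" "z = w \<oplus>\<^bsub>V\<^esub> c \<odot>\<^bsub>V\<^esub> (w' \<oplus>\<^bsub>V\<^esub> x)"
      by (auto simp: set_add_def' a_r_coset_def')
    have W: "w \<in> carrier V" "w' \<in> carrier V" using w S.a_subset by auto
    have "z = (w \<oplus>\<^bsub>V\<^esub> c \<odot>\<^bsub>V\<^esub> w') \<oplus>\<^bsub>V\<^esub> c \<odot>\<^bsub>V\<^esub> x"
      using w W assms by (simp add: V.smult_r_distr V.M.a_assoc)
    moreover have "w \<oplus>\<^bsub>V\<^esub> c \<odot>\<^bsub>V\<^esub> w' \<in> W" using w assms by auto
    ultimately show "z \<in> coset (c \<odot>\<^bsub>V\<^esub> x)" by (auto simp: a_r_coset_def')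
  next
    fix z assume "z \<in> coset (c \<odot>\<^bsub>V\<^esub> x)"
    then obtain w where "w \<in> W" "z = w \<oplus>\<^bsub>V\<^esub> c \<odot>\<^bsub>V\<^esub> x" by (auto simp: a_r_coset_def')
    moreover have "x \<in> coset x" using S.a_rcos_self assms by auto
    ultimately show "z \<in> W <+>\<^bsub>V\<^esub> ((\<lambda>v. c \<odot>\<^bsub>V\<^esub> v) ` coset x)" by (auto simp: set_add_def')
  qed
  thus ?thesis by (simp add: quot_module_def)
qed

lemma quot_module_is_module: "module K (quot_module V W)"
proof (rule moduleI)
  show "cring K" by (rule V.R.is_cring)
  show "abelian_group (quot_module V W)"
  proof (rule abelian_groupI)
    fix X assume "X \<in> carrier (quot_module V W)"
    then obtain x where x: "x \<in> carrier V" "X = coset x" by (auto simp: quot_carrier)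
    show "\<exists>Y\<in>carrier (quot_module V W). Y \<oplus>\<^bsub>quot_module V W\<^esub> X = \<zero>\<^bsub>quot_module V W\<^esub>"
      by (rule bexI[of _ "coset (\<ominus>\<^bsub>V\<^esub> x)"])
        (use x in \<open>auto simp: quot_add coset_closed coset_zero[symmetric] V.M.l_neg\<close>)
  qed (auto simp: quot_carrier quot_add coset_zero[symmetric] V.M.a_ac)
qed (auto simp: quot_carrier quot_add quot_smult V.smult_l_distr V.smult_r_distr V.smult_assoc1)

text \<open>A map defined by \<open>the_elem\<close> of the image of a coset is well defined exactly when the underlying
linear map vanishes on the submodule. Every map out of a tensor product and every action of
\<open>\<kappa>\<^sub>p\<^sub>a\<^sub>r G\<close> below is controlled by this observation.\<close>

lemma the_elem_image_coset:
  assumes "module K T" "h \<in> module_hom K V T" "\<And>w. w \<in> W \<Longrightarrow> h w = \<zero>\<^bsub>T\<^esub>" "x \<in> carrier V"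
  shows "the_elem (h ` coset x) = h x"
proof -
  interpret T: module K T by fact
  have "h y = h x" if y: "y \<in> coset x" for y
  proof -
    obtain w where w: "w \<in> W" "y = w \<oplus>\<^bsub>V\<^esub> x" using y by (auto simp: a_r_coset_def')
    thus ?thesis using assms S.a_subset module_hom_closed[OF assms(2)]
      by (auto simp: module_hom_add[OF assms(2)])
  qed
  moreover have "x \<in> coset x" using S.a_rcos_self assms by auto
  ultimately have "h ` coset x = {h x}" by blast
  thus ?thesis by simp
qed

end

section \<open>Free modules\<close>

locale free_mod = cring K for K :: "('k, 'c) ring_scheme" (structure)
begin

lemma free_module_simps [simp]:
  "zero (free_module K S) = (\<lambda>x. \<zero>)" "add (free_module K S) = (\<lambda>f h x. f x \<oplus> h x)"
  "smult (free_module K S) = (\<lambda>c f x. c \<otimes> f x)"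
  by (auto simp: free_module_def)

lemma free_module_carrierI:
  "\<lbrakk>\<And>x. f x \<in> carrier K; finite F; F \<subseteq> S; \<And>x. x \<notin> F \<Longrightarrow> f x = \<zero>\<rbrakk> \<Longrightarrow> f \<in> carrier (free_module K S)"
  by (auto simp: free_module_def intro: finite_subset[of _ F])

lemma free_module_carrierD:
  assumes "f \<in> carrier (free_module K S)"
  shows "f x \<in> carrier K" "finite {x. f x \<noteq> \<zero>}" "{x. f x \<noteq> \<zero>} \<subseteq> S" "x \<notin> S \<Longrightarrow> f x = \<zero>"
  using assms by (auto simp: free_module_def)

lemma free_module_is_module: "module K (free_module K S)"
proof (rule moduleI)
  show "cring K" by (rule is_cring)
  show "abelian_group (free_module K S)"
  proof (rule abelian_groupI)
    fix f g assume f: "f \<in> carrier (free_module K S)" and g: "g \<in> carrier (free_module K S)"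
    show "f \<oplus>\<^bsub>free_module K S\<^esub> g \<in> carrier (free_module K S)"
      by (rule free_module_carrierI[of _ "{x. f x \<noteq> \<zero>} \<union> {x. g x \<noteq> \<zero>}"])
        (use free_module_carrierD[OF f] free_module_carrierD[OF g] in auto)
  next
    fix f assume f: "f \<in> carrier (free_module K S)"
    have "(\<lambda>x. \<ominus> f x) \<in> carrier (free_module K S)"
      by (rule free_module_carrierI[of _ "{x. f x \<noteq> \<zero>}"]) (use free_module_carrierD[OF f] in auto)
    thus "\<exists>y\<in>carrier (free_module K S). y \<oplus>\<^bsub>free_module K S\<^esub> f = \<zero>\<^bsub>free_module K S\<^esub>"
      by (rule bexI[rotated]) (use free_module_carrierD(1)[OF f] in \<open>auto simp: l_neg\<close>)
  qed (auto simp: fun_eq_iff a_ac free_module_carrierD(1)[of _ S] intro: free_module_carrierI[of _ "{}"])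
next
  fix c f assume c: "c \<in> carrier K" and f: "f \<in> carrier (free_module K S)"
  show "c \<odot>\<^bsub>free_module K S\<^esub> f \<in> carrier (free_module K S)"
    by (rule free_module_carrierI[of _ "{x. f x \<noteq> \<zero>}"]) (use c free_module_carrierD[OF f] in auto)
qed (auto simp: free_module_carrierD(1)[of _ S] fun_eq_iff l_distr r_distr m_assoc)

lemma kdelta_closed: "x \<in> S \<Longrightarrow> kdelta K x \<in> carrier (free_module K S)"
  by (rule free_module_carrierI[of _ "{x}"]) (auto simp: kdelta_def)

text \<open>Induction on the support: splitting off the value at one point lowers it.\<close>

lemma free_module_induct [consumes 1, case_names zero single add]:
  assumes "f \<in> carrier (free_module K S)"
    and "P (\<lambda>x. \<zero>)"
    and single: "\<And>c x. \<lbrakk>c \<in> carrier K; x \<in> S\<rbrakk> \<Longrightarrow> P (c \<odot>\<^bsub>free_module K S\<^esub> kdelta K x)"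
    and add: "\<And>f g. \<lbrakk>f \<in> carrier (free_module K S); g \<in> carrier (free_module K S); P f; P g\<rbrakk>
        \<Longrightarrow> P (f \<oplus>\<^bsub>free_module K S\<^esub> g)"
  shows "P f"
proof -
  have "finite F \<Longrightarrow> F \<subseteq> S \<Longrightarrow> f \<in> carrier (free_module K S) \<Longrightarrow> {x. f x \<noteq> \<zero>} \<subseteq> F \<Longrightarrow> P f" for F f
  proof (induction F arbitrary: f rule: finite_induct)
    case empty
    hence "f = (\<lambda>x. \<zero>)" by auto
    thus ?case using assms(2) by simp
  next
    case (insert a F)
    note f = free_module_carrierD[OF insert.prems(2)]
    define g where "g = f(a := \<zero>)"
    have g: "g \<in> carrier (free_module K S)"
      by (rule free_module_carrierI[of _ F]) (use f insert g_def in auto)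
    have "f = f a \<odot>\<^bsub>free_module K S\<^esub> kdelta K a \<oplus>\<^bsub>free_module K S\<^esub> g"
      using f(1) by (auto simp: g_def kdelta_def fun_eq_iff)
    moreover have "P g" by (rule insert.IH[OF _ g]) (use insert.prems in \<open>auto simp: g_def\<close>)
    moreover have "f a \<odot>\<^bsub>free_module K S\<^esub> kdelta K a \<in> carrier (free_module K S)"
      using module.smult_closed[OF free_module_is_module] f(1) kdelta_closed[of a S] insert.prems by blast
    ultimately show ?case using add single insert.prems(1) f(1) g by (metis insert_subset)
  qed
  thus ?thesis using free_module_carrierD[OF assms(1)] assms(1) by blast
qed

end

lemma free_mod_of_module: "module K V \<Longrightarrow> free_mod K"
  by (simp add: module_def free_mod_def)

lemma lin_ext_superset:
  assumes "module K V" "f \<in> carrier (free_module K S)" "\<And>x. x \<in> S \<Longrightarrow> b x \<in> carrier V"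
    "finite F" "{x. f x \<noteq> \<zero>\<^bsub>K\<^esub>} \<subseteq> F" "F \<subseteq> S"
  shows "lin_ext K V b f = (\<Oplus>\<^bsub>V\<^esub>x\<in>F. f x \<odot>\<^bsub>V\<^esub> b x)"
proof -
  interpret V: module K V by fact
  interpret free_mod K by (rule free_mod_of_module[OF assms(1)])
  note f = free_module_carrierD[OF assms(2)]
  show ?thesis unfolding lin_ext_def
    by (rule V.M.add.finprod_mono_neutral_cong_left) (use f assms in auto)
qed

lemma lin_ext_hom:
  assumes "module K V" "\<And>x. x \<in> S \<Longrightarrow> b x \<in> carrier V"
  shows "lin_ext K V b \<in> module_hom K (free_module K S) V"
proof -
  interpret V: module K V by fact
  interpret free_mod K by (rule free_mod_of_module[OF assms(1)])
  interpret F: module K "free_module K S" by (rule free_module_is_module)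
  show ?thesis
  proof (rule module_homI)
    fix f assume f: "f \<in> carrier (free_module K S)"
    show "lin_ext K V b f \<in> carrier V" unfolding lin_ext_def
      using free_module_carrierD[OF f] assms(2) by (intro V.M.finsum_closed) auto
    fix g assume g: "g \<in> carrier (free_module K S)"
    let ?F = "{x. f x \<noteq> \<zero>\<^bsub>K\<^esub>} \<union> {x. g x \<noteq> \<zero>\<^bsub>K\<^esub>}"
    have F: "finite ?F" "?F \<subseteq> S" using free_module_carrierD[OF f] free_module_carrierD[OF g] by auto
    have "lin_ext K V b (f \<oplus>\<^bsub>free_module K S\<^esub> g) =
        (\<Oplus>\<^bsub>V\<^esub>x\<in>?F. (f \<oplus>\<^bsub>free_module K S\<^esub> g) x \<odot>\<^bsub>V\<^esub> b x)"
      by (rule lin_ext_superset[OF assms(1) F.M.a_closed[OF f g] assms(2) F(1) _ F(2)]) auto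
    also have "\<dots> = (\<Oplus>\<^bsub>V\<^esub>x\<in>?F. f x \<odot>\<^bsub>V\<^esub> b x \<oplus>\<^bsub>V\<^esub> g x \<odot>\<^bsub>V\<^esub> b x)"
      using F(2) assms(2) free_module_carrierD(1)[OF f] free_module_carrierD(1)[OF g]
      by (intro V.M.finsum_cong') (auto simp: V.smult_l_distr)
    also have "\<dots> = (\<Oplus>\<^bsub>V\<^esub>x\<in>?F. f x \<odot>\<^bsub>V\<^esub> b x) \<oplus>\<^bsub>V\<^esub> (\<Oplus>\<^bsub>V\<^esub>x\<in>?F. g x \<odot>\<^bsub>V\<^esub> b x)"
      using F assms(2) free_module_carrierD(1)[OF f] free_module_carrierD(1)[OF g]
      by (intro V.M.finsum_addf) auto
    also have "\<dots> = lin_ext K V b f \<oplus>\<^bsub>V\<^esub> lin_ext K V b g"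
      using lin_ext_superset[OF assms(1) f assms(2) F(1) _ F(2)]
        lin_ext_superset[OF assms(1) g assms(2) F(1) _ F(2)] by simp
    finally show "lin_ext K V b (f \<oplus>\<^bsub>free_module K S\<^esub> g) = lin_ext K V b f \<oplus>\<^bsub>V\<^esub> lin_ext K V b g" .
  next
    fix c f assume c: "c \<in> carrier K" and f: "f \<in> carrier (free_module K S)"
    note fD = free_module_carrierD[OF f]
    have "lin_ext K V b (c \<odot>\<^bsub>free_module K S\<^esub> f) =
        (\<Oplus>\<^bsub>V\<^esub>x\<in>{x. f x \<noteq> \<zero>\<^bsub>K\<^esub>}. (c \<odot>\<^bsub>free_module K S\<^esub> f) x \<odot>\<^bsub>V\<^esub> b x)"
      by (rule lin_ext_superset[OF assms(1) F.smult_closed[OF c f] assms(2) fD(2) _ fD(3)])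
        (use c in auto)
    also have "\<dots> = (\<Oplus>\<^bsub>V\<^esub>x\<in>{x. f x \<noteq> \<zero>\<^bsub>K\<^esub>}. c \<odot>\<^bsub>V\<^esub> (f x \<odot>\<^bsub>V\<^esub> b x))"
      using fD assms(2) c by (intro V.M.finsum_cong') (auto simp: V.smult_assoc1)
    also have "\<dots> = c \<odot>\<^bsub>V\<^esub> lin_ext K V b f" unfolding lin_ext_def
      using fD assms(2) c by (intro V.finsum_smult_ldistr[symmetric]) auto
    finally show "lin_ext K V b (c \<odot>\<^bsub>free_module K S\<^esub> f) = c \<odot>\<^bsub>V\<^esub> lin_ext K V b f" .
  qed
qed

lemma lin_ext_kdelta:
  assumes "module K V" "b x \<in> carrier V"
  shows "lin_ext K V b (kdelta K x) = b x"
proof -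
  interpret V: module K V by fact
  interpret free_mod K by (rule free_mod_of_module[OF assms(1)])
  have "lin_ext K V b (kdelta K x) = (\<Oplus>\<^bsub>V\<^esub>y\<in>{x}. kdelta K x y \<odot>\<^bsub>V\<^esub> b y)"
    by (rule lin_ext_superset[OF assms(1) kdelta_closed[of x "{x}"]]) (use assms in \<open>auto simp: kdelta_def\<close>)
  thus ?thesis using assms by (simp add: kdelta_def)
qed

section \<open>Tensor products and balanced maps\<close>

lemma scalars_simps [simp]:
  "carrier (scalars R M) = carrier M" "zero (scalars R M) = zero M" "add (scalars R M) = add M"
  "smult (scalars R M) = (\<lambda>c m. (c \<odot>\<^bsub>R\<^esub> \<one>\<^bsub>R\<^esub>) \<odot>\<^bsub>M\<^esub> m)"
  by (auto simp: scalars_def)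

text \<open>The last clause is linearity over \<open>K\<close>, which acts on \<open>X\<close> through \<open>R\<close>.\<close>

definition balanced_map ::
    "('k, 'c) ring_scheme \<Rightarrow> ('k, 'r) module \<Rightarrow> ('r, 'x) module \<Rightarrow> ('r, 'n) module
      \<Rightarrow> ('k, 't) module \<Rightarrow> ('x \<Rightarrow> 'n \<Rightarrow> 't) \<Rightarrow> bool"
  where "balanced_map K R X N T \<beta> \<longleftrightarrow>
    (\<forall>x\<in>carrier X. \<forall>n\<in>carrier N. \<beta> x n \<in> carrier T) \<and>
    (\<forall>x\<in>carrier X. \<forall>x'\<in>carrier X. \<forall>n\<in>carrier N. \<beta> (x \<oplus>\<^bsub>X\<^esub> x') n = \<beta> x n \<oplus>\<^bsub>T\<^esub> \<beta> x' n) \<and>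
    (\<forall>x\<in>carrier X. \<forall>n\<in>carrier N. \<forall>n'\<in>carrier N. \<beta> x (n \<oplus>\<^bsub>N\<^esub> n') = \<beta> x n \<oplus>\<^bsub>T\<^esub> \<beta> x n') \<and>
    (\<forall>r\<in>carrier R. \<forall>x\<in>carrier X. \<forall>n\<in>carrier N. \<beta> (r \<odot>\<^bsub>X\<^esub> x) n = \<beta> x (r \<odot>\<^bsub>N\<^esub> n)) \<and>
    (\<forall>c\<in>carrier K. \<forall>x\<in>carrier X. \<forall>n\<in>carrier N.
      \<beta> ((c \<odot>\<^bsub>R\<^esub> \<one>\<^bsub>R\<^esub>) \<odot>\<^bsub>X\<^esub> x) n = c \<odot>\<^bsub>T\<^esub> \<beta> x n)"

lemma balanced_mapI:
  assumes "\<And>x n. \<lbrakk>x \<in> carrier X; n \<in> carrier N\<rbrakk> \<Longrightarrow> \<beta> x n \<in> carrier T"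
    and "\<And>x x' n. \<lbrakk>x \<in> carrier X; x' \<in> carrier X; n \<in> carrier N\<rbrakk> \<Longrightarrow> \<beta> (x \<oplus>\<^bsub>X\<^esub> x') n = \<beta> x n \<oplus>\<^bsub>T\<^esub> \<beta> x' n"
    and "\<And>x n n'. \<lbrakk>x \<in> carrier X; n \<in> carrier N; n' \<in> carrier N\<rbrakk> \<Longrightarrow> \<beta> x (n \<oplus>\<^bsub>N\<^esub> n') = \<beta> x n \<oplus>\<^bsub>T\<^esub> \<beta> x n'"
    and "\<And>r x n. \<lbrakk>r \<in> carrier R; x \<in> carrier X; n \<in> carrier N\<rbrakk> \<Longrightarrow> \<beta> (r \<odot>\<^bsub>X\<^esub> x) n = \<beta> x (r \<odot>\<^bsub>N\<^esub> n)"
    and "\<And>c x n. \<lbrakk>c \<in> carrier K; x \<in> carrier X; n \<in> carrier N\<rbrakk> \<Longrightarrow>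
      \<beta> ((c \<odot>\<^bsub>R\<^esub> \<one>\<^bsub>R\<^esub>) \<odot>\<^bsub>X\<^esub> x) n = c \<odot>\<^bsub>T\<^esub> \<beta> x n"
  shows "balanced_map K R X N T \<beta>"
  using assms by (auto simp: balanced_map_def)

text \<open>Only additivity and closure of the two actions enter: the tensor product is a quotient of the free
module on pairs, and its defining relations have to lie in that free module.\<close>

locale tensor_data =
  fixes K :: "('k, 'c) ring_scheme" and R :: "('k, 'r) module"
    and X :: "('r, 'x) module" and N :: "('r, 'n) module"
  assumes cring_K: "cring K" and group_X: "abelian_group X" and group_N: "abelian_group N"
    and scalar_closed: "c \<in> carrier K \<Longrightarrow> c \<odot>\<^bsub>R\<^esub> \<one>\<^bsub>R\<^esub> \<in> carrier R"
    and X_smult: "\<lbrakk>r \<in> carrier R; x \<in> carrier X\<rbrakk> \<Longrightarrow> r \<odot>\<^bsub>X\<^esub> x \<in> carrier X"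
    and N_smult: "\<lbrakk>r \<in> carrier R; n \<in> carrier N\<rbrakk> \<Longrightarrow> r \<odot>\<^bsub>N\<^esub> n \<in> carrier N"
begin

abbreviation V where "V \<equiv> tensor_free K X N"
abbreviation T where "T \<equiv> tensor K R X N"
abbreviation pure where "pure \<equiv> pure_tensor K R X N"

sublocale free_mod K by (simp add: free_mod_def cring_K)
sublocale X: abelian_group X by (rule group_X)
sublocale N: abelian_group N by (rule group_N)

lemma module_V: "module K V" unfolding tensor_free_def by (rule free_module_is_module)

sublocale V: module K V by (rule module_V)

lemma delta_closed: "\<lbrakk>x \<in> carrier X; n \<in> carrier N\<rbrakk> \<Longrightarrow> kdelta K (x, n) \<in> carrier V"
  by (simp add: tensor_free_def kdelta_closed)

lemma rels_closed: "tensor_rels K R X N \<subseteq> carrier V"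
  unfolding tensor_rels_def Let_def
  by (auto simp: delta_closed X_smult N_smult scalar_closed intro!: V.M.minus_closed)

sublocale Q: quotient_module K V "tensor_null K R X N"
  by (rule quotient_module.intro, rule module_V)
    (simp add: tensor_null_def submodule_gen_submodule[OF module_V rels_closed])

lemma T_eq: "T = quot_module V (tensor_null K R X N)"
  by (simp add: tensor_def)

lemma pure_eq: "pure x n = Q.coset (kdelta K (x, n))"
  by (simp add: pure_tensor_def)

lemma module_T: "module K T"
  unfolding T_eq by (rule Q.quot_module_is_module)

sublocale T: module K T by (rule module_T)

lemma pure_closed: "\<lbrakk>x \<in> carrier X; n \<in> carrier N\<rbrakk> \<Longrightarrow> pure x n \<in> carrier T"
  by (simp add: pure_eq T_eq Q.coset_closed delta_closed)

lemma rel_null: "r \<in> tensor_rels K R X N \<Longrightarrow> r \<in> tensor_null K R X N"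
  unfolding tensor_null_def by (rule subsetD[OF submodule_gen_incl])

lemma pure_add_left:
  assumes "x \<in> carrier X" "x' \<in> carrier X" "n \<in> carrier N"
  shows "pure (x \<oplus>\<^bsub>X\<^esub> x') n = pure x n \<oplus>\<^bsub>T\<^esub> pure x' n"
proof -
  have "kdelta K (x \<oplus>\<^bsub>X\<^esub> x', n) \<ominus>\<^bsub>V\<^esub> (kdelta K (x, n) \<oplus>\<^bsub>V\<^esub> kdelta K (x', n)) \<in> tensor_rels K R X N"
    unfolding tensor_rels_def Let_def
    by (rule UnI1, rule UnI1, rule UnI1, rule CollectI, (rule exI)+, rule conjI[OF refl])
      (use assms in auto)
  from Q.coset_eqI[OF rel_null[OF this]] show ?thesis
    using assms by (simp add: pure_eq T_eq Q.quot_add delta_closed)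
qed

lemma pure_add_right:
  assumes "x \<in> carrier X" "n \<in> carrier N" "n' \<in> carrier N"
  shows "pure x (n \<oplus>\<^bsub>N\<^esub> n') = pure x n \<oplus>\<^bsub>T\<^esub> pure x n'"
proof -
  have "kdelta K (x, n \<oplus>\<^bsub>N\<^esub> n') \<ominus>\<^bsub>V\<^esub> (kdelta K (x, n) \<oplus>\<^bsub>V\<^esub> kdelta K (x, n')) \<in> tensor_rels K R X N"
    unfolding tensor_rels_def Let_def
    by (rule UnI1, rule UnI1, rule UnI2, rule CollectI, (rule exI)+, rule conjI[OF refl])
      (use assms in auto)
  from Q.coset_eqI[OF rel_null[OF this]] show ?thesis
    using assms by (simp add: pure_eq T_eq Q.quot_add delta_closed)
qed

lemma pure_balanced:
  assumes "r \<in> carrier R" "x \<in> carrier X" "n \<in> carrier N"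
  shows "pure (r \<odot>\<^bsub>X\<^esub> x) n = pure x (r \<odot>\<^bsub>N\<^esub> n)"
proof -
  have "kdelta K (r \<odot>\<^bsub>X\<^esub> x, n) \<ominus>\<^bsub>V\<^esub> kdelta K (x, r \<odot>\<^bsub>N\<^esub> n) \<in> tensor_rels K R X N"
    unfolding tensor_rels_def Let_def
    by (rule UnI1, rule UnI2, rule CollectI, (rule exI)+, rule conjI[OF refl])
      (use assms in auto)
  from Q.coset_eqI[OF rel_null[OF this]] show ?thesis
    using assms by (simp add: pure_eq delta_closed X_smult N_smult)
qed

lemma pure_scalar:
  assumes "c \<in> carrier K" "x \<in> carrier X" "n \<in> carrier N"
  shows "pure ((c \<odot>\<^bsub>R\<^esub> \<one>\<^bsub>R\<^esub>) \<odot>\<^bsub>X\<^esub> x) n = c \<odot>\<^bsub>T\<^esub> pure x n"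
proof -
  have "kdelta K (c \<odot>\<^bsub>scalars R X\<^esub> x, n) \<ominus>\<^bsub>V\<^esub> c \<odot>\<^bsub>V\<^esub> kdelta K (x, n) \<in> tensor_rels K R X N"
    unfolding tensor_rels_def Let_def
    by (rule UnI2, rule CollectI, (rule exI)+, rule conjI[OF refl])
      (use assms in auto)
  from Q.coset_eqI[OF rel_null[OF this]] show ?thesis
    using assms by (simp add: pure_eq T_eq Q.quot_smult delta_closed X_smult scalar_closed)
qed

lemma pure_zero_left: "n \<in> carrier N \<Longrightarrow> pure \<zero>\<^bsub>X\<^esub> n = \<zero>\<^bsub>T\<^esub>"
  using pure_add_left[of "\<zero>\<^bsub>X\<^esub>" "\<zero>\<^bsub>X\<^esub>" n] pure_closed[of "\<zero>\<^bsub>X\<^esub>" n] by simp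

lemma tensor_induct [consumes 1, case_names pure add]:
  assumes "t \<in> carrier T"
    and pure: "\<And>x n. \<lbrakk>x \<in> carrier X; n \<in> carrier N\<rbrakk> \<Longrightarrow> P (pure x n)"
    and add: "\<And>s t. \<lbrakk>s \<in> carrier T; t \<in> carrier T; P s; P t\<rbrakk> \<Longrightarrow> P (s \<oplus>\<^bsub>T\<^esub> t)"
  shows "P t"
proof -
  obtain f where f: "f \<in> carrier (free_module K (carrier X \<times> carrier N))" "t = Q.coset f"
    using assms(1) unfolding T_eq Q.quot_carrier by (auto simp: tensor_free_def)
  from f(1) have "P (Q.coset f)"
  proof (induction f rule: free_module_induct)
    case zero
    have "Q.coset (\<lambda>x. \<zero>\<^bsub>K\<^esub>) = Q.coset \<zero>\<^bsub>V\<^esub>" by (simp add: tensor_free_def)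
    also have "\<dots> = pure \<zero>\<^bsub>X\<^esub> \<zero>\<^bsub>N\<^esub>" unfolding Q.coset_zero pure_zero_left[OF N.zero_closed] T_eq ..
    finally show ?case using pure by simp
  next
    case (single c p)
    obtain x n where p: "p = (x, n)" "x \<in> carrier X" "n \<in> carrier N" using single by auto
    have "Q.coset (c \<odot>\<^bsub>V\<^esub> kdelta K p) = c \<odot>\<^bsub>T\<^esub> pure x n"
      using p single by (simp add: pure_eq T_eq Q.quot_smult delta_closed)
    also have "\<dots> = pure ((c \<odot>\<^bsub>R\<^esub> \<one>\<^bsub>R\<^esub>) \<odot>\<^bsub>X\<^esub> x) n" using single p by (simp add: pure_scalar)
    finally show ?case using pure p single by (simp add: X_smult scalar_closed tensor_free_def)
  next
    case (add f g)
    have fg: "f \<in> carrier V" "g \<in> carrier V" using add by (auto simp: tensor_free_def)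
    have "Q.coset (f \<oplus>\<^bsub>V\<^esub> g) = Q.coset f \<oplus>\<^bsub>T\<^esub> Q.coset g" using fg by (simp add: T_eq Q.quot_add)
    thus ?case using add assms(3) fg Q.coset_closed[of f] Q.coset_closed[of g]
      by (simp add: T_eq tensor_free_def)
  qed
  thus ?thesis using f by simp
qed

text \<open>The universal property. The linear extension of a balanced map kills the four families of defining
relations, and its kernel is a submodule, so it kills the submodule they generate.\<close>

lemma lift_coset:
  assumes "module K W" "balanced_map K R X N W \<beta>" "f \<in> carrier V"
  shows "quot_lift K W (\<lambda>(x, n). \<beta> x n) (Q.coset f) = lin_ext K W (\<lambda>(x, n). \<beta> x n) f"
proof -
  interpret W: module K W by fact
  let ?h = "lin_ext K W (\<lambda>(x, n). \<beta> x n)"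
  have \<beta>: "\<And>x n. \<lbrakk>x \<in> carrier X; n \<in> carrier N\<rbrakk> \<Longrightarrow> \<beta> x n \<in> carrier W"
    "\<And>x x' n. \<lbrakk>x \<in> carrier X; x' \<in> carrier X; n \<in> carrier N\<rbrakk> \<Longrightarrow> \<beta> (x \<oplus>\<^bsub>X\<^esub> x') n = \<beta> x n \<oplus>\<^bsub>W\<^esub> \<beta> x' n"
    "\<And>x n n'. \<lbrakk>x \<in> carrier X; n \<in> carrier N; n' \<in> carrier N\<rbrakk> \<Longrightarrow> \<beta> x (n \<oplus>\<^bsub>N\<^esub> n') = \<beta> x n \<oplus>\<^bsub>W\<^esub> \<beta> x n'"
    "\<And>r x n. \<lbrakk>r \<in> carrier R; x \<in> carrier X; n \<in> carrier N\<rbrakk> \<Longrightarrow> \<beta> (r \<odot>\<^bsub>X\<^esub> x) n = \<beta> x (r \<odot>\<^bsub>N\<^esub> n)"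
    "\<And>c x n. \<lbrakk>c \<in> carrier K; x \<in> carrier X; n \<in> carrier N\<rbrakk> \<Longrightarrow>
      \<beta> ((c \<odot>\<^bsub>R\<^esub> \<one>\<^bsub>R\<^esub>) \<odot>\<^bsub>X\<^esub> x) n = c \<odot>\<^bsub>W\<^esub> \<beta> x n"
    using assms(2) by (auto simp: balanced_map_def)
  have h: "?h \<in> module_hom K V W"
    unfolding tensor_free_def by (rule lin_ext_hom[OF assms(1)]) (use \<beta> in auto)
  have hd: "?h (kdelta K (x, n)) = \<beta> x n" if "x \<in> carrier X" "n \<in> carrier N" for x n
    using lin_ext_kdelta[OF assms(1), of "\<lambda>(x, n). \<beta> x n" "(x, n)"] \<beta> that by auto
  have minus_self: "w \<ominus>\<^bsub>W\<^esub> w = \<zero>\<^bsub>W\<^esub>" if "w \<in> carrier W" for w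
    using that by (simp add: a_minus_def W.M.r_neg)
  note hs = module_hom_minus[OF module_V assms(1) h] module_hom_add[OF h] module_hom_smult[OF h]
    delta_closed X_smult N_smult scalar_closed hd \<beta>(1) minus_self
  have "tensor_null K R X N \<subseteq> {x \<in> carrier V. ?h x = \<zero>\<^bsub>W\<^esub>}"
    unfolding tensor_null_def
  proof (rule submodule_gen_minimal[OF kernel_submodule[OF module_V assms(1) h]], rule subsetI)
    fix t assume t: "t \<in> tensor_rels K R X N"
    from t have "?h t = \<zero>\<^bsub>W\<^esub>" unfolding tensor_rels_def Let_def
    proof (elim UnE CollectE exE conjE, goal_cases)
      case 1 thus ?case by (simp add: hs \<beta>(2))
    next
      case 2 thus ?case by (simp add: hs \<beta>(3))
    next
      case 3 thus ?case by (simp add: hs \<beta>(4))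
    next
      case 4 thus ?case by (simp add: hs \<beta>(5))
    qed
    thus "t \<in> {x \<in> carrier V. ?h x = \<zero>\<^bsub>W\<^esub>}" using t rels_closed by auto
  qed
  thus ?thesis unfolding quot_lift_def
    by (intro Q.the_elem_image_coset[OF assms(1) h _ assms(3)]) auto
qed

lemma lift_pure:
  assumes "module K W" "balanced_map K R X N W \<beta>" "x \<in> carrier X" "n \<in> carrier N"
  shows "quot_lift K W (\<lambda>(x, n). \<beta> x n) (pure x n) = \<beta> x n"
  using lift_coset[OF assms(1,2) delta_closed[OF assms(3,4)]]
    lin_ext_kdelta[OF assms(1), of "\<lambda>(x, n). \<beta> x n" "(x, n)"] assms
  by (auto simp: pure_eq balanced_map_def)

lemma lift_hom:
  assumes "module K W" "balanced_map K R X N W \<beta>"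
  shows "quot_lift K W (\<lambda>(x, n). \<beta> x n) \<in> module_hom K T W"
proof -
  let ?h = "lin_ext K W (\<lambda>(x, n). \<beta> x n)"
  have h: "?h \<in> module_hom K V W" unfolding tensor_free_def
    by (rule lin_ext_hom[OF assms(1)]) (use assms(2) in \<open>auto simp: balanced_map_def\<close>)
  note [simp] = T_eq Q.quot_add Q.quot_smult lift_coset[OF assms]
  show ?thesis
    by (rule module_homI) (auto simp: Q.quot_carrier module_hom_closed[OF h] module_hom_add[OF h]
      module_hom_smult[OF h])
qed

end

section \<open>The enveloping algebra and its modules\<close>

text \<open>The zero algebra is included, because a quotient such as \<open>\<kappa>\<^sub>p\<^sub>a\<^sub>r G\<close> is covered without a proof that
it does not collapse.\<close>

locale unital_alg = module K R + A: ring R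
  for K :: "('k, 'c) ring_scheme" and R :: "('k, 'r) module" +
  assumes smult_mult_left:
      "\<lbrakk>c \<in> carrier K; x \<in> carrier R; y \<in> carrier R\<rbrakk> \<Longrightarrow> (c \<odot>\<^bsub>R\<^esub> x) \<otimes>\<^bsub>R\<^esub> y = c \<odot>\<^bsub>R\<^esub> (x \<otimes>\<^bsub>R\<^esub> y)"
    and smult_mult_right:
      "\<lbrakk>c \<in> carrier K; x \<in> carrier R; y \<in> carrier R\<rbrakk> \<Longrightarrow> x \<otimes>\<^bsub>R\<^esub> (c \<odot>\<^bsub>R\<^esub> y) = c \<odot>\<^bsub>R\<^esub> (x \<otimes>\<^bsub>R\<^esub> y)"
begin

lemma module_KR: "module K R" by (rule module_axioms)

lemma scalar_one_mult: "\<lbrakk>c \<in> carrier K; x \<in> carrier R\<rbrakk> \<Longrightarrow> (c \<odot>\<^bsub>R\<^esub> \<one>\<^bsub>R\<^esub>) \<otimes>\<^bsub>R\<^esub> x = c \<odot>\<^bsub>R\<^esub> x"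
  by (simp add: smult_mult_left)

abbreviation E where "E \<equiv> env K R"
abbreviation et where "et \<equiv> env_tensor K R"

lemma opp_simps [simp]: "carrier (opp R) = carrier R" "zero (opp R) = zero R" "one (opp R) = one R"
  "add (opp R) = add R" "smult (opp R) = smult R" "monoid.mult (opp R) = (\<lambda>x y. y \<otimes>\<^bsub>R\<^esub> x)"
  by (auto simp: opp_def)

sublocale ET: tensor_data K "self_algebra K" R "opp R"
proof (rule tensor_data.intro)
  show "cring K" by (rule R.is_cring)
  show "abelian_group R" by (rule A.is_abelian_group)
  show "abelian_group (opp R)" by (rule abelian_group_cong[OF A.is_abelian_group]) auto
qed (auto simp: self_algebra_def)

lemma E_simps: "carrier E = carrier ET.T" "zero E = zero ET.T" "add E = add ET.T" "smult E = smult ET.T"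
  by (auto simp: env_def algebra_tensor_def Let_def)

lemma et_eq: "et r s = ET.pure r s"
  by (simp add: env_tensor_def)

lemma module_E: "module K E"
  by (rule module_cong[OF ET.module_T]) (simp_all add: E_simps)

sublocale E: module K E by (rule module_E)

lemma one_E: "\<one>\<^bsub>E\<^esub> = et \<one>\<^bsub>R\<^esub> \<one>\<^bsub>R\<^esub>"
  by (simp add: env_def algebra_tensor_def Let_def env_tensor_def)

lemma et_closed: "\<lbrakk>r \<in> carrier R; s \<in> carrier R\<rbrakk> \<Longrightarrow> et r s \<in> carrier E"
  by (simp add: et_eq E_simps ET.pure_closed)

lemma et_add_left: "\<lbrakk>r \<in> carrier R; r' \<in> carrier R; s \<in> carrier R\<rbrakk> \<Longrightarrow>
    et (r \<oplus>\<^bsub>R\<^esub> r') s = et r s \<oplus>\<^bsub>E\<^esub> et r' s"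
  by (simp add: et_eq E_simps ET.pure_add_left)

lemma et_add_right: "\<lbrakk>r \<in> carrier R; s \<in> carrier R; s' \<in> carrier R\<rbrakk> \<Longrightarrow>
    et r (s \<oplus>\<^bsub>R\<^esub> s') = et r s \<oplus>\<^bsub>E\<^esub> et r s'"
  using ET.pure_add_right[of r s s'] by (simp add: et_eq E_simps)

lemma et_smult_left: "\<lbrakk>c \<in> carrier K; r \<in> carrier R; s \<in> carrier R\<rbrakk> \<Longrightarrow> et (c \<odot>\<^bsub>R\<^esub> r) s = c \<odot>\<^bsub>E\<^esub> et r s"
  using ET.pure_scalar[of c r s] by (simp add: et_eq E_simps self_algebra_def)

lemma et_smult_right: "\<lbrakk>c \<in> carrier K; r \<in> carrier R; s \<in> carrier R\<rbrakk> \<Longrightarrow> et r (c \<odot>\<^bsub>R\<^esub> s) = c \<odot>\<^bsub>E\<^esub> et r s"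
  using ET.pure_balanced[of c r s] et_smult_left[of c r s] by (simp add: et_eq self_algebra_def)

text \<open>Scalars can be moved into the first factor, so sums of pure tensors suffice.\<close>

lemma E_induct [consumes 1, case_names et add]:
  assumes "X \<in> carrier E"
    and "\<And>r s. \<lbrakk>r \<in> carrier R; s \<in> carrier R\<rbrakk> \<Longrightarrow> P (et r s)"
    and "\<And>X Y. \<lbrakk>X \<in> carrier E; Y \<in> carrier E; P X; P Y\<rbrakk> \<Longrightarrow> P (X \<oplus>\<^bsub>E\<^esub> Y)"
  shows "P X"
  using assms(1) unfolding E_simps
  by (induction X rule: ET.tensor_induct) (use assms(2,3) in \<open>auto simp: et_eq E_simps\<close>)

lemma bilinear_balanced:
  assumes "\<And>r s. \<lbrakk>r \<in> carrier R; s \<in> carrier R\<rbrakk> \<Longrightarrow> \<beta> r s \<in> carrier W"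
    and "\<And>r r' s. \<lbrakk>r \<in> carrier R; r' \<in> carrier R; s \<in> carrier R\<rbrakk> \<Longrightarrow> \<beta> (r \<oplus>\<^bsub>R\<^esub> r') s = \<beta> r s \<oplus>\<^bsub>W\<^esub> \<beta> r' s"
    and "\<And>r s s'. \<lbrakk>r \<in> carrier R; s \<in> carrier R; s' \<in> carrier R\<rbrakk> \<Longrightarrow> \<beta> r (s \<oplus>\<^bsub>R\<^esub> s') = \<beta> r s \<oplus>\<^bsub>W\<^esub> \<beta> r s'"
    and "\<And>c r s. \<lbrakk>c \<in> carrier K; r \<in> carrier R; s \<in> carrier R\<rbrakk> \<Longrightarrow> \<beta> (c \<odot>\<^bsub>R\<^esub> r) s = c \<odot>\<^bsub>W\<^esub> \<beta> r s"
    and "\<And>c r s. \<lbrakk>c \<in> carrier K; r \<in> carrier R; s \<in> carrier R\<rbrakk> \<Longrightarrow> \<beta> r (c \<odot>\<^bsub>R\<^esub> s) = c \<odot>\<^bsub>W\<^esub> \<beta> r s"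
  shows "balanced_map K (self_algebra K) R (opp R) W \<beta>"
  by (rule balanced_mapI) (use assms in \<open>auto simp: self_algebra_def\<close>)

lemma E_lift_hom:
  assumes "module K W" "balanced_map K (self_algebra K) R (opp R) W \<beta>"
  shows "quot_lift K W (\<lambda>(r, s). \<beta> r s) \<in> module_hom K E W"
  using ET.lift_hom[OF assms] by (simp add: module_hom_def E_simps)

lemma E_lift_et:
  assumes "module K W" "balanced_map K (self_algebra K) R (opp R) W \<beta>" "r \<in> carrier R" "s \<in> carrier R"
  shows "quot_lift K W (\<lambda>(r, s). \<beta> r s) (et r s) = \<beta> r s"
  using ET.lift_pure[OF assms(1,2)] assms(3,4) by (simp add: et_eq)

text \<open>The product of the enveloping algebra is a lift in each of its two arguments; on pure tensors both
lifts can be evaluated, because the map being lifted is bilinear.\<close>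

lemma et_mult:
  assumes R: "r \<in> carrier R" "s \<in> carrier R" "r' \<in> carrier R" "s' \<in> carrier R"
  shows "et r s \<otimes>\<^bsub>E\<^esub> et r' s' = et (r \<otimes>\<^bsub>R\<^esub> r') (s' \<otimes>\<^bsub>R\<^esub> s)"
proof -
  let ?G = "\<lambda>r s. quot_lift K E (\<lambda>(r', s'). et (r \<otimes>\<^bsub>R\<^esub> r') (s' \<otimes>\<^bsub>R\<^esub> s))"
  have eqE: "quot_lift K ET.T = quot_lift K E"
    by (simp add: fun_eq_iff quot_lift_def lin_ext_def E_simps finsum_def finprod_def)
  have G: "?G r s (et r' s') = et (r \<otimes>\<^bsub>R\<^esub> r') (s' \<otimes>\<^bsub>R\<^esub> s)"
    if "r \<in> carrier R" "s \<in> carrier R" for r s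
    by (rule E_lift_et[OF module_E bilinear_balanced R(3,4)])
      (use that in \<open>auto simp: et_closed et_add_left et_add_right et_smult_left et_smult_right
         A.l_distr A.r_distr smult_mult_left smult_mult_right\<close>)
  have "et r s \<otimes>\<^bsub>E\<^esub> et r' s' = quot_lift K E (\<lambda>(r, s). ?G r s (et r' s')) (et r s)"
    unfolding eqE[symmetric] by (simp add: env_def algebra_tensor_def Let_def env_tensor_def)
  also have "\<dots> = ?G r s (et r' s')"
    by (rule E_lift_et[OF module_E bilinear_balanced R(1,2)])
      (use R in \<open>auto simp: G et_closed et_add_left et_add_right et_smult_left et_smult_right
         A.l_distr A.r_distr smult_mult_left smult_mult_right\<close>)
  also have "\<dots> = et (r \<otimes>\<^bsub>R\<^esub> r') (s' \<otimes>\<^bsub>R\<^esub> s)" by (rule G[OF R(1,2)])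
  finally show ?thesis .
qed

abbreviation RR where "RR \<equiv> right_regular K R"

lemma RR_simps [simp]: "carrier RR = carrier R" "zero RR = zero R" "add RR = add R"
  by (simp_all add: right_regular_def)

lemma RR_balanced: "a \<in> carrier R \<Longrightarrow>
    balanced_map K (self_algebra K) R (opp R) R (\<lambda>r s. s \<otimes>\<^bsub>R\<^esub> a \<otimes>\<^bsub>R\<^esub> r)"
  by (rule bilinear_balanced) (auto simp: A.l_distr A.r_distr smult_mult_left smult_mult_right)

lemma RR_hom: "a \<in> carrier R \<Longrightarrow> (\<lambda>X. X \<odot>\<^bsub>RR\<^esub> a) \<in> module_hom K E R"
  unfolding right_regular_def with_smult_simps by (rule E_lift_hom[OF module_KR RR_balanced])

lemma RR_et: "\<lbrakk>a \<in> carrier R; r \<in> carrier R; s \<in> carrier R\<rbrakk> \<Longrightarrow> et r s \<odot>\<^bsub>RR\<^esub> a = s \<otimes>\<^bsub>R\<^esub> a \<otimes>\<^bsub>R\<^esub> r"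
  unfolding right_regular_def with_smult_simps by (rule E_lift_et[OF module_KR RR_balanced])

lemma RR_smult_closed: "\<lbrakk>X \<in> carrier E; a \<in> carrier R\<rbrakk> \<Longrightarrow> X \<odot>\<^bsub>RR\<^esub> a \<in> carrier R"
  using module_hom_closed[OF RR_hom] by blast

lemma RR_scalar: "\<lbrakk>c \<in> carrier K; a \<in> carrier R\<rbrakk> \<Longrightarrow> (c \<odot>\<^bsub>E\<^esub> \<one>\<^bsub>E\<^esub>) \<odot>\<^bsub>RR\<^esub> a = c \<odot>\<^bsub>R\<^esub> a"
  by (simp add: one_E RR_et smult_mult_right flip: et_smult_left)

end

text \<open>A weak notion of left module over the enveloping algebra: the restriction of a bimodule along a
homomorphism satisfies it immediately, and the tensor product with the regular bimodule asks for
no more.\<close>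

locale env_module = unital_alg K R + N: abelian_group N
  for K :: "('k, 'c) ring_scheme" and R :: "('k, 'r) module"
    and N :: "(('r \<times> 'r \<Rightarrow> 'k) set, 'n) module" +
  assumes act_closed: "\<lbrakk>X \<in> carrier (env K R); n \<in> carrier N\<rbrakk> \<Longrightarrow> X \<odot>\<^bsub>N\<^esub> n \<in> carrier N"
    and act_add_left: "\<lbrakk>X \<in> carrier (env K R); Y \<in> carrier (env K R); n \<in> carrier N\<rbrakk> \<Longrightarrow>
      (X \<oplus>\<^bsub>env K R\<^esub> Y) \<odot>\<^bsub>N\<^esub> n = X \<odot>\<^bsub>N\<^esub> n \<oplus>\<^bsub>N\<^esub> Y \<odot>\<^bsub>N\<^esub> n"
begin

sublocale H: tensor_data K "env K R" "right_regular K R" N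
proof (rule tensor_data.intro)
  show "cring K" by (rule R.is_cring)
  show "abelian_group RR" by (rule abelian_group_cong[OF A.is_abelian_group]) auto
  show "abelian_group N" by (rule N.abelian_group_axioms)
qed (auto simp: one_E et_closed RR_smult_closed act_closed)

text \<open>Balancedness over the whole enveloping algebra reduces to balancedness for \<open>r \<otimes> s\<close>, where it reads
\<open>\<beta>(s a r, n) = \<beta>(a, r n s)\<close>.\<close>

lemma H_balanced:
  assumes "module K W"
    and "\<And>a n. \<lbrakk>a \<in> carrier R; n \<in> carrier N\<rbrakk> \<Longrightarrow> \<beta> a n \<in> carrier W"
    and "\<And>a a' n. \<lbrakk>a \<in> carrier R; a' \<in> carrier R; n \<in> carrier N\<rbrakk> \<Longrightarrow> \<beta> (a \<oplus>\<^bsub>R\<^esub> a') n = \<beta> a n \<oplus>\<^bsub>W\<^esub> \<beta> a' n"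
    and "\<And>a n n'. \<lbrakk>a \<in> carrier R; n \<in> carrier N; n' \<in> carrier N\<rbrakk> \<Longrightarrow> \<beta> a (n \<oplus>\<^bsub>N\<^esub> n') = \<beta> a n \<oplus>\<^bsub>W\<^esub> \<beta> a n'"
    and "\<And>r s a n. \<lbrakk>r \<in> carrier R; s \<in> carrier R; a \<in> carrier R; n \<in> carrier N\<rbrakk> \<Longrightarrow>
      \<beta> (s \<otimes>\<^bsub>R\<^esub> a \<otimes>\<^bsub>R\<^esub> r) n = \<beta> a (et r s \<odot>\<^bsub>N\<^esub> n)"
    and "\<And>c a n. \<lbrakk>c \<in> carrier K; a \<in> carrier R; n \<in> carrier N\<rbrakk> \<Longrightarrow> \<beta> (c \<odot>\<^bsub>R\<^esub> a) n = c \<odot>\<^bsub>W\<^esub> \<beta> a n"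
  shows "balanced_map K E RR N W \<beta>"
proof (rule balanced_mapI)
  fix X a n assume X: "X \<in> carrier E" and a: "a \<in> carrier RR" and n: "n \<in> carrier N"
  from X show "\<beta> (X \<odot>\<^bsub>RR\<^esub> a) n = \<beta> a (X \<odot>\<^bsub>N\<^esub> n)"
  proof (induction X rule: E_induct)
    case (et r s) thus ?case using a n by (simp add: RR_et assms)
  next
    case (add X Y) thus ?case
      using a n by (simp add: module_hom_add[OF RR_hom] assms RR_smult_closed act_add_left act_closed)
  qed
qed (use assms in \<open>auto simp: RR_scalar\<close>)

lemma pure_regular: "\<lbrakk>r \<in> carrier R; s \<in> carrier R; a \<in> carrier R; n \<in> carrier N\<rbrakk> \<Longrightarrow>
    H.pure a (et r s \<odot>\<^bsub>N\<^esub> n) = H.pure (s \<otimes>\<^bsub>R\<^esub> a \<otimes>\<^bsub>R\<^esub> r) n"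
  using H.pure_balanced[of "et r s" a n] by (simp add: et_closed RR_et)

lemma pure_smult: "\<lbrakk>c \<in> carrier K; a \<in> carrier R; n \<in> carrier N\<rbrakk> \<Longrightarrow>
    H.pure (c \<odot>\<^bsub>R\<^esub> a) n = c \<odot>\<^bsub>H.T\<^esub> H.pure a n"
  using H.pure_scalar[of c a n] by (simp add: RR_scalar)

lemma pure_one: "\<lbrakk>a \<in> carrier R; n \<in> carrier N\<rbrakk> \<Longrightarrow> H.pure a n = H.pure \<one>\<^bsub>R\<^esub> (et a \<one>\<^bsub>R\<^esub> \<odot>\<^bsub>N\<^esub> n)"
  by (simp add: pure_regular)

lemma pure_one': "\<lbrakk>a \<in> carrier R; n \<in> carrier N\<rbrakk> \<Longrightarrow> H.pure a n = H.pure \<one>\<^bsub>R\<^esub> (et \<one>\<^bsub>R\<^esub> a \<odot>\<^bsub>N\<^esub> n)"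
  by (simp add: pure_regular)

text \<open>\<open>R \<otimes> N\<close> over \<open>R\<^sup>e\<close> is the quotient \<open>N/[R, N]\<close>: since \<open>a \<otimes> n = 1 \<otimes> a n\<close>, the map \<open>n \<mapsto> 1 \<otimes> n\<close> is onto.\<close>

lemma H_cases:
  assumes "t \<in> carrier H.T"
  obtains n where "n \<in> carrier N" "t = H.pure \<one>\<^bsub>R\<^esub> n"
proof -
  from assms have "\<exists>n\<in>carrier N. t = H.pure \<one>\<^bsub>R\<^esub> n"
  proof (induction t rule: H.tensor_induct)
    case (pure a n) thus ?case using pure_one[of a n] by (auto intro!: act_closed et_closed)
  next
    case (add s t)
    then obtain n n' where "n \<in> carrier N" "n' \<in> carrier N" "s = H.pure \<one>\<^bsub>R\<^esub> n" "t = H.pure \<one>\<^bsub>R\<^esub> n'" by auto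
    thus ?case by (intro bexI[of _ "n \<oplus>\<^bsub>N\<^esub> n'"]) (simp_all add: H.pure_add_right)
  qed
  thus ?thesis using that by blast
qed

end

locale bimodule = unital_alg K R + M: left_module "env K R" M
  for K :: "('k, 'c) ring_scheme" and R :: "('k, 'r) module"
    and M :: "(('r \<times> 'r \<Rightarrow> 'k) set, 'm) module"
begin

sublocale env_module K R M
  by (intro env_module.intro env_module_axioms.intro unital_alg_axioms M.M.abelian_group_axioms)
    (auto simp: M.lsmult_closed M.lsmult_l_distr M.lsmult_r_distr)

text \<open>The left module structure over the enveloping algebra, written as the two-sided product \<open>r m s\<close>.\<close>

definition bi :: "'r \<Rightarrow> 'm \<Rightarrow> 'r \<Rightarrow> 'm"
  where "bi r m s = et r s \<odot>\<^bsub>M\<^esub> m"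

lemma bi_closed: "\<lbrakk>r \<in> carrier R; s \<in> carrier R; m \<in> carrier M\<rbrakk> \<Longrightarrow> bi r m s \<in> carrier M"
  by (simp add: bi_def et_closed M.lsmult_closed)

lemma bi_add: "\<lbrakk>r \<in> carrier R; s \<in> carrier R; m \<in> carrier M; m' \<in> carrier M\<rbrakk> \<Longrightarrow>
    bi r (m \<oplus>\<^bsub>M\<^esub> m') s = bi r m s \<oplus>\<^bsub>M\<^esub> bi r m' s"
  by (simp add: bi_def et_closed M.lsmult_r_distr)

lemma bi_add_left: "\<lbrakk>r \<in> carrier R; r' \<in> carrier R; s \<in> carrier R; m \<in> carrier M\<rbrakk> \<Longrightarrow>
    bi (r \<oplus>\<^bsub>R\<^esub> r') m s = bi r m s \<oplus>\<^bsub>M\<^esub> bi r' m s"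
  by (simp add: bi_def et_closed et_add_left M.lsmult_l_distr)

lemma bi_add_right: "\<lbrakk>r \<in> carrier R; s \<in> carrier R; s' \<in> carrier R; m \<in> carrier M\<rbrakk> \<Longrightarrow>
    bi r m (s \<oplus>\<^bsub>R\<^esub> s') = bi r m s \<oplus>\<^bsub>M\<^esub> bi r m s'"
  by (simp add: bi_def et_closed et_add_right M.lsmult_l_distr)

lemma bi_smult: "\<lbrakk>c \<in> carrier K; r \<in> carrier R; s \<in> carrier R\<rbrakk> \<Longrightarrow>
    bi r m (c \<odot>\<^bsub>R\<^esub> s) = bi (c \<odot>\<^bsub>R\<^esub> r) m s"
  by (simp add: bi_def et_smult_left et_smult_right)

lemma bi_bi: "\<lbrakk>r \<in> carrier R; s \<in> carrier R; r' \<in> carrier R; s' \<in> carrier R; m \<in> carrier M\<rbrakk> \<Longrightarrow>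
    bi r (bi r' m s') s = bi (r \<otimes>\<^bsub>R\<^esub> r') m (s' \<otimes>\<^bsub>R\<^esub> s)"
  by (simp add: bi_def et_closed et_mult flip: M.lsmult_assoc)

lemma bi_one: "m \<in> carrier M \<Longrightarrow> bi \<one>\<^bsub>R\<^esub> m \<one>\<^bsub>R\<^esub> = m"
  using M.lsmult_one by (simp add: bi_def one_E)

lemma bi_scalar: "\<lbrakk>c \<in> carrier K; r \<in> carrier R; s \<in> carrier R; m \<in> carrier M\<rbrakk> \<Longrightarrow>
    (c \<odot>\<^bsub>E\<^esub> \<one>\<^bsub>E\<^esub>) \<odot>\<^bsub>M\<^esub> bi r m s = bi (c \<odot>\<^bsub>R\<^esub> r) m s"
  by (simp add: one_E bi_bi scalar_one_mult flip: et_smult_left bi_def)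

end

section \<open>Functoriality of tensor products\<close>

locale tensor_map_data = tensor_data K R X N + N': tensor_data K R X N'
  for K :: "('k, 'c) ring_scheme" and R :: "('k, 'r) module"
    and X :: "('r, 'x) module" and N :: "('r, 'n) module" and N' :: "('r, 'n1) module" +
  fixes f
  assumes f_hom: "f \<in> module_hom R N N'"
begin

lemma tensor_map_balanced: "balanced_map K R X N N'.T (\<lambda>x n. N'.pure x (f n))"
  by (rule balanced_mapI)
    (auto simp: N'.pure_closed N'.pure_add_left N'.pure_add_right N'.pure_balanced N'.pure_scalar
      module_hom_closed[OF f_hom] module_hom_add[OF f_hom] module_hom_smult[OF f_hom])

lemma tensor_map_hom: "tensor_map K R X N' f \<in> module_hom K T N'.T"
  unfolding tensor_map_def by (rule lift_hom[OF N'.module_T tensor_map_balanced])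

lemma tensor_map_pure: "\<lbrakk>x \<in> carrier X; n \<in> carrier N\<rbrakk> \<Longrightarrow>
    tensor_map K R X N' f (pure x n) = N'.pure x (f n)"
  unfolding tensor_map_def by (rule lift_pure[OF N'.module_T tensor_map_balanced])

end

lemma module_hom_cong: "\<lbrakk>left_module R M; f \<in> module_hom R M N; \<And>x. x \<in> carrier M \<Longrightarrow> f x = g x\<rbrakk> \<Longrightarrow> g \<in> module_hom R M N"
proof -
  assume M: "left_module R M" and f: "f \<in> module_hom R M N" and e: "\<And>x. x \<in> carrier M \<Longrightarrow> f x = g x"
  interpret M: left_module R M by fact
  show ?thesis
    by (rule module_homI) (use f in \<open>auto simp: M.lsmult_closed module_hom_def Pi_def simp flip: e\<close>)
qed

lemma tensor_map_cong:
  assumes "tensor_map_data K R X N N' f" "tensor_map_data K R X N N' g"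
    and "\<And>x. x \<in> carrier N \<Longrightarrow> f x = g x" "t \<in> carrier (tensor K R X N)"
  shows "tensor_map K R X N' f t = tensor_map K R X N' g t"
proof -
  interpret f: tensor_map_data K R X N N' f by fact
  interpret g: tensor_map_data K R X N N' g by fact
  from assms(4) show ?thesis
    by (induction t rule: f.tensor_induct)
      (auto simp: f.tensor_map_pure g.tensor_map_pure assms(3) module_hom_add[OF f.tensor_map_hom]
        module_hom_add[OF g.tensor_map_hom])
qed

lemma tensor_map_id:
  assumes "tensor_data K R X N" "t \<in> carrier (tensor K R X N)"
  shows "tensor_map K R X N (\<lambda>x. x) t = t"
proof -
  interpret tensor_map_data K R X N N "\<lambda>x. x"
    by (intro tensor_map_data.intro tensor_map_data_axioms.intro assms module_homI) simp_all
  from assms(2) show ?thesis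
    by (induction t rule: tensor_induct) (auto simp: tensor_map_pure module_hom_add[OF tensor_map_hom])
qed

lemma tensor_map_comp:
  assumes "tensor_map_data K R X N N' f" "tensor_map_data K R X N' N'' g" "t \<in> carrier (tensor K R X N)"
  shows "tensor_map K R X N'' (\<lambda>x. g (f x)) t = tensor_map K R X N'' g (tensor_map K R X N' f t)"
proof -
  interpret f: tensor_map_data K R X N N' f by fact
  interpret g: tensor_map_data K R X N' N'' g by fact
  note [simp] = module_hom_closed[OF f.f_hom] module_hom_closed[OF g.f_hom]
    module_hom_add[OF f.f_hom] module_hom_add[OF g.f_hom]
    module_hom_smult[OF f.f_hom] module_hom_smult[OF g.f_hom]
  interpret gf: tensor_map_data K R X N N'' "\<lambda>x. g (f x)"
    by (intro tensor_map_data.intro tensor_map_data_axioms.intro module_homI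
      f.tensor_data_axioms g.N'.tensor_data_axioms) auto
  from assms(3) show ?thesis
    by (induction t rule: f.tensor_induct)
      (auto simp: f.tensor_map_pure g.tensor_map_pure gf.tensor_map_pure module_hom_add[OF f.tensor_map_hom]
        module_hom_add[OF g.tensor_map_hom] module_hom_add[OF gf.tensor_map_hom]
        module_hom_closed[OF f.tensor_map_hom])
qed

lemma tensor_functor_is_functor:
  fixes X :: "('r, 'x) module"
  assumes "\<And>M :: ('r, 'm) module. left_module R M \<Longrightarrow> tensor_data K R X M"
  shows "is_functor R K (tensor_functor K R X :: ('r, 'm, 'k, ('x \<times> 'm \<Rightarrow> 'k) set) mod_functor)"
proof -
  have D: "tensor_map_data K R X M N f"
    if "left_module R M" "left_module R N" "f \<in> module_hom R M N" for f and M N :: "('r, 'm) module"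
    using that by (intro tensor_map_data.intro tensor_map_data_axioms.intro assms)
  show ?thesis
    unfolding is_functor_def tensor_functor_def mod_functor.simps
  proof (intro conjI allI impI ballI; (elim conjE)?)
    fix M :: "('r, 'm) module" assume M: "left_module R M"
    show "left_module K (tensor K R X M)"
      by (rule left_module_of_module[OF tensor_data.module_T[OF assms[OF M]]])
    fix y assume "y \<in> carrier (tensor K R X M)"
    thus "tensor_map K R X M (\<lambda>x. x) y = y" by (rule tensor_map_id[OF assms[OF M]])
  next
    fix M N :: "('r, 'm) module" and f
    assume "left_module R M" "left_module R N" "f \<in> module_hom R M N"
    thus "tensor_map K R X N f \<in> module_hom K (tensor K R X M) (tensor K R X N)"
      by (rule tensor_map_data.tensor_map_hom[OF D])
  next
    fix M N :: "('r, 'm) module" and f g y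
    assume a: "left_module R M" "left_module R N" "f \<in> module_hom R M N" "\<forall>x\<in>carrier M. f x = g x"
      "y \<in> carrier (tensor K R X M)"
    have "g \<in> module_hom R M N" by (rule module_hom_cong[OF a(1,3)]) (use a(4) in auto)
    thus "tensor_map K R X N f y = tensor_map K R X N g y"
      using a by (intro tensor_map_cong[OF D D]) auto
  next
    fix M N P :: "('r, 'm) module" and f g y
    assume "left_module R M" "left_module R N" "left_module R P" "f \<in> module_hom R M N"
      "g \<in> module_hom R N P" "y \<in> carrier (tensor K R X M)"
    thus "tensor_map K R X P (\<lambda>x. g (f x)) y = tensor_map K R X P g (tensor_map K R X N f y)"
      by (intro tensor_map_comp[OF D D])
  qed
qed

section \<open>The free algebra\<close>

text \<open>For a product that is additive in both arguments, associativity and the unit laws need only be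
tested on additive generators. This is applied to words in the free algebra and to homogeneous
elements of the crossed product, where the product of two generators has a closed form.\<close>

lemma ring_of_generators:
  assumes "abelian_group V"
    and closed: "\<And>x y. \<lbrakk>x \<in> carrier V; y \<in> carrier V\<rbrakk> \<Longrightarrow> x \<otimes>\<^bsub>V\<^esub> y \<in> carrier V"
    and ld: "\<And>x y z. \<lbrakk>x \<in> carrier V; y \<in> carrier V; z \<in> carrier V\<rbrakk> \<Longrightarrow>
      (x \<oplus>\<^bsub>V\<^esub> y) \<otimes>\<^bsub>V\<^esub> z = x \<otimes>\<^bsub>V\<^esub> z \<oplus>\<^bsub>V\<^esub> y \<otimes>\<^bsub>V\<^esub> z"
    and rd: "\<And>x y z. \<lbrakk>x \<in> carrier V; y \<in> carrier V; z \<in> carrier V\<rbrakk> \<Longrightarrow>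
      z \<otimes>\<^bsub>V\<^esub> (x \<oplus>\<^bsub>V\<^esub> y) = z \<otimes>\<^bsub>V\<^esub> x \<oplus>\<^bsub>V\<^esub> z \<otimes>\<^bsub>V\<^esub> y"
    and one: "\<one>\<^bsub>V\<^esub> \<in> carrier V" and S: "S \<subseteq> carrier V"
    and gens: "\<And>Q. \<lbrakk>S \<subseteq> Q; \<forall>x\<in>carrier V \<inter> Q. \<forall>y\<in>carrier V \<inter> Q. x \<oplus>\<^bsub>V\<^esub> y \<in> Q\<rbrakk> \<Longrightarrow> carrier V \<subseteq> Q"
    and assoc: "\<And>x y z. \<lbrakk>x \<in> S; y \<in> S; z \<in> S\<rbrakk> \<Longrightarrow> (x \<otimes>\<^bsub>V\<^esub> y) \<otimes>\<^bsub>V\<^esub> z = x \<otimes>\<^bsub>V\<^esub> (y \<otimes>\<^bsub>V\<^esub> z)"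
    and unit: "\<And>x. x \<in> S \<Longrightarrow> \<one>\<^bsub>V\<^esub> \<otimes>\<^bsub>V\<^esub> x = x" "\<And>x. x \<in> S \<Longrightarrow> x \<otimes>\<^bsub>V\<^esub> \<one>\<^bsub>V\<^esub> = x"
  shows "ring V"
proof (rule ringI[OF assms(1) monoidI ld rd])
  have S': "s \<in> carrier V" if "s \<in> S" for s using that S by auto
  have gen: "P x" if "x \<in> carrier V" "\<And>s. s \<in> S \<Longrightarrow> P s"
    "\<And>x y. \<lbrakk>x \<in> carrier V; y \<in> carrier V; P x; P y\<rbrakk> \<Longrightarrow> P (x \<oplus>\<^bsub>V\<^esub> y)" for P x
    using gens[of "Collect P"] that by blast
  note [simp] = closed ld rd S' one
  fix x y z assume x: "x \<in> carrier V" and y: "y \<in> carrier V" and z: "z \<in> carrier V"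
  show "\<one>\<^bsub>V\<^esub> \<otimes>\<^bsub>V\<^esub> x = x" using x by (rule gen) (auto simp: unit)
  show "x \<otimes>\<^bsub>V\<^esub> \<one>\<^bsub>V\<^esub> = x" using x by (rule gen) (auto simp: unit)
  have 1: "(s \<otimes>\<^bsub>V\<^esub> t) \<otimes>\<^bsub>V\<^esub> z = s \<otimes>\<^bsub>V\<^esub> (t \<otimes>\<^bsub>V\<^esub> z)" if "s \<in> S" "t \<in> S" for s t
    using z by (rule gen) (use that in \<open>auto simp: assoc\<close>)
  have 2: "(s \<otimes>\<^bsub>V\<^esub> y) \<otimes>\<^bsub>V\<^esub> z = s \<otimes>\<^bsub>V\<^esub> (y \<otimes>\<^bsub>V\<^esub> z)" if "s \<in> S" for s
    using y by (rule gen) (use that z in \<open>auto simp: 1\<close>)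
  show "(x \<otimes>\<^bsub>V\<^esub> y) \<otimes>\<^bsub>V\<^esub> z = x \<otimes>\<^bsub>V\<^esub> (y \<otimes>\<^bsub>V\<^esub> z)"
    using x by (rule gen) (use y z in \<open>auto simp: 2\<close>)
qed (use assms in auto)

context free_mod
begin

lemma free_algebra_simps:
  "carrier (free_algebra K S) = carrier (free_module K (lists S))"
  "zero (free_algebra K S) = zero (free_module K (lists S))"
  "add (free_algebra K S) = add (free_module K (lists S))"
  "smult (free_algebra K S) = smult (free_module K (lists S))"
  "one (free_algebra K S) = kdelta K []"
  "f \<otimes>\<^bsub>free_algebra K S\<^esub> h = (\<lambda>w. \<Oplus>i\<in>{..length w}. f (take i w) \<otimes> h (drop i w))"
  by (simp_all add: free_algebra_def)

lemma module_free_algebra: "module K (free_algebra K S)"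
  by (rule module_cong[OF free_module_is_module[of "lists S"]]) (simp_all add: free_algebra_simps)

lemma fa_carrierD:
  "f \<in> carrier (free_algebra K S) \<Longrightarrow> f x \<in> carrier K"
  by (simp add: free_algebra_simps free_module_carrierD)

lemma fa_delta_closed: "w \<in> lists S \<Longrightarrow> kdelta K w \<in> carrier (free_algebra K S)"
  by (simp add: free_algebra_simps kdelta_closed)

text \<open>A word in the support of a product splits into words from the two supports.\<close>

lemma fa_mult_closed:
  assumes f: "f \<in> carrier (free_algebra K S)" and h: "h \<in> carrier (free_algebra K S)"
  shows "f \<otimes>\<^bsub>free_algebra K S\<^esub> h \<in> carrier (free_algebra K S)"
proof -
  note fD = free_module_carrierD[OF f[unfolded free_algebra_simps]]
  note hD = free_module_carrierD[OF h[unfolded free_algebra_simps]]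
  let ?F = "(\<lambda>(a, b). a @ b) ` ({x. f x \<noteq> \<zero>} \<times> {x. h x \<noteq> \<zero>})"
  show ?thesis unfolding free_algebra_simps
  proof (rule free_module_carrierI[of _ ?F])
    show "finite ?F" using fD(2) hD(2) by simp
    show "?F \<subseteq> lists S"
    proof
      fix w assume "w \<in> ?F"
      then obtain a b where "w = a @ b" "a \<in> {x. f x \<noteq> \<zero>}" "b \<in> {x. h x \<noteq> \<zero>}"
        by (elim imageE SigmaE) simp
      thus "w \<in> lists S" using subsetD[OF fD(3), of a] subsetD[OF hD(3), of b] by simp
    qed
  next
    fix w show "(\<Oplus>i\<in>{..length w}. f (take i w) \<otimes> h (drop i w)) \<in> carrier K"
      using fD(1) hD(1) by (intro finsum_closed) auto
    assume w: "w \<notin> ?F"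
    have "f (take i w) \<otimes> h (drop i w) = \<zero>" for i
    proof (cases "f (take i w) = \<zero> \<or> h (drop i w) = \<zero>")
      case False
      hence "(\<lambda>(a, b). a @ b) (take i w, drop i w) \<in> ?F" by (intro imageI) auto
      thus ?thesis using w by simp
    qed (use fD(1) hD(1) in auto)
    thus "(\<Oplus>i\<in>{..length w}. f (take i w) \<otimes> h (drop i w)) = \<zero>" by (simp add: finsum_zero)
  qed
qed

lemma fa_delta_mult: "kdelta K a \<otimes>\<^bsub>free_algebra K S\<^esub> kdelta K b = kdelta K (a @ b)"
proof
  fix w
  have "(\<Oplus>i\<in>{..length w}. kdelta K a (take i w) \<otimes> kdelta K b (drop i w)) = kdelta K (a @ b) w"
  proof (cases "w = a @ b")
    case True
    have "(\<Oplus>i\<in>{..length w}. kdelta K a (take i w) \<otimes> kdelta K b (drop i w)) =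
        (\<Oplus>i\<in>{..length w}. if length a = i then \<one> else \<zero>)"
    proof (rule finsum_cong')
      fix i assume "i \<in> {..length w}"
      hence i: "i \<le> length w" by simp
      show "kdelta K a (take i w) \<otimes> kdelta K b (drop i w) = (if length a = i then \<one> else \<zero>)"
      proof (cases "i = length a")
        case False
        hence "take i w \<noteq> a" using i by (metis length_take min.absorb2)
        thus ?thesis using False by (auto simp: kdelta_def)
      qed (simp add: True kdelta_def)
    qed auto
    also have "\<dots> = \<one>" using True by (subst finsum_singleton[where f = "\<lambda>_. \<one>"]) auto
    finally show ?thesis using True by (simp add: kdelta_def)
  next
    case False
    have "kdelta K a (take i w) \<otimes> kdelta K b (drop i w) = \<zero>" for i
    proof -
      have "take i w \<noteq> a \<or> drop i w \<noteq> b" using False append_take_drop_id[of i w] by metis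
      thus ?thesis by (auto simp: kdelta_def)
    qed
    thus ?thesis using False by (simp add: finsum_zero) (simp add: kdelta_def)
  qed
  thus "(kdelta K a \<otimes>\<^bsub>free_algebra K S\<^esub> kdelta K b) w = kdelta K (a @ b) w"
    by (simp add: free_algebra_simps)
qed

lemma fa_distrib:
  assumes "f \<in> carrier (free_algebra K S)" "g \<in> carrier (free_algebra K S)" "h \<in> carrier (free_algebra K S)"
  shows "(f \<oplus>\<^bsub>free_algebra K S\<^esub> g) \<otimes>\<^bsub>free_algebra K S\<^esub> h =
      f \<otimes>\<^bsub>free_algebra K S\<^esub> h \<oplus>\<^bsub>free_algebra K S\<^esub> g \<otimes>\<^bsub>free_algebra K S\<^esub> h"
    and "h \<otimes>\<^bsub>free_algebra K S\<^esub> (f \<oplus>\<^bsub>free_algebra K S\<^esub> g) =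
      h \<otimes>\<^bsub>free_algebra K S\<^esub> f \<oplus>\<^bsub>free_algebra K S\<^esub> h \<otimes>\<^bsub>free_algebra K S\<^esub> g"
  by (auto simp: free_algebra_simps fun_eq_iff l_distr r_distr finsum_addf Pi_def fa_carrierD[OF assms(1)]
      fa_carrierD[OF assms(2)] fa_carrierD[OF assms(3)])

lemma fa_smult:
  assumes "c \<in> carrier K" "f \<in> carrier (free_algebra K S)" "h \<in> carrier (free_algebra K S)"
  shows "(c \<odot>\<^bsub>free_algebra K S\<^esub> f) \<otimes>\<^bsub>free_algebra K S\<^esub> h = c \<odot>\<^bsub>free_algebra K S\<^esub> (f \<otimes>\<^bsub>free_algebra K S\<^esub> h)"
    and "f \<otimes>\<^bsub>free_algebra K S\<^esub> (c \<odot>\<^bsub>free_algebra K S\<^esub> h) = c \<odot>\<^bsub>free_algebra K S\<^esub> (f \<otimes>\<^bsub>free_algebra K S\<^esub> h)"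
  by (auto simp: free_algebra_simps fun_eq_iff finsum_rdistr assms(1) Pi_def m_assoc m_lcomm
      fa_carrierD[OF assms(2)] fa_carrierD[OF assms(3)])

lemma fa_induct [consumes 1, case_names single add]:
  assumes "f \<in> carrier (free_algebra K S)"
    and single: "\<And>c w. \<lbrakk>c \<in> carrier K; w \<in> lists S\<rbrakk> \<Longrightarrow> P (c \<odot>\<^bsub>free_algebra K S\<^esub> kdelta K w)"
    and add: "\<And>f g. \<lbrakk>f \<in> carrier (free_algebra K S); g \<in> carrier (free_algebra K S); P f; P g\<rbrakk>
        \<Longrightarrow> P (f \<oplus>\<^bsub>free_algebra K S\<^esub> g)"
  shows "P f"
  using assms(1) unfolding free_algebra_simps
proof (induction f rule: free_module_induct)
  case zero
  have "\<zero> \<odot>\<^bsub>free_algebra K S\<^esub> kdelta K [] = (\<lambda>x. \<zero>)"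
    by (auto simp: free_algebra_simps kdelta_def)
  thus ?case using single[of \<zero> "[]"] by simp
next
  case (single c w) thus ?case using assms(2)[of c w] by (simp add: free_algebra_simps)
next
  case (add f g) thus ?case using assms(3)[of f g] by (simp add: free_algebra_simps)
qed

lemma unital_alg_free_algebra: "unital_alg K (free_algebra K S)"
proof -
  interpret FA: module K "free_algebra K S" by (rule module_free_algebra)
  let ?S = "{c \<odot>\<^bsub>free_algebra K S\<^esub> kdelta K w | c w. c \<in> carrier K \<and> w \<in> lists S}"
  note [simp] = fa_delta_closed fa_smult fa_mult_closed fa_delta_mult
  have one: "\<one>\<^bsub>free_algebra K S\<^esub> = kdelta K []" by (simp add: free_algebra_simps)
  have "ring (free_algebra K S)"
  proof (rule ring_of_generators[where S = ?S])
    fix Q assume s: "?S \<subseteq> Q" and a: "\<forall>x\<in>carrier (free_algebra K S) \<inter> Q. \<forall>y\<in>carrier (free_algebra K S) \<inter> Q.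
        x \<oplus>\<^bsub>free_algebra K S\<^esub> y \<in> Q"
    show "carrier (free_algebra K S) \<subseteq> Q"
    proof
      fix x assume "x \<in> carrier (free_algebra K S)"
      thus "x \<in> Q" by (induction x rule: fa_induct) (use s a in blast)+
    qed
  next
    show "?S \<subseteq> carrier (free_algebra K S)" by (auto intro!: FA.smult_closed fa_delta_closed)
  next
    fix x assume "x \<in> ?S"
    then obtain c w where w: "x = c \<odot>\<^bsub>free_algebra K S\<^esub> kdelta K w" "c \<in> carrier K" "w \<in> lists S" by blast
    note [simp] = fa_delta_closed[OF w(3)] fa_delta_closed[of "[]" S]
    show "\<one>\<^bsub>free_algebra K S\<^esub> \<otimes>\<^bsub>free_algebra K S\<^esub> x = x" "x \<otimes>\<^bsub>free_algebra K S\<^esub> \<one>\<^bsub>free_algebra K S\<^esub> = x"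
      using w(1,2) by (simp_all add: one)
    fix y z assume "y \<in> ?S" "z \<in> ?S"
    then obtain c' w' c'' w'' where w': "y = c' \<odot>\<^bsub>free_algebra K S\<^esub> kdelta K w'" "c' \<in> carrier K" "w' \<in> lists S"
      "z = c'' \<odot>\<^bsub>free_algebra K S\<^esub> kdelta K w''" "c'' \<in> carrier K" "w'' \<in> lists S" by blast
    have [simp]: "w @ w' \<in> lists S" "w' @ w'' \<in> lists S" using w w' by simp_all
    note [simp] = fa_delta_closed[OF w'(3)] fa_delta_closed[OF w'(6)]
      fa_delta_closed[of "w @ w'" S] fa_delta_closed[of "w' @ w''" S]
    show "(x \<otimes>\<^bsub>free_algebra K S\<^esub> y) \<otimes>\<^bsub>free_algebra K S\<^esub> z = x \<otimes>\<^bsub>free_algebra K S\<^esub> (y \<otimes>\<^bsub>free_algebra K S\<^esub> z)"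
      using w w' by simp
  qed (auto simp: FA.M.abelian_group_axioms fa_distrib one)
  thus ?thesis
    by (intro unital_alg.intro unital_alg_axioms.intro module_free_algebra) auto
qed

end

section \<open>The twisted partial group algebra\<close>

text \<open>The generator \<open>[1]\<close> is neutral for all generators, but the unit of \<open>\<kappa>\<^sub>p\<^sub>a\<^sub>r G\<close> is the empty word.\<close>

locale kpar_data = K: cring K + G: group G
  for K :: "'k ring" and G :: "'g monoid" and \<rho> :: "'g \<Rightarrow> 'g \<Rightarrow> 'k" +
  assumes \<rho>_closed: "\<lbrakk>g \<in> carrier G; h \<in> carrier G\<rbrakk> \<Longrightarrow> \<rho> g h \<in> carrier K"
begin

abbreviation FA where "FA \<equiv> free_algebra K (carrier G)"
abbreviation I where "I \<equiv> par_ideal K G \<rho>"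
abbreviation P where "P \<equiv> kpar K G \<rho>"
abbreviation word :: "'g list \<Rightarrow> ('g list \<Rightarrow> 'k) set" where "word w \<equiv> I +>\<^bsub>FA\<^esub> kdelta K w"
abbreviation gen where "gen \<equiv> par_gen K G \<rho>"

sublocale F: free_mod K by (simp add: free_mod_def K.is_cring)
sublocale FA: unital_alg K FA by (rule F.unital_alg_free_algebra)

lemma delta_closed: "w \<in> lists (carrier G) \<Longrightarrow> kdelta K w \<in> carrier FA"
  by (rule F.fa_delta_closed)

lemma par_rels_closed: "par_rels K G \<rho> \<subseteq> carrier FA"
  unfolding par_rels_def Let_def
  by (auto simp: F.fa_delta_mult delta_closed \<rho>_closed intro!: FA.M.minus_closed)

lemma ideal_I: "ideal I FA"
  unfolding par_ideal_def by (rule FA.A.genideal_ideal[OF par_rels_closed])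

sublocale I: ideal I FA by (rule ideal_I)

lemma rel_in_I: "r \<in> par_rels K G \<rho> \<Longrightarrow> r \<in> I"
  unfolding par_ideal_def by (rule subsetD[OF FA.A.genideal_self[OF par_rels_closed]])

lemma submodule_I: "submodule I K FA"
proof (rule FA.submoduleI)
  fix c x assume c: "c \<in> carrier K" and x: "x \<in> I"
  have "c \<odot>\<^bsub>FA\<^esub> x = (c \<odot>\<^bsub>FA\<^esub> \<one>\<^bsub>FA\<^esub>) \<otimes>\<^bsub>FA\<^esub> x" using c x I.Icarr by (simp add: FA.scalar_one_mult)
  also have "\<dots> \<in> I" using c x by (intro I.I_l_closed) auto
  finally show "c \<odot>\<^bsub>FA\<^esub> x \<in> I" .
qed (use I.Icarr in auto)

sublocale Q: quotient_module K FA I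
  by (intro quotient_module.intro FA.module_axioms submodule_I)

lemma P_eq: "P = quot_module FA I" by (simp add: kpar_def)

lemma ring_P: "ring P"
proof (rule ring_cong[OF I.quotient_is_ring])
qed (simp_all add: P_eq quot_module_def)

lemma coset_mult: "\<lbrakk>x \<in> carrier FA; y \<in> carrier FA\<rbrakk> \<Longrightarrow> Q.coset x \<otimes>\<^bsub>P\<^esub> Q.coset y = Q.coset (x \<otimes>\<^bsub>FA\<^esub> y)"
  by (simp add: P_eq quot_module_def FactRing_def I.rcoset_mult_add)

lemma unital_alg_P: "unital_alg K P"
  by (intro unital_alg.intro unital_alg_axioms.intro ring_P)
    (auto simp: P_eq Q.quot_module_is_module Q.quot_carrier Q.quot_smult
      coset_mult[unfolded P_eq] FA.smult_mult_left FA.smult_mult_right)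

sublocale P: unital_alg K P by (rule unital_alg_P)

lemma word_closed: "w \<in> lists (carrier G) \<Longrightarrow> word w \<in> carrier P"
  by (simp add: P_eq Q.coset_closed delta_closed)

lemma one_P: "\<one>\<^bsub>P\<^esub> = word []"
  by (simp add: P_eq quot_module_def FactRing_def F.free_algebra_simps(5))

lemma gen_eq: "gen g = word [g]" by (simp add: par_gen_def)

lemma gen_closed: "g \<in> carrier G \<Longrightarrow> gen g \<in> carrier P"
  by (simp add: gen_eq word_closed)

lemma P_induct [consumes 1, case_names word add]:
  assumes "X \<in> carrier P"
    and "\<And>c w. \<lbrakk>c \<in> carrier K; w \<in> lists (carrier G)\<rbrakk> \<Longrightarrow> \<Phi> (c \<odot>\<^bsub>P\<^esub> word w)"
    and "\<And>X Y. \<lbrakk>X \<in> carrier P; Y \<in> carrier P; \<Phi> X; \<Phi> Y\<rbrakk> \<Longrightarrow> \<Phi> (X \<oplus>\<^bsub>P\<^esub> Y)"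
  shows "\<Phi> X"
proof -
  obtain f where f: "f \<in> carrier FA" "X = Q.coset f" using assms(1) by (auto simp: P_eq Q.quot_carrier)
  from f(1) have "\<Phi> (Q.coset f)"
  proof (induction f rule: F.fa_induct)
    case (single c w) thus ?case using assms(2)[of c w] by (simp add: P_eq Q.quot_smult delta_closed)
  next
    case (add f g) thus ?case using assms(3)[of "Q.coset f" "Q.coset g"]
      by (simp add: P_eq Q.quot_add Q.coset_closed)
  qed
  thus ?thesis using f by simp
qed

lemma gen_zero_left:
  assumes "g \<in> carrier G" "h \<in> carrier G" "\<rho> g h = \<zero>\<^bsub>K\<^esub>"
  shows "gen (inv\<^bsub>G\<^esub> g) \<otimes>\<^bsub>P\<^esub> gen (g \<otimes>\<^bsub>G\<^esub> h) = \<zero>\<^bsub>P\<^esub>"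
proof -
  have "kdelta K [inv\<^bsub>G\<^esub> g] \<otimes>\<^bsub>FA\<^esub> kdelta K [g \<otimes>\<^bsub>G\<^esub> h] \<in> par_rels K G \<rho>"
    unfolding par_rels_def Let_def using assms by blast
  from Q.coset_zeroI[OF rel_in_I[OF this], folded P_eq] show ?thesis using assms
    by (simp add: gen_eq coset_mult delta_closed)
qed

lemma gen_zero_right:
  assumes "g \<in> carrier G" "h \<in> carrier G" "\<rho> g h = \<zero>\<^bsub>K\<^esub>"
  shows "gen (g \<otimes>\<^bsub>G\<^esub> h) \<otimes>\<^bsub>P\<^esub> gen (inv\<^bsub>G\<^esub> h) = \<zero>\<^bsub>P\<^esub>"
proof -
  have "kdelta K [g \<otimes>\<^bsub>G\<^esub> h] \<otimes>\<^bsub>FA\<^esub> kdelta K [inv\<^bsub>G\<^esub> h] \<in> par_rels K G \<rho>"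
    unfolding par_rels_def Let_def using assms by blast
  from Q.coset_zeroI[OF rel_in_I[OF this], folded P_eq] show ?thesis using assms
    by (simp add: gen_eq coset_mult delta_closed)
qed

lemma gen_mult_left:
  assumes "g \<in> carrier G" "h \<in> carrier G"
  shows "gen (inv\<^bsub>G\<^esub> g) \<otimes>\<^bsub>P\<^esub> gen g \<otimes>\<^bsub>P\<^esub> gen h = \<rho> g h \<odot>\<^bsub>P\<^esub> (gen (inv\<^bsub>G\<^esub> g) \<otimes>\<^bsub>P\<^esub> gen (g \<otimes>\<^bsub>G\<^esub> h))"
proof -
  have "(kdelta K [inv\<^bsub>G\<^esub> g] \<otimes>\<^bsub>FA\<^esub> kdelta K [g] \<otimes>\<^bsub>FA\<^esub> kdelta K [h]) \<ominus>\<^bsub>FA\<^esub>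
      (\<rho> g h \<odot>\<^bsub>FA\<^esub> (kdelta K [inv\<^bsub>G\<^esub> g] \<otimes>\<^bsub>FA\<^esub> kdelta K [g \<otimes>\<^bsub>G\<^esub> h])) \<in> par_rels K G \<rho>"
    unfolding par_rels_def Let_def using assms by blast
  from Q.coset_eqI[OF rel_in_I[OF this]] show ?thesis using assms
    by (simp add: gen_eq coset_mult delta_closed \<rho>_closed Q.quot_smult[folded P_eq])
qed

lemma gen_mult_right:
  assumes "g \<in> carrier G" "h \<in> carrier G"
  shows "gen g \<otimes>\<^bsub>P\<^esub> gen h \<otimes>\<^bsub>P\<^esub> gen (inv\<^bsub>G\<^esub> h) = \<rho> g h \<odot>\<^bsub>P\<^esub> (gen (g \<otimes>\<^bsub>G\<^esub> h) \<otimes>\<^bsub>P\<^esub> gen (inv\<^bsub>G\<^esub> h))"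
proof -
  have "(kdelta K [g] \<otimes>\<^bsub>FA\<^esub> kdelta K [h] \<otimes>\<^bsub>FA\<^esub> kdelta K [inv\<^bsub>G\<^esub> h]) \<ominus>\<^bsub>FA\<^esub>
      (\<rho> g h \<odot>\<^bsub>FA\<^esub> (kdelta K [g \<otimes>\<^bsub>G\<^esub> h] \<otimes>\<^bsub>FA\<^esub> kdelta K [inv\<^bsub>G\<^esub> h])) \<in> par_rels K G \<rho>"
    unfolding par_rels_def Let_def using assms by blast
  from Q.coset_eqI[OF rel_in_I[OF this]] show ?thesis using assms
    by (simp add: gen_eq coset_mult delta_closed \<rho>_closed Q.quot_smult[folded P_eq])
qed

lemma gen_one:
  assumes "g \<in> carrier G"
  shows "gen g \<otimes>\<^bsub>P\<^esub> gen \<one>\<^bsub>G\<^esub> = gen g" "gen \<one>\<^bsub>G\<^esub> \<otimes>\<^bsub>P\<^esub> gen g = gen g"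
proof -
  have "(kdelta K [g] \<otimes>\<^bsub>FA\<^esub> kdelta K [\<one>\<^bsub>G\<^esub>]) \<ominus>\<^bsub>FA\<^esub> kdelta K [g] \<in> par_rels K G \<rho>"
    unfolding par_rels_def Let_def using assms by blast
  from Q.coset_eqI[OF rel_in_I[OF this]] show "gen g \<otimes>\<^bsub>P\<^esub> gen \<one>\<^bsub>G\<^esub> = gen g" using assms
    by (simp add: gen_eq coset_mult delta_closed)
  have "(kdelta K [\<one>\<^bsub>G\<^esub>] \<otimes>\<^bsub>FA\<^esub> kdelta K [g]) \<ominus>\<^bsub>FA\<^esub> kdelta K [g] \<in> par_rels K G \<rho>"
    unfolding par_rels_def Let_def using assms by blast
  from Q.coset_eqI[OF rel_in_I[OF this]] show "gen \<one>\<^bsub>G\<^esub> \<otimes>\<^bsub>P\<^esub> gen g = gen g" using assms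
    by (simp add: gen_eq coset_mult delta_closed)
qed

end

text \<open>Left and right modules over \<open>\<kappa>\<^sub>p\<^sub>a\<^sub>r G\<close> given by operators for the generators. The function \<open>ap\<close> assigns
an operator to every word, multiplicatively for left modules and anti-multiplicatively for right
modules, so that the defining relations have the same form in both cases.\<close>

locale word_action = kpar_data K G \<rho> + V: module K V
  for K :: "'k ring" and G :: "'g monoid" and \<rho> :: "'g \<Rightarrow> 'g \<Rightarrow> 'k" and V :: "('k, 'v) module" +
  fixes ap :: "'g list \<Rightarrow> 'v \<Rightarrow> 'v"
  assumes ap_hom: "w \<in> lists (carrier G) \<Longrightarrow> ap w \<in> module_hom K V V"
    and ap_comp: "(\<forall>w w' v. ap (w @ w') v = ap w (ap w' v)) \<or> (\<forall>w w' v. ap (w @ w') v = ap w' (ap w v))"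
    and ap_zero_left: "\<lbrakk>g \<in> carrier G; h \<in> carrier G; v \<in> carrier V; \<rho> g h = \<zero>\<^bsub>K\<^esub>\<rbrakk> \<Longrightarrow>
      ap [inv\<^bsub>G\<^esub> g, g \<otimes>\<^bsub>G\<^esub> h] v = \<zero>\<^bsub>V\<^esub>"
    and ap_zero_right: "\<lbrakk>g \<in> carrier G; h \<in> carrier G; v \<in> carrier V; \<rho> g h = \<zero>\<^bsub>K\<^esub>\<rbrakk> \<Longrightarrow>
      ap [g \<otimes>\<^bsub>G\<^esub> h, inv\<^bsub>G\<^esub> h] v = \<zero>\<^bsub>V\<^esub>"
    and ap_mult_left: "\<lbrakk>g \<in> carrier G; h \<in> carrier G; v \<in> carrier V\<rbrakk> \<Longrightarrow>
      ap [inv\<^bsub>G\<^esub> g, g, h] v = \<rho> g h \<odot>\<^bsub>V\<^esub> ap [inv\<^bsub>G\<^esub> g, g \<otimes>\<^bsub>G\<^esub> h] v"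
    and ap_mult_right: "\<lbrakk>g \<in> carrier G; h \<in> carrier G; v \<in> carrier V\<rbrakk> \<Longrightarrow>
      ap [g, h, inv\<^bsub>G\<^esub> h] v = \<rho> g h \<odot>\<^bsub>V\<^esub> ap [g \<otimes>\<^bsub>G\<^esub> h, inv\<^bsub>G\<^esub> h] v"
    and ap_one_left: "\<lbrakk>g \<in> carrier G; v \<in> carrier V\<rbrakk> \<Longrightarrow> ap [\<one>\<^bsub>G\<^esub>, g] v = ap [g] v"
    and ap_one_right: "\<lbrakk>g \<in> carrier G; v \<in> carrier V\<rbrakk> \<Longrightarrow> ap [g, \<one>\<^bsub>G\<^esub>] v = ap [g] v"
begin

text \<open>The action of the free algebra, and the induced map on the quotient by the relations.\<close>

definition lin :: "('g list \<Rightarrow> 'k) \<Rightarrow> 'v \<Rightarrow> 'v"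
  where "lin f v = lin_ext K V (\<lambda>w. ap w v) f"

definition act :: "('g list \<Rightarrow> 'k) set \<Rightarrow> 'v \<Rightarrow> 'v"
  where "act X v = quot_lift K V (\<lambda>w. ap w v) X"

lemma ap_closed: "\<lbrakk>w \<in> lists (carrier G); v \<in> carrier V\<rbrakk> \<Longrightarrow> ap w v \<in> carrier V"
  by (rule module_hom_closed[OF ap_hom])

lemma lin_hom_left: "v \<in> carrier V \<Longrightarrow> (\<lambda>f. lin f v) \<in> module_hom K FA V"
proof -
  assume v: "v \<in> carrier V"
  have "lin_ext K V (\<lambda>w. ap w v) \<in> module_hom K (free_module K (lists (carrier G))) V"
    by (rule lin_ext_hom[OF V.module_axioms ap_closed[OF _ v]])
  thus ?thesis by (simp add: lin_def module_hom_def F.free_algebra_simps)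
qed

lemma lin_delta: "\<lbrakk>w \<in> lists (carrier G); v \<in> carrier V\<rbrakk> \<Longrightarrow> lin (kdelta K w) v = ap w v"
  using lin_ext_kdelta[OF V.module_axioms, of "\<lambda>w. ap w v" w] by (simp add: lin_def ap_closed)

lemma lin_single: "\<lbrakk>c \<in> carrier K; w \<in> lists (carrier G); v \<in> carrier V\<rbrakk> \<Longrightarrow>
    lin (c \<odot>\<^bsub>FA\<^esub> kdelta K w) v = c \<odot>\<^bsub>V\<^esub> ap w v"
  using module_hom_smult[OF lin_hom_left, of v c "kdelta K w"] lin_delta[of w v] delta_closed[of w] by simp

lemma lin_add: "\<lbrakk>f \<in> carrier FA; h \<in> carrier FA; v \<in> carrier V\<rbrakk> \<Longrightarrow>
    lin (f \<oplus>\<^bsub>FA\<^esub> h) v = lin f v \<oplus>\<^bsub>V\<^esub> lin h v"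
  by (rule module_hom_add[OF lin_hom_left])

lemma lin_smult: "\<lbrakk>c \<in> carrier K; f \<in> carrier FA; v \<in> carrier V\<rbrakk> \<Longrightarrow>
    lin (c \<odot>\<^bsub>FA\<^esub> f) v = c \<odot>\<^bsub>V\<^esub> lin f v"
  by (rule module_hom_smult[OF lin_hom_left])

lemma lin_closed: "\<lbrakk>f \<in> carrier FA; v \<in> carrier V\<rbrakk> \<Longrightarrow> lin f v \<in> carrier V"
  by (rule module_hom_closed[OF lin_hom_left])

lemma lin_hom_right: "f \<in> carrier FA \<Longrightarrow> lin f \<in> module_hom K V V"
proof (induction f rule: F.fa_induct)
  case (single c w)
  note h = ap_hom[OF single(2)]
  show ?case
    by (rule module_homI) (use single in \<open>simp_all add: lin_single module_hom_closed[OF h]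
      module_hom_add[OF h] module_hom_smult[OF h] V.smult_r_distr K.m_comm flip: V.smult_assoc1\<close>)
next
  case (add f h)
  show ?case
    by (rule module_homI) (use add(1,2) in \<open>simp_all add: lin_add lin_closed V.smult_r_distr V.M.a_ac
      module_hom_add[OF add(3)] module_hom_add[OF add(4)]
      module_hom_smult[OF add(3)] module_hom_smult[OF add(4)]\<close>)
qed

text \<open>Multiplicativity is a statement about two linear variables; it is reduced to words one variable
at a time.\<close>

lemma lin_mult_aux:
  assumes ap: "\<And>w' v. \<lbrakk>w' \<in> lists (carrier G); v \<in> carrier V\<rbrakk> \<Longrightarrow> ap (w @ w') v = ap w (ap w' v)"
    and w: "w \<in> lists (carrier G)" and h: "h \<in> carrier FA" and v: "v \<in> carrier V"
  shows "lin (kdelta K w \<otimes>\<^bsub>FA\<^esub> h) v = ap w (lin h v)"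
  using h
proof (induction h rule: F.fa_induct)
  case (single c w')
  have "w @ w' \<in> lists (carrier G)" using single w by simp
  thus ?case using single w v ap[OF single(2) v]
    by (simp add: F.fa_smult delta_closed F.fa_delta_mult lin_single module_hom_smult[OF ap_hom] ap_closed
      del: append_in_lists_conv)
next
  case (add f h)
  thus ?case using w v
    by (simp add: F.fa_distrib delta_closed lin_add lin_closed module_hom_add[OF ap_hom] F.fa_mult_closed)
qed

lemma lin_mult_left:
  assumes ap: "\<forall>w w' v. ap (w @ w') v = ap w (ap w' v)"
    and f: "f \<in> carrier FA" and h: "h \<in> carrier FA" and v: "v \<in> carrier V"
  shows "lin (f \<otimes>\<^bsub>FA\<^esub> h) v = lin f (lin h v)"
  using f
proof (induction f rule: F.fa_induct)
  case (single c w)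
  thus ?case using h v lin_mult_aux[OF _ single(2) h v] ap
    by (simp add: F.fa_smult delta_closed lin_smult F.fa_mult_closed lin_closed lin_delta)
next
  case (add f g)
  thus ?case using h v by (simp add: F.fa_distrib lin_add lin_closed F.fa_mult_closed)
qed

lemma lin_mult_aux':
  assumes ap: "\<And>w' v. \<lbrakk>w' \<in> lists (carrier G); v \<in> carrier V\<rbrakk> \<Longrightarrow> ap (w' @ w) v = ap w (ap w' v)"
    and w: "w \<in> lists (carrier G)" and h: "h \<in> carrier FA" and v: "v \<in> carrier V"
  shows "lin (h \<otimes>\<^bsub>FA\<^esub> kdelta K w) v = ap w (lin h v)"
  using h
proof (induction h rule: F.fa_induct)
  case (single c w')
  have "w' @ w \<in> lists (carrier G)" using single w by simp
  thus ?case using single w v ap[OF single(2) v]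
    by (simp add: F.fa_smult delta_closed F.fa_delta_mult lin_single module_hom_smult[OF ap_hom] ap_closed
      del: append_in_lists_conv)
next
  case (add f h)
  thus ?case using w v
    by (simp add: F.fa_distrib delta_closed lin_add lin_closed module_hom_add[OF ap_hom] F.fa_mult_closed)
qed

lemma lin_mult_right:
  assumes ap: "\<forall>w w' v. ap (w @ w') v = ap w' (ap w v)"
    and f: "f \<in> carrier FA" and h: "h \<in> carrier FA" and v: "v \<in> carrier V"
  shows "lin (h \<otimes>\<^bsub>FA\<^esub> f) v = lin f (lin h v)"
  using f
proof (induction f rule: F.fa_induct)
  case (single c w)
  thus ?case using h v lin_mult_aux'[OF _ single(2) h v] ap
    by (simp add: F.fa_smult delta_closed lin_smult F.fa_mult_closed lin_closed lin_delta)
next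
  case (add f g)
  thus ?case using h v by (simp add: F.fa_distrib lin_add lin_closed F.fa_mult_closed)
qed

lemma lin_zero: "f \<in> carrier FA \<Longrightarrow> lin f \<zero>\<^bsub>V\<^esub> = \<zero>\<^bsub>V\<^esub>"
  by (rule module_hom_zero[OF V.module_axioms V.module_axioms lin_hom_right])

lemma lin_rels:
  assumes r: "r \<in> par_rels K G \<rho>" and v: "v \<in> carrier V"
  shows "lin r v = \<zero>\<^bsub>V\<^esub>"
proof -
  have minus: "lin (f \<ominus>\<^bsub>FA\<^esub> h) v = \<zero>\<^bsub>V\<^esub>" if "f \<in> carrier FA" "h \<in> carrier FA" "lin f v = lin h v" for f h
    using module_hom_minus[OF FA.module_KR V.module_axioms lin_hom_left[OF v] that(1,2)] that v
    by (simp add: a_minus_def V.M.r_neg lin_closed)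
  show ?thesis using r v unfolding par_rels_def Let_def
    by (auto simp: F.fa_delta_mult delta_closed \<rho>_closed lin_delta lin_single ap_zero_left ap_zero_right
      ap_mult_left ap_mult_right ap_one_left ap_one_right intro!: minus)
qed

text \<open>The elements of the free algebra that act as zero form a two-sided ideal, for either order of
composition. It contains the relations, hence the ideal they generate.\<close>

lemma lin_I:
  assumes "f \<in> I" "v \<in> carrier V"
  shows "lin f v = \<zero>\<^bsub>V\<^esub>"
proof -
  let ?J = "{f \<in> carrier FA. \<forall>v\<in>carrier V. lin f v = \<zero>\<^bsub>V\<^esub>}"
  have hom: "\<And>v. v \<in> carrier V \<Longrightarrow> (\<lambda>f. lin f v) \<in> module_hom K FA V" by (rule lin_hom_left)
  note hz = module_hom_zero[OF FA.module_KR V.module_axioms hom]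
  note hu = module_hom_uminus[OF FA.module_KR V.module_axioms hom]
  have "ideal ?J FA"
  proof (rule idealI)
    show "ring FA" by (rule FA.A.ring_axioms)
    show "subgroup ?J (add_monoid FA)"
      by (rule FA.M.add.subgroupI) (auto simp: hz hu lin_add)
    fix a x assume "a \<in> ?J" and x: "x \<in> carrier FA"
    hence a: "a \<in> carrier FA" "\<And>v. v \<in> carrier V \<Longrightarrow> lin a v = \<zero>\<^bsub>V\<^esub>" by auto
    show "x \<otimes>\<^bsub>FA\<^esub> a \<in> ?J" "a \<otimes>\<^bsub>FA\<^esub> x \<in> ?J"
      using ap_comp by (auto simp: lin_mult_left lin_mult_right a x lin_zero lin_closed)
  qed
  moreover have "par_rels K G \<rho> \<subseteq> ?J" using lin_rels par_rels_closed by auto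
  ultimately have "I \<subseteq> ?J" unfolding par_ideal_def by (rule FA.A.genideal_minimal)
  thus ?thesis using assms by auto
qed

lemma act_coset: "\<lbrakk>f \<in> carrier FA; v \<in> carrier V\<rbrakk> \<Longrightarrow> act (Q.coset f) v = lin f v"
  using Q.the_elem_image_coset[OF V.module_axioms lin_hom_left lin_I]
  by (simp add: act_def quot_lift_def lin_def)

lemma act_word: "\<lbrakk>w \<in> lists (carrier G); v \<in> carrier V\<rbrakk> \<Longrightarrow> act (word w) v = ap w v"
  by (simp add: act_coset delta_closed lin_delta)

lemma act_gen: "\<lbrakk>g \<in> carrier G; v \<in> carrier V\<rbrakk> \<Longrightarrow> act (gen g) v = ap [g] v"
  by (simp add: gen_eq act_word)

lemma P_coset: "X \<in> carrier P \<Longrightarrow> (\<And>f. \<lbrakk>f \<in> carrier FA; X = Q.coset f\<rbrakk> \<Longrightarrow> thesis) \<Longrightarrow> thesis"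
  by (auto simp: P_eq Q.quot_carrier)

lemma act_hom_left: "v \<in> carrier V \<Longrightarrow> (\<lambda>X. act X v) \<in> module_hom K P V"
  by (rule module_homI)
    (auto elim!: P_coset simp: act_coset lin_closed lin_add lin_smult
      Q.quot_add[folded P_eq] Q.quot_smult[folded P_eq])

lemma act_hom_right: "X \<in> carrier P \<Longrightarrow> act X \<in> module_hom K V V"
  by (elim P_coset) (auto intro!: module_homI simp: act_coset lin_closed module_hom_add[OF lin_hom_right]
    module_hom_smult[OF lin_hom_right])

lemma act_closed: "\<lbrakk>X \<in> carrier P; v \<in> carrier V\<rbrakk> \<Longrightarrow> act X v \<in> carrier V"
  by (rule module_hom_closed[OF act_hom_right])

lemma act_mult_left:
  assumes "\<forall>w w' v. ap (w @ w') v = ap w (ap w' v)" "X \<in> carrier P" "Y \<in> carrier P" "v \<in> carrier V"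
  shows "act (X \<otimes>\<^bsub>P\<^esub> Y) v = act X (act Y v)"
  using assms by (auto elim!: P_coset simp: coset_mult act_coset lin_mult_left F.fa_mult_closed lin_closed)

lemma act_mult_right:
  assumes "\<forall>w w' v. ap (w @ w') v = ap w' (ap w v)" "X \<in> carrier P" "Y \<in> carrier P" "v \<in> carrier V"
  shows "act (X \<otimes>\<^bsub>P\<^esub> Y) v = act Y (act X v)"
  using assms by (auto elim!: P_coset simp: coset_mult act_coset lin_mult_right F.fa_mult_closed lin_closed)

end

section \<open>Unital twisted partial actions\<close>

text \<open>An ideal generated by a central idempotent \<open>e\<close> is the set of elements fixed by multiplication with
\<open>e\<close>. In this form membership in the domains \<open>D\<^sub>g\<close> and their products becomes an equation.\<close>

lemma (in ring) Idl_central_idem: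
  assumes "e \<in> carrier R" "e \<otimes> e = e" "\<And>a. a \<in> carrier R \<Longrightarrow> e \<otimes> a = a \<otimes> e"
  shows "Idl {e} = {a \<in> carrier R. e \<otimes> a = a}"
proof (rule equalityI)
  have "ideal {a \<in> carrier R. e \<otimes> a = a} R"
  proof (rule idealI)
    show "ring R" by (rule ring_axioms)
    show "subgroup {a \<in> carrier R. e \<otimes> a = a} (add_monoid R)"
      using assms(1) by (intro add.subgroupI) (auto simp: r_distr r_minus)
    fix a x assume "a \<in> {a \<in> carrier R. e \<otimes> a = a}" "x \<in> carrier R"
    hence a: "a \<in> carrier R" "e \<otimes> a = a" "x \<in> carrier R" by auto
    have "e \<otimes> (x \<otimes> a) = (x \<otimes> e) \<otimes> a"
      using a assms(1) assms(3)[OF a(3)] by (simp add: m_assoc[symmetric])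
    also have "\<dots> = x \<otimes> a" using a assms(1) by (simp add: m_assoc)
    finally show "x \<otimes> a \<in> {a \<in> carrier R. e \<otimes> a = a}" using a by simp
    show "a \<otimes> x \<in> {a \<in> carrier R. e \<otimes> a = a}" using a assms(1) by (simp add: m_assoc[symmetric])
  qed
  thus "Idl {e} \<subseteq> {a \<in> carrier R. e \<otimes> a = a}"
    by (rule genideal_minimal) (use assms(1,2) in auto)
  interpret I: ideal "Idl {e}" R by (rule genideal_ideal) (use assms(1) in auto)
  show "{a \<in> carrier R. e \<otimes> a = a} \<subseteq> Idl {e}"
  proof
    fix a assume a: "a \<in> {a \<in> carrier R. e \<otimes> a = a}"
    have "e \<otimes> a \<in> Idl {e}" using a assms(1) genideal_self'[of e] by (intro I.I_r_closed) auto
    thus "a \<in> Idl {e}" using a by simp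
  qed
qed

lemma (in ring) ideal_prod_central_idem:
  assumes "e \<in> carrier R" "e \<otimes> e = e" "\<And>a. a \<in> carrier R \<Longrightarrow> e \<otimes> a = a \<otimes> e"
    and "f \<in> carrier R" "f \<otimes> f = f" "\<And>a. a \<in> carrier R \<Longrightarrow> f \<otimes> a = a \<otimes> f"
  shows "ideal_prod R (Idl {e}) (Idl {f}) = {a \<in> carrier R. e \<otimes> f \<otimes> a = a}"
proof (rule equalityI; rule subsetI)
  fix a assume "a \<in> ideal_prod R (Idl {e}) (Idl {f})"
  thus "a \<in> {a \<in> carrier R. e \<otimes> f \<otimes> a = a}"
  proof (induction a rule: ideal_prod.induct)
    case (prod i j)
    hence i: "i \<in> carrier R" "e \<otimes> i = i" and j: "j \<in> carrier R" "f \<otimes> j = j"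
      using Idl_central_idem[OF assms(1-3)] Idl_central_idem[OF assms(4-6)] by auto
    have "e \<otimes> f \<otimes> (i \<otimes> j) = e \<otimes> (f \<otimes> i) \<otimes> j" using i j assms(1,4) by (simp add: m_assoc)
    also have "\<dots> = e \<otimes> i \<otimes> (f \<otimes> j)" using i(1) j(1) assms(1,4) assms(6)[OF i(1)] by (simp add: m_assoc)
    finally show ?case using i j by simp
  next
    case (sum s t) thus ?case using assms(1,4) by (simp add: r_distr)
  qed
next
  fix a assume a: "a \<in> {a \<in> carrier R. e \<otimes> f \<otimes> a = a}"
  have "f \<otimes> (f \<otimes> a) = f \<otimes> a" using a assms(4,5) by (simp add: m_assoc[symmetric])
  hence "e \<otimes> (f \<otimes> a) \<in> ideal_prod R (Idl {e}) (Idl {f})"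
    using a assms(1,2,4,5) by (intro ideal_prod.prod)
      (auto simp: Idl_central_idem[OF assms(1-3)] Idl_central_idem[OF assms(4-6)])
  moreover have "e \<otimes> (f \<otimes> a) = a" using a assms(1,4) m_assoc[of e f a] by simp
  ultimately show "a \<in> ideal_prod R (Idl {e}) (Idl {f})" by simp
qed

lemma (in module) smult_cancel:
  assumes "field R" "c \<in> carrier R" "c' \<in> carrier R" "x \<in> carrier M" "x \<noteq> \<zero>\<^bsub>M\<^esub>" "c \<odot>\<^bsub>M\<^esub> x = c' \<odot>\<^bsub>M\<^esub> x"
  shows "c = c'"
proof (rule ccontr)
  interpret field R by fact
  assume "c \<noteq> c'"
  hence "c \<ominus> c' \<noteq> \<zero>" using assms by auto
  hence u: "c \<ominus> c' \<in> Units R" using assms by (simp add: field_Units)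
  have "(c \<ominus> c') \<odot>\<^bsub>M\<^esub> x = \<zero>\<^bsub>M\<^esub>"
    using assms by (simp add: a_minus_def smult_l_distr smult_l_minus M.r_neg)
  hence "inv (c \<ominus> c') \<odot>\<^bsub>M\<^esub> ((c \<ominus> c') \<odot>\<^bsub>M\<^esub> x) = \<zero>\<^bsub>M\<^esub>" using u by simp
  moreover have "inv (c \<ominus> c') \<odot>\<^bsub>M\<^esub> ((c \<ominus> c') \<odot>\<^bsub>M\<^esub> x) = x"
    using u assms by (simp add: Units_l_inv flip: smult_assoc1)
  ultimately show False using assms by simp
qed

lemma kalgebra_unital_alg: "kalgebra K A \<Longrightarrow> unital_alg K A"
  by (auto simp: kalgebra_def kalgebra_axioms_def unital_alg_def unital_alg_axioms_def)

context unital_partial_action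
begin

sublocale K: field K by (rule field_K)
sublocale G: group G by (rule group_G)
sublocale A: unital_alg K A by (rule kalgebra_unital_alg[OF algebra_A])

abbreviation mult_A (infixl \<open>*\<^sub>A\<close> 70) where "a *\<^sub>A b \<equiv> a \<otimes>\<^bsub>A\<^esub> b"
abbreviation smult_A (infixl \<open>\<odot>\<^sub>A\<close> 70) where "c \<odot>\<^sub>A a \<equiv> c \<odot>\<^bsub>A\<^esub> a"
abbreviation mult_K (infixl \<open>*\<^sub>K\<close> 70) where "c *\<^sub>K c' \<equiv> c \<otimes>\<^bsub>K\<^esub> c'"
abbreviation mult_G (infixl \<open>*\<^sub>G\<close> 70) where "g *\<^sub>G h \<equiv> g \<otimes>\<^bsub>G\<^esub> h"
abbreviation inv_G (\<open>inv\<^sub>G _\<close> [81] 80) where "inv\<^sub>G g \<equiv> inv\<^bsub>G\<^esub> g"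

lemma inv_cancel [simp]:
  "\<lbrakk>g \<in> carrier G; h \<in> carrier G\<rbrakk> \<Longrightarrow> inv\<^sub>G g *\<^sub>G (g *\<^sub>G h) = h"
  "\<lbrakk>g \<in> carrier G; h \<in> carrier G\<rbrakk> \<Longrightarrow> g *\<^sub>G (inv\<^sub>G g *\<^sub>G h) = h"
  by (simp_all flip: G.m_assoc)

lemma u_comm: "\<lbrakk>g \<in> carrier G; a \<in> carrier A; b \<in> carrier A\<rbrakk> \<Longrightarrow> a *\<^sub>A (u g *\<^sub>A b) = u g *\<^sub>A (a *\<^sub>A b)"
  using u_central[of g a] u_closed[of g] by (simp flip: A.A.m_assoc)

lemma u_idem': "\<lbrakk>g \<in> carrier G; a \<in> carrier A\<rbrakk> \<Longrightarrow> u g *\<^sub>A (u g *\<^sub>A a) = u g *\<^sub>A a"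
  using u_idem[of g] u_closed[of g] by (simp flip: A.A.m_assoc)

lemma u_ac:
  "\<lbrakk>g \<in> carrier G; h \<in> carrier G\<rbrakk> \<Longrightarrow> u g *\<^sub>A u h = u h *\<^sub>A u g"
  "\<lbrakk>g \<in> carrier G; h \<in> carrier G; b \<in> carrier A\<rbrakk> \<Longrightarrow>
    u g *\<^sub>A (u h *\<^sub>A b) = u h *\<^sub>A (u g *\<^sub>A b)"
  by (auto intro: u_central u_comm u_closed)

lemma dom_eq: "g \<in> carrier G \<Longrightarrow> partial_dom A u g = {a \<in> carrier A. u g *\<^sub>A a = a}"
  unfolding partial_dom_def by (rule A.A.Idl_central_idem) (auto intro: u_closed u_idem u_central)

lemma dom_prod_eq: "\<lbrakk>g \<in> carrier G; h \<in> carrier G\<rbrakk> \<Longrightarrow>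
    ideal_prod A (partial_dom A u g) (partial_dom A u h) = {a \<in> carrier A. u g *\<^sub>A u h *\<^sub>A a = a}"
  unfolding partial_dom_def by (rule A.A.ideal_prod_central_idem) (auto intro: u_closed u_idem u_central)

lemma u_one: "u \<one>\<^bsub>G\<^esub> = \<one>\<^bsub>A\<^esub>"
proof -
  have "\<one>\<^bsub>A\<^esub> \<in> partial_dom A u \<one>\<^bsub>G\<^esub>" by (simp add: dom_one)
  thus ?thesis by (simp add: dom_eq u_closed)
qed

text \<open>The partial isomorphism \<open>\<theta>\<^sub>g\<close> is extended to \<open>A\<close> by first projecting to its domain. The total map
is multiplicative and linear but not unital, and it absorbs the idempotents \<open>1\<^sub>g\<^sub>-\<^sub>1\<close> that
accompany \<open>\<theta>\<close> in all formulas.\<close>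

definition \<tau> :: "'g \<Rightarrow> 'a \<Rightarrow> 'a"
  where "\<tau> g a = \<theta> g (u (inv\<^sub>G g) *\<^sub>A a)"

lemma theta_closed: "\<lbrakk>g \<in> carrier G; a \<in> partial_dom A u (inv\<^sub>G g)\<rbrakk> \<Longrightarrow> \<theta> g a \<in> partial_dom A u g"
  using ring_iso_memE(1)[OF theta_iso] by (simp add: partial_dom_ring_def)

lemma theta_mult: "\<lbrakk>g \<in> carrier G; a \<in> partial_dom A u (inv\<^sub>G g); b \<in> partial_dom A u (inv\<^sub>G g)\<rbrakk> \<Longrightarrow>
    \<theta> g (a *\<^sub>A b) = \<theta> g a *\<^sub>A \<theta> g b"
  using ring_iso_memE(2)[OF theta_iso] by (simp add: partial_dom_ring_def)

lemma theta_add: "\<lbrakk>g \<in> carrier G; a \<in> partial_dom A u (inv\<^sub>G g); b \<in> partial_dom A u (inv\<^sub>G g)\<rbrakk> \<Longrightarrow>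
    \<theta> g (a \<oplus>\<^bsub>A\<^esub> b) = \<theta> g a \<oplus>\<^bsub>A\<^esub> \<theta> g b"
  using ring_iso_memE(3)[OF theta_iso] by (simp add: partial_dom_ring_def)

lemma theta_unit: "g \<in> carrier G \<Longrightarrow> \<theta> g (u (inv\<^sub>G g)) = u g"
  using ring_iso_memE(4)[OF theta_iso] by (simp add: partial_dom_ring_def)

lemma u_dom: "\<lbrakk>g \<in> carrier G; a \<in> carrier A\<rbrakk> \<Longrightarrow> u g *\<^sub>A a \<in> partial_dom A u g"
  by (simp add: dom_eq u_closed u_idem')

lemma tau_dom: "\<lbrakk>g \<in> carrier G; a \<in> carrier A\<rbrakk> \<Longrightarrow> \<tau> g a \<in> partial_dom A u g"
  by (simp add: \<tau>_def theta_closed u_dom)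

lemma tau_closed: "\<lbrakk>g \<in> carrier G; a \<in> carrier A\<rbrakk> \<Longrightarrow> \<tau> g a \<in> carrier A"
  and u_tau: "\<lbrakk>g \<in> carrier G; a \<in> carrier A\<rbrakk> \<Longrightarrow> u g *\<^sub>A \<tau> g a = \<tau> g a"
  using tau_dom by (auto simp: dom_eq)

lemma tau_add: "\<lbrakk>g \<in> carrier G; a \<in> carrier A; b \<in> carrier A\<rbrakk> \<Longrightarrow> \<tau> g (a \<oplus>\<^bsub>A\<^esub> b) = \<tau> g a \<oplus>\<^bsub>A\<^esub> \<tau> g b"
  by (simp add: \<tau>_def u_closed A.A.r_distr theta_add u_dom)

lemma tau_mult:
  assumes "g \<in> carrier G" "a \<in> carrier A" "b \<in> carrier A"
  shows "\<tau> g (a *\<^sub>A b) = \<tau> g a *\<^sub>A \<tau> g b"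
proof -
  have "u (inv\<^sub>G g) *\<^sub>A (a *\<^sub>A b) = (u (inv\<^sub>G g) *\<^sub>A a) *\<^sub>A (u (inv\<^sub>G g) *\<^sub>A b)"
    using assms by (simp add: A.A.m_assoc u_closed u_comm[of "inv\<^sub>G g" a b] u_idem')
  thus ?thesis using assms by (simp add: \<tau>_def theta_mult u_dom)
qed

lemma tau_smult: "\<lbrakk>g \<in> carrier G; c \<in> carrier K; a \<in> carrier A\<rbrakk> \<Longrightarrow> \<tau> g (c \<odot>\<^sub>A a) = c \<odot>\<^sub>A \<tau> g a"
  by (simp add: \<tau>_def A.smult_mult_right u_closed theta_smult u_dom)

lemma tau_unit: "g \<in> carrier G \<Longrightarrow> \<tau> g \<one>\<^bsub>A\<^esub> = u g"
  by (simp add: \<tau>_def u_closed theta_unit)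

lemma tau_zero: "g \<in> carrier G \<Longrightarrow> \<tau> g \<zero>\<^bsub>A\<^esub> = \<zero>\<^bsub>A\<^esub>"
  using tau_smult[of g "\<zero>\<^bsub>K\<^esub>" "\<zero>\<^bsub>A\<^esub>"] tau_closed[of g "\<zero>\<^bsub>A\<^esub>"] by simp

lemma tau_one: "a \<in> carrier A \<Longrightarrow> \<tau> \<one>\<^bsub>G\<^esub> a = a"
  by (simp add: \<tau>_def u_one theta_one)

text \<open>\<open>\<theta>\<^sub>g\<close> maps the ideal \<open>D\<^sub>g\<^sub>-\<^sub>1 D\<^sub>h\<close> isomorphically onto \<open>D\<^sub>g D\<^sub>g\<^sub>h\<close>, so it maps the unit of the first to the
unit of the second.\<close>

lemma theta_u_prod:
  assumes g: "g \<in> carrier G" and h: "h \<in> carrier G"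
  shows "\<theta> g (u (inv\<^sub>G g) *\<^sub>A u h) = u g *\<^sub>A u (g *\<^sub>G h)"
proof -
  let ?g = "inv\<^sub>G g" and ?e = "u (inv\<^sub>G g) *\<^sub>A u h" and ?f = "u g *\<^sub>A u (g *\<^sub>G h)"
  have cl: "?e \<in> carrier A" "?f \<in> carrier A" using g h by (auto simp: u_closed)
  have "?e *\<^sub>A ?e = ?e" "?f *\<^sub>A ?f = ?f"
    using g h by (simp_all add: A.A.m_assoc u_closed u_ac u_idem' u_idem)
  hence e: "?e \<in> ideal_prod A (partial_dom A u ?g) (partial_dom A u h)"
    and f: "?f \<in> ideal_prod A (partial_dom A u g) (partial_dom A u (g *\<^sub>G h))"
    using g h cl by (simp_all add: dom_prod_eq)
  have "\<theta> g ?e \<in> ideal_prod A (partial_dom A u g) (partial_dom A u (g *\<^sub>G h))"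
    unfolding theta_dom[OF g h, symmetric] by (rule imageI[OF e])
  hence fe: "?f *\<^sub>A \<theta> g ?e = \<theta> g ?e" "\<theta> g ?e \<in> carrier A" using g h by (simp_all add: dom_prod_eq)
  \<comment> \<open>As the unit of the image is hit by some \<open>x\<close>, and \<open>x = e x\<close> for the unit \<open>e\<close> of the source, it is \<open>\<theta> g e\<close>.\<close>
  obtain x where x: "x \<in> ideal_prod A (partial_dom A u ?g) (partial_dom A u h)" "?f = \<theta> g x"
    using f unfolding theta_dom[OF g h, symmetric] by auto
  have xc: "x \<in> carrier A" "?e *\<^sub>A x = x" using x(1) g h by (simp_all add: dom_prod_eq)
  have "u ?g *\<^sub>A x = u ?g *\<^sub>A (?e *\<^sub>A x)" using xc by simp
  also have "\<dots> = ?e *\<^sub>A x" using g h xc(1) by (simp add: A.A.m_assoc u_closed u_idem')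
  finally have xd: "x \<in> partial_dom A u ?g" using g xc by (simp add: dom_eq)
  have "?f = \<theta> g (?e *\<^sub>A x)" using x(2) xc(2) by simp
  also have "\<dots> = \<theta> g ?e *\<^sub>A ?f" unfolding x(2)
    using g h by (intro theta_mult xd u_dom) (auto simp: u_closed)
  also have "\<dots> = ?f *\<^sub>A \<theta> g ?e"
    using g h fe(2) u_central[of "g *\<^sub>G h" "\<theta> g ?e"]
    by (simp add: A.A.m_assoc u_closed u_comm[of g "\<theta> g ?e"])
  finally show ?thesis using fe by simp
qed

lemma tau_u: "\<lbrakk>g \<in> carrier G; h \<in> carrier G\<rbrakk> \<Longrightarrow> \<tau> g (u h) = u g *\<^sub>A u (g *\<^sub>G h)"
  by (simp add: \<tau>_def theta_u_prod)

text \<open>The composition law of the partial action, whose domain condition turns into the factor \<open>1\<^sub>g\<close>.\<close>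

lemma tau_tau:
  assumes g: "g \<in> carrier G" and h: "h \<in> carrier G" and a: "a \<in> carrier A"
  shows "\<tau> g (\<tau> h a) = u g *\<^sub>A \<tau> (g *\<^sub>G h) a"
proof -
  let ?k = "inv\<^sub>G (g *\<^sub>G h)"
  have k: "?k = inv\<^sub>G h *\<^sub>G inv\<^sub>G g" using g h by (rule G.inv_mult_group)
  have tu: "\<tau> h (u ?k) = u h *\<^sub>A u (inv\<^sub>G g)" using g h by (simp add: tau_u k)
  have "u (inv\<^sub>G g) *\<^sub>A \<tau> h a = u h *\<^sub>A (u (inv\<^sub>G g) *\<^sub>A \<tau> h a)"
    using g h a u_comm[of h "u (inv\<^sub>G g)" "\<tau> h a"] by (simp add: u_closed tau_closed u_tau)
  also have "\<dots> = \<tau> h (u ?k) *\<^sub>A \<tau> h a"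
    using g h a by (simp add: tu A.A.m_assoc u_closed tau_closed)
  also have "\<dots> = \<tau> h (u ?k *\<^sub>A a)" using g h a by (simp add: tau_mult u_closed)
  finally have "\<tau> g (\<tau> h a) = \<theta> g (\<theta> h (u (inv\<^sub>G h) *\<^sub>A (u ?k *\<^sub>A a)))"
    by (simp add: \<tau>_def)
  also have "\<dots> = \<theta> (g *\<^sub>G h) (u (inv\<^sub>G h) *\<^sub>A (u ?k *\<^sub>A a))"
    using g h a by (intro theta_comp) (simp_all add: dom_prod_eq u_closed A.A.m_assoc u_ac u_idem')
  also have "\<dots> = \<tau> (g *\<^sub>G h) (u (inv\<^sub>G h) *\<^sub>A a)"
    using g h a by (simp add: \<tau>_def u_ac u_closed)
  also have "\<dots> = u (g *\<^sub>G h) *\<^sub>A u g *\<^sub>A \<tau> (g *\<^sub>G h) a"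
    using g h a by (simp add: tau_mult u_closed tau_u G.m_assoc)
  also have "\<dots> = u g *\<^sub>A \<tau> (g *\<^sub>G h) a"
    using g h a u_comm[of "g *\<^sub>G h" "u g" "\<tau> (g *\<^sub>G h) a"]
    by (simp add: A.A.m_assoc u_closed tau_closed u_tau)
  finally show ?thesis .
qed

end

context twisted_partial_action
begin

lemma twist_one_left': "g \<in> carrier G \<Longrightarrow> \<sigma> \<one>\<^bsub>G\<^esub> g \<odot>\<^sub>A u g = u g"
  using twist_one_left[of g] by (simp add: twist_elem_def u_one u_closed)

lemma twist_one_right': "g \<in> carrier G \<Longrightarrow> \<sigma> g \<one>\<^bsub>G\<^esub> \<odot>\<^sub>A u g = u g"
  using twist_one_right[of g] by (simp add: twist_elem_def u_idem)

text \<open>The cocycle identity, with the values of \<open>\<tau>\<^sub>g\<close> on the idempotents inserted. The scalars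
themselves need only agree when the product of the three idempotents is nonzero.\<close>

lemma twist_cocycle':
  assumes "g \<in> carrier G" "h \<in> carrier G" "t \<in> carrier G"
  shows "(\<sigma> h t *\<^sub>K \<sigma> g (h *\<^sub>G t)) \<odot>\<^sub>A (u g *\<^sub>A (u (g *\<^sub>G h) *\<^sub>A u (g *\<^sub>G (h *\<^sub>G t)))) =
    (\<sigma> g h *\<^sub>K \<sigma> (g *\<^sub>G h) t) \<odot>\<^sub>A (u g *\<^sub>A (u (g *\<^sub>G h) *\<^sub>A u (g *\<^sub>G (h *\<^sub>G t))))"
proof -
  let ?v = "u g *\<^sub>A (u (g *\<^sub>G h) *\<^sub>A u (g *\<^sub>G (h *\<^sub>G t)))"
  note [simp] = u_closed twist_closed A.A.m_assoc u_ac u_idem u_idem' G.m_assoc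
    A.smult_mult_left A.smult_mult_right
  have "\<theta> g (u (inv\<^sub>G g) *\<^sub>A twist_elem G A u \<sigma> h t) = \<tau> g (twist_elem G A u \<sigma> h t)"
    by (simp only: \<tau>_def)
  also have "\<dots> = \<sigma> h t \<odot>\<^sub>A (\<tau> g (u h) *\<^sub>A \<tau> g (u (h *\<^sub>G t)))"
    using assms by (simp add: twist_elem_def tau_smult tau_mult)
  finally have 1: "\<theta> g (u (inv\<^sub>G g) *\<^sub>A twist_elem G A u \<sigma> h t) = \<sigma> h t \<odot>\<^sub>A ?v"
    using assms by (simp add: tau_u)
  have "\<theta> g (u (inv\<^sub>G g) *\<^sub>A twist_elem G A u \<sigma> h t) *\<^sub>A twist_elem G A u \<sigma> g (h *\<^sub>G t) =
      (\<sigma> h t *\<^sub>K \<sigma> g (h *\<^sub>G t)) \<odot>\<^sub>A ?v"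
    unfolding 1 using assms by (simp add: twist_elem_def K.m_comm flip: A.smult_assoc1)
  moreover have "twist_elem G A u \<sigma> g h *\<^sub>A twist_elem G A u \<sigma> (g *\<^sub>G h) t =
      (\<sigma> g h *\<^sub>K \<sigma> (g *\<^sub>G h) t) \<odot>\<^sub>A ?v"
    using assms by (simp add: twist_elem_def K.m_comm flip: A.smult_assoc1)
  ultimately show ?thesis using twist_cocycle[OF assms] by simp
qed

lemma twist_cocycle_scalar:
  assumes "g \<in> carrier G" "h \<in> carrier G" "t \<in> carrier G"
    "u g *\<^sub>A (u (g *\<^sub>G h) *\<^sub>A u (g *\<^sub>G (h *\<^sub>G t))) \<noteq> \<zero>\<^bsub>A\<^esub>"
  shows "\<sigma> h t *\<^sub>K \<sigma> g (h *\<^sub>G t) = \<sigma> g h *\<^sub>K \<sigma> (g *\<^sub>G h) t"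
  by (rule A.smult_cancel[OF field_K _ _ _ assms(4) twist_cocycle'[OF assms(1-3)]])
    (use assms in \<open>auto simp: twist_closed u_closed\<close>)

lemma u_zero_inv:
  assumes "g \<in> carrier G" "u g = \<zero>\<^bsub>A\<^esub>"
  shows "u (inv\<^sub>G g) = \<zero>\<^bsub>A\<^esub>"
  using tau_u[of "inv\<^sub>G g" g] assms by (simp add: tau_zero u_one u_closed)

lemma twist_inv_zero_iff: "g \<in> carrier G \<Longrightarrow> \<sigma> g (inv\<^sub>G g) = \<zero>\<^bsub>K\<^esub> \<longleftrightarrow> u g = \<zero>\<^bsub>A\<^esub>"
  by (simp add: twist_zero_iff u_one u_closed)

text \<open>The cocycle identity at \<open>(g, g\<^sup>-\<^sup>1, g)\<close>.\<close>

lemma twist_inv_comm: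
  assumes g: "g \<in> carrier G"
  shows "\<sigma> g (inv\<^sub>G g) = \<sigma> (inv\<^sub>G g) g"
proof (cases "u g = \<zero>\<^bsub>A\<^esub>")
  case True
  thus ?thesis using g u_zero_inv[OF g True] twist_inv_zero_iff[of g] twist_inv_zero_iff[of "inv\<^sub>G g"] by simp
next
  case False
  have 1: "\<sigma> g \<one>\<^bsub>G\<^esub> = \<one>\<^bsub>K\<^esub>" "\<sigma> \<one>\<^bsub>G\<^esub> g = \<one>\<^bsub>K\<^esub>"
    using g False twist_one_left'[OF g] twist_one_right'[OF g]
    by (auto intro!: A.smult_cancel[OF field_K _ _ _ False] simp: twist_closed u_closed)
  show ?thesis
    using twist_cocycle_scalar[of g "inv\<^sub>G g" g] g False by (simp add: 1 u_one u_closed u_idem twist_closed)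
qed

text \<open>The products \<open>1\<^sub>g 1\<^sub>g\<^sub>h\<close> that decide about zeros of the twist are exchanged by the isomorphisms
\<open>\<theta>\<close>, so vanishing at \<open>(g, h)\<close> passes on to \<open>(g\<^sup>-\<^sup>1, g h)\<close>, \<open>(g h, h\<^sup>-\<^sup>1)\<close> and
\<open>(h\<^sup>-\<^sup>1, g\<^sup>-\<^sup>1)\<close>.\<close>

lemma twist_zero_inv:
  assumes g: "g \<in> carrier G" and h: "h \<in> carrier G" and z: "\<sigma> g h = \<zero>\<^bsub>K\<^esub>"
  shows "\<sigma> (inv\<^sub>G g) (g *\<^sub>G h) = \<zero>\<^bsub>K\<^esub>" "\<sigma> (g *\<^sub>G h) (inv\<^sub>G h) = \<zero>\<^bsub>K\<^esub>"
    "\<sigma> (inv\<^sub>G h) (inv\<^sub>G g) = \<zero>\<^bsub>K\<^esub>"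
proof -
  note [simp] = u_closed A.A.m_assoc u_ac u_idem' u_idem G.m_assoc u_one
  have z': "u g *\<^sub>A u (g *\<^sub>G h) = \<zero>\<^bsub>A\<^esub>" using twist_zero_iff[OF g h] z by simp
  have "\<tau> (inv\<^sub>G g) (u g *\<^sub>A u (g *\<^sub>G h)) = u (inv\<^sub>G g) *\<^sub>A u h"
    using g h by (simp add: tau_mult tau_u)
  thus "\<sigma> (inv\<^sub>G g) (g *\<^sub>G h) = \<zero>\<^bsub>K\<^esub>" using g h z' by (simp add: twist_zero_iff tau_zero)
  show "\<sigma> (g *\<^sub>G h) (inv\<^sub>G h) = \<zero>\<^bsub>K\<^esub>"
    using g h z' by (simp add: twist_zero_iff)
  have "\<tau> (inv\<^sub>G h *\<^sub>G inv\<^sub>G g) (u (g *\<^sub>G h) *\<^sub>A u g) =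
      u (inv\<^sub>G h *\<^sub>G inv\<^sub>G g) *\<^sub>A u (inv\<^sub>G h)"
    using g h by (simp add: tau_mult tau_u)
  thus "\<sigma> (inv\<^sub>G h) (inv\<^sub>G g) = \<zero>\<^bsub>K\<^esub>"
    using g h z' by (simp add: twist_zero_iff tau_zero)
qed

section \<open>The crossed product\<close>

abbreviation L where "L \<equiv> crossed_product G A u \<theta> \<sigma>"
abbreviation mult_L (infixl \<open>*\<^sub>L\<close> 70) where "f *\<^sub>L h \<equiv> f \<otimes>\<^bsub>L\<^esub> h"
abbreviation smult_L (infixl \<open>\<odot>\<^sub>L\<close> 70) where "c \<odot>\<^sub>L f \<equiv> c \<odot>\<^bsub>L\<^esub> f"
abbreviation mon where "mon \<equiv> hom_elem A"

lemma L_simps: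
  "carrier L = {f. (\<forall>g\<in>carrier G. f g \<in> partial_dom A u g) \<and> (\<forall>g. g \<notin> carrier G \<longrightarrow> f g = \<zero>\<^bsub>A\<^esub>) \<and>
     finite {g. f g \<noteq> \<zero>\<^bsub>A\<^esub>}}"
  "zero L = (\<lambda>g. \<zero>\<^bsub>A\<^esub>)" "add L = (\<lambda>f f' g. f g \<oplus>\<^bsub>A\<^esub> f' g)" "smult L = (\<lambda>c f g. c \<odot>\<^sub>A f g)"
  "one L = mon \<one>\<^bsub>A\<^esub> \<one>\<^bsub>G\<^esub>"
  by (simp_all add: crossed_product_def)

lemma L_carrierD:
  assumes "f \<in> carrier L"
  shows "f g \<in> carrier A" "g \<in> carrier G \<Longrightarrow> u g *\<^sub>A f g = f g" "g \<notin> carrier G \<Longrightarrow> f g = \<zero>\<^bsub>A\<^esub>"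
    "finite {g. f g \<noteq> \<zero>\<^bsub>A\<^esub>}" "{g. f g \<noteq> \<zero>\<^bsub>A\<^esub>} \<subseteq> carrier G"
  using assms by (cases "g \<in> carrier G"; auto simp: L_simps dom_eq)+

lemma L_carrierI:
  assumes "\<And>g. f g \<in> carrier A" "\<And>g. g \<in> carrier G \<Longrightarrow> u g *\<^sub>A f g = f g"
    "\<And>g. g \<notin> carrier G \<Longrightarrow> f g = \<zero>\<^bsub>A\<^esub>" "finite F" "\<And>g. g \<notin> F \<Longrightarrow> f g = \<zero>\<^bsub>A\<^esub>"
  shows "f \<in> carrier L"
  using assms finite_subset[of "{g. f g \<noteq> \<zero>\<^bsub>A\<^esub>}" F] by (auto simp: L_simps dom_eq)

lemma module_L: "module K L"
proof (rule moduleI)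
  show "cring K" by (rule K.is_cring)
  show "abelian_group L"
  proof (rule abelian_groupI)
    fix f f' assume f: "f \<in> carrier L" "f' \<in> carrier L"
    show "f \<oplus>\<^bsub>L\<^esub> f' \<in> carrier L"
      by (rule L_carrierI[of _ "{g. f g \<noteq> \<zero>\<^bsub>A\<^esub>} \<union> {g. f' g \<noteq> \<zero>\<^bsub>A\<^esub>}"])
        (use L_carrierD[OF f(1)] L_carrierD[OF f(2)] in \<open>auto simp: L_simps(2-) A.A.r_distr u_closed\<close>)
    have "(\<lambda>g. \<ominus>\<^bsub>A\<^esub> f g) \<in> carrier L"
      by (rule L_carrierI[of _ "{g. f g \<noteq> \<zero>\<^bsub>A\<^esub>}"])
        (use L_carrierD[OF f(1)] in \<open>auto simp: A.A.r_minus u_closed\<close>)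
    thus "\<exists>y\<in>carrier L. y \<oplus>\<^bsub>L\<^esub> f = \<zero>\<^bsub>L\<^esub>"
      by (rule bexI[rotated]) (use L_carrierD(1)[OF f(1)] in \<open>auto simp: L_simps(2-) A.M.l_neg\<close>)
  next
    show "\<zero>\<^bsub>L\<^esub> \<in> carrier L" by (rule L_carrierI[of _ "{}"]) (auto simp: L_simps(2-) u_closed)
  qed (auto simp: L_simps(2-) fun_eq_iff A.M.a_ac L_carrierD(1))
next
  fix c f assume c: "c \<in> carrier K" and f: "f \<in> carrier L"
  show "c \<odot>\<^sub>L f \<in> carrier L"
    by (rule L_carrierI[of _ "{g. f g \<noteq> \<zero>\<^bsub>A\<^esub>}"])
      (use c L_carrierD[OF f] in \<open>auto simp: L_simps(2-) A.smult_mult_right u_closed\<close>)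
qed (auto simp: L_simps(2-) fun_eq_iff L_carrierD(1) A.smult_l_distr A.smult_r_distr A.smult_assoc1)

sublocale L: module K L by (rule module_L)

lemma mon_closed: "\<lbrakk>g \<in> carrier G; a \<in> carrier A; u g *\<^sub>A a = a\<rbrakk> \<Longrightarrow> mon a g \<in> carrier L"
  by (rule L_carrierI[of _ "{g}"]) (auto simp: hom_elem_def u_closed)

lemma mon_add: "\<lbrakk>a \<in> carrier A; b \<in> carrier A\<rbrakk> \<Longrightarrow> mon (a \<oplus>\<^bsub>A\<^esub> b) g = mon a g \<oplus>\<^bsub>L\<^esub> mon b g"
  by (auto simp: L_simps(2-) hom_elem_def)

lemma mon_smult: "c \<in> carrier K \<Longrightarrow> mon (c \<odot>\<^sub>A a) g = c \<odot>\<^sub>L mon a g"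
  by (auto simp: L_simps(2-) hom_elem_def)

lemma mon_zero: "mon \<zero>\<^bsub>A\<^esub> g = \<zero>\<^bsub>L\<^esub>"
  by (auto simp: L_simps(2-) hom_elem_def)

lemma L_induct [consumes 1, case_names mon add]:
  assumes "f \<in> carrier L"
    and mon: "\<And>a g. \<lbrakk>g \<in> carrier G; a \<in> carrier A; u g *\<^sub>A a = a\<rbrakk> \<Longrightarrow> \<Phi> (mon a g)"
    and add: "\<And>f g. \<lbrakk>f \<in> carrier L; g \<in> carrier L; \<Phi> f; \<Phi> g\<rbrakk> \<Longrightarrow> \<Phi> (f \<oplus>\<^bsub>L\<^esub> g)"
  shows "\<Phi> f"
proof -
  have "finite F \<Longrightarrow> F \<subseteq> carrier G \<Longrightarrow> f \<in> carrier L \<Longrightarrow> {x. f x \<noteq> \<zero>\<^bsub>A\<^esub>} \<subseteq> F \<Longrightarrow> \<Phi> f" for F f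
  proof (induction F arbitrary: f rule: finite_induct)
    case empty
    hence "f = mon \<zero>\<^bsub>A\<^esub> \<one>\<^bsub>G\<^esub>" by (auto simp: hom_elem_def)
    thus ?case using mon by (simp add: u_closed)
  next
    case (insert a F)
    note f = L_carrierD[OF insert.prems(2)]
    define h where "h = (\<lambda>x. if x = a then \<zero>\<^bsub>A\<^esub> else f x)"
    have h: "h \<in> carrier L"
      by (rule L_carrierI[of _ F]) (use f insert.prems insert.hyps in \<open>auto simp: h_def u_closed\<close>)
    have "\<Phi> h" by (rule insert.IH[OF _ h]) (use insert.prems in \<open>auto simp: h_def\<close>)
    moreover have "f = mon (f a) a \<oplus>\<^bsub>L\<^esub> h"
      using f(1) by (auto simp: h_def hom_elem_def fun_eq_iff L_simps(2-))
    moreover have "a \<in> carrier G" using insert.prems by auto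
    ultimately show ?case using add[OF mon_closed h, of a "f a"] mon[of a "f a"] f(1,2) by metis
  qed
  thus ?thesis using L_carrierD(4,5)[OF assms(1)] assms(1) by blast
qed

lemma L_mult_eq:
  assumes f: "f \<in> carrier L" and h: "h \<in> carrier L" and F: "finite F" "{g. f g \<noteq> \<zero>\<^bsub>A\<^esub>} \<subseteq> F" "F \<subseteq> carrier G"
    and t: "t \<in> carrier G"
  shows "(f *\<^sub>L h) t = (\<Oplus>\<^bsub>A\<^esub>g\<in>F. \<sigma> g (inv\<^sub>G g *\<^sub>G t) \<odot>\<^sub>A (f g *\<^sub>A \<tau> g (h (inv\<^sub>G g *\<^sub>G t))))"
proof -
  have "(f *\<^sub>L h) t = (\<Oplus>\<^bsub>A\<^esub>g\<in>{g. f g \<noteq> \<zero>\<^bsub>A\<^esub>}.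
      \<sigma> g (inv\<^sub>G g *\<^sub>G t) \<odot>\<^sub>A (f g *\<^sub>A \<tau> g (h (inv\<^sub>G g *\<^sub>G t))))"
    using t by (simp add: crossed_product_def \<tau>_def)
  also have "\<dots> = (\<Oplus>\<^bsub>A\<^esub>g\<in>F. \<sigma> g (inv\<^sub>G g *\<^sub>G t) \<odot>\<^sub>A (f g *\<^sub>A \<tau> g (h (inv\<^sub>G g *\<^sub>G t))))"
    using F t by (intro A.M.add.finprod_mono_neutral_cong_left)
      (auto simp: twist_closed tau_closed L_carrierD(1)[OF f] L_carrierD(1)[OF h] subset_iff)
  finally show ?thesis .
qed

lemma L_mult_outside: "t \<notin> carrier G \<Longrightarrow> (f *\<^sub>L h) t = \<zero>\<^bsub>A\<^esub>"
  by (simp add: crossed_product_def)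

lemma mon_mult:
  assumes g: "g \<in> carrier G" and a: "a \<in> carrier A" "u g *\<^sub>A a = a"
    and h: "h \<in> carrier G" and b: "b \<in> carrier A" "u h *\<^sub>A b = b"
  shows "mon a g *\<^sub>L mon b h = mon (\<sigma> g h \<odot>\<^sub>A (a *\<^sub>A \<tau> g b)) (g *\<^sub>G h)"
proof
  fix t
  show "(mon a g *\<^sub>L mon b h) t = mon (\<sigma> g h \<odot>\<^sub>A (a *\<^sub>A \<tau> g b)) (g *\<^sub>G h) t"
  proof (cases "t \<in> carrier G")
    case False
    thus ?thesis using g h by (auto simp: L_mult_outside hom_elem_def)
  next
    case t: True
    have "(mon a g *\<^sub>L mon b h) t = (\<Oplus>\<^bsub>A\<^esub>k\<in>{g}. \<sigma> k (inv\<^sub>G k *\<^sub>G t) \<odot>\<^sub>A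
        (mon a g k *\<^sub>A \<tau> k (mon b h (inv\<^sub>G k *\<^sub>G t))))"
      by (rule L_mult_eq[OF mon_closed mon_closed]) (use assms t in \<open>auto simp: hom_elem_def\<close>)
    also have "\<dots> = \<sigma> g (inv\<^sub>G g *\<^sub>G t) \<odot>\<^sub>A (a *\<^sub>A \<tau> g (mon b h (inv\<^sub>G g *\<^sub>G t)))"
      using g a b t by (simp add: twist_closed tau_closed hom_elem_def)
    also have "\<dots> = mon (\<sigma> g h \<odot>\<^sub>A (a *\<^sub>A \<tau> g b)) (g *\<^sub>G h) t"
    proof (cases "t = g *\<^sub>G h")
      case True thus ?thesis using g h by (simp add: hom_elem_def)
    next
      case False
      hence "inv\<^sub>G g *\<^sub>G t \<noteq> h" using g t inv_cancel(2)[OF g t] by auto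
      thus ?thesis using False g a t by (simp add: hom_elem_def tau_zero twist_closed)
    qed
    finally show ?thesis .
  qed
qed

lemma L_distr:
  assumes f: "f \<in> carrier L" and f': "f' \<in> carrier L" and h: "h \<in> carrier L"
  shows "(f \<oplus>\<^bsub>L\<^esub> f') *\<^sub>L h = f *\<^sub>L h \<oplus>\<^bsub>L\<^esub> f' *\<^sub>L h"
    and "h *\<^sub>L (f \<oplus>\<^bsub>L\<^esub> f') = h *\<^sub>L f \<oplus>\<^bsub>L\<^esub> h *\<^sub>L f'"
proof -
  note [simp] = L_carrierD(1)[OF f] L_carrierD(1)[OF f'] L_carrierD(1)[OF h] tau_closed twist_closed
  let ?F = "{g. f g \<noteq> \<zero>\<^bsub>A\<^esub>} \<union> {g. f' g \<noteq> \<zero>\<^bsub>A\<^esub>}"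
  have F: "finite ?F" "?F \<subseteq> carrier G"
    using L_carrierD(4,5)[OF f] L_carrierD(4,5)[OF f'] by auto
  have H: "finite {g. h g \<noteq> \<zero>\<^bsub>A\<^esub>}" "{g. h g \<noteq> \<zero>\<^bsub>A\<^esub>} \<subseteq> carrier G"
    using L_carrierD(4,5)[OF h] by auto
  have FG: "\<And>g. g \<in> ?F \<Longrightarrow> g \<in> carrier G" and HG: "\<And>g. g \<in> {g. h g \<noteq> \<zero>\<^bsub>A\<^esub>} \<Longrightarrow> g \<in> carrier G"
    using F(2) H(2) by blast+
  have s: "{g. (f \<oplus>\<^bsub>L\<^esub> f') g \<noteq> \<zero>\<^bsub>A\<^esub>} \<subseteq> ?F" by (auto simp: L_simps(2-))
  have "((f \<oplus>\<^bsub>L\<^esub> f') *\<^sub>L h) t = (f *\<^sub>L h \<oplus>\<^bsub>L\<^esub> f' *\<^sub>L h) t" for t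
  proof (cases "t \<in> carrier G")
    case t: True
    let ?T = "\<lambda>f g. \<sigma> g (inv\<^sub>G g *\<^sub>G t) \<odot>\<^sub>A (f g *\<^sub>A \<tau> g (h (inv\<^sub>G g *\<^sub>G t)))"
    have "((f \<oplus>\<^bsub>L\<^esub> f') *\<^sub>L h) t = (\<Oplus>\<^bsub>A\<^esub>g\<in>?F. ?T (f \<oplus>\<^bsub>L\<^esub> f') g)"
      by (rule L_mult_eq[OF L.M.a_closed[OF f f'] h F(1) s F(2) t])
    also have "\<dots> = (\<Oplus>\<^bsub>A\<^esub>g\<in>?F. ?T f g \<oplus>\<^bsub>A\<^esub> ?T f' g)"
      using FG t by (intro A.M.finsum_cong') (auto simp: L_simps(2-) A.A.l_distr A.smult_r_distr)
    also have "\<dots> = (\<Oplus>\<^bsub>A\<^esub>g\<in>?F. ?T f g) \<oplus>\<^bsub>A\<^esub> (\<Oplus>\<^bsub>A\<^esub>g\<in>?F. ?T f' g)"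
      using FG t by (intro A.M.finsum_addf) auto
    also have "\<dots> = (f *\<^sub>L h) t \<oplus>\<^bsub>A\<^esub> (f' *\<^sub>L h) t"
      using L_mult_eq[OF f h F(1) _ F(2) t] L_mult_eq[OF f' h F(1) _ F(2) t] by simp
    finally show ?thesis by (simp add: L_simps(2-))
  qed (simp add: L_mult_outside L_simps(2-))
  thus "(f \<oplus>\<^bsub>L\<^esub> f') *\<^sub>L h = f *\<^sub>L h \<oplus>\<^bsub>L\<^esub> f' *\<^sub>L h" by blast
  have "(h *\<^sub>L (f \<oplus>\<^bsub>L\<^esub> f')) t = (h *\<^sub>L f \<oplus>\<^bsub>L\<^esub> h *\<^sub>L f') t" for t
  proof (cases "t \<in> carrier G")
    case t: True
    let ?H = "{g. h g \<noteq> \<zero>\<^bsub>A\<^esub>}"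
    let ?T = "\<lambda>f g. \<sigma> g (inv\<^sub>G g *\<^sub>G t) \<odot>\<^sub>A (h g *\<^sub>A \<tau> g (f (inv\<^sub>G g *\<^sub>G t)))"
    have "(h *\<^sub>L (f \<oplus>\<^bsub>L\<^esub> f')) t = (\<Oplus>\<^bsub>A\<^esub>g\<in>?H. ?T (f \<oplus>\<^bsub>L\<^esub> f') g)"
      by (rule L_mult_eq[OF h L.M.a_closed[OF f f'] H(1) _ H(2) t]) simp
    also have "\<dots> = (\<Oplus>\<^bsub>A\<^esub>g\<in>?H. ?T f g \<oplus>\<^bsub>A\<^esub> ?T f' g)"
      using HG t by (intro A.M.finsum_cong') (auto simp: L_simps(2-) tau_add A.A.r_distr A.smult_r_distr)
    also have "\<dots> = (\<Oplus>\<^bsub>A\<^esub>g\<in>?H. ?T f g) \<oplus>\<^bsub>A\<^esub> (\<Oplus>\<^bsub>A\<^esub>g\<in>?H. ?T f' g)"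
      using HG t by (intro A.M.finsum_addf) auto
    also have "\<dots> = (h *\<^sub>L f) t \<oplus>\<^bsub>A\<^esub> (h *\<^sub>L f') t"
      using L_mult_eq[OF h f H(1) _ H(2) t] L_mult_eq[OF h f' H(1) _ H(2) t] by simp
    finally show ?thesis by (simp add: L_simps(2-))
  qed (simp add: L_mult_outside L_simps(2-))
  thus "h *\<^sub>L (f \<oplus>\<^bsub>L\<^esub> f') = h *\<^sub>L f \<oplus>\<^bsub>L\<^esub> h *\<^sub>L f'" by blast
qed

lemma mon_mult_dom:
  assumes g: "g \<in> carrier G" and a: "a \<in> carrier A" "u g *\<^sub>A a = a"
    and h: "h \<in> carrier G" and b: "b \<in> carrier A" "u h *\<^sub>A b = b"
  shows "u (g *\<^sub>G h) *\<^sub>A (\<sigma> g h \<odot>\<^sub>A (a *\<^sub>A \<tau> g b)) = \<sigma> g h \<odot>\<^sub>A (a *\<^sub>A \<tau> g b)"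
proof -
  have "\<tau> g b = u g *\<^sub>A (u (g *\<^sub>G h) *\<^sub>A \<tau> g b)"
    using tau_mult[OF g u_closed[OF h] b(1)] assms by (simp add: tau_u A.A.m_assoc u_closed tau_closed)
  hence "u (g *\<^sub>G h) *\<^sub>A \<tau> g b = \<tau> g b"
    using g h b u_idem'[of "g *\<^sub>G h" "u g *\<^sub>A \<tau> g b"] by (simp add: u_ac u_closed tau_closed)
  thus ?thesis using g h a b u_comm[of "g *\<^sub>G h" a "\<tau> g b"]
    by (simp add: A.smult_mult_right u_closed tau_closed twist_closed)
qed

lemma mon_mult_closed:
  assumes "g \<in> carrier G" "a \<in> carrier A" "u g *\<^sub>A a = a" "h \<in> carrier G" "b \<in> carrier A" "u h *\<^sub>A b = b"
  shows "mon a g *\<^sub>L mon b h \<in> carrier L"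
  unfolding mon_mult[OF assms]
  by (rule mon_closed) (use assms mon_mult_dom[OF assms] in \<open>simp_all add: twist_closed tau_closed\<close>)

lemma L_mult_closed: "\<lbrakk>f \<in> carrier L; h \<in> carrier L\<rbrakk> \<Longrightarrow> f *\<^sub>L h \<in> carrier L"
proof (induction f rule: L_induct)
  case (mon a g)
  from mon(4) show ?case
    by (induction h rule: L_induct) (use mon in \<open>simp_all add: mon_mult_closed L_distr mon_closed\<close>)
qed (simp add: L_distr)

text \<open>Both ways of multiplying three homogeneous elements give the same element of \<open>A\<close>, and this element
is fixed by \<open>1\<^sub>g 1\<^sub>g\<^sub>h 1\<^sub>g\<^sub>h\<^sub>t\<close>. The idempotent is made explicit so that the cocycle identity, which
only holds after multiplication with it, can be applied to the scalars.\<close>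

lemma tau_assoc:
  assumes g: "g \<in> carrier G" and a: "a \<in> carrier A" "u g *\<^sub>A a = a"
    and h: "h \<in> carrier G" and b: "b \<in> carrier A" "u h *\<^sub>A b = b"
    and t: "t \<in> carrier G" and c: "c \<in> carrier A" "u t *\<^sub>A c = c"
  shows "a *\<^sub>A \<tau> g (b *\<^sub>A \<tau> h c) =
      (u g *\<^sub>A (u (g *\<^sub>G h) *\<^sub>A u (g *\<^sub>G (h *\<^sub>G t)))) *\<^sub>A (a *\<^sub>A (\<tau> g b *\<^sub>A \<tau> (g *\<^sub>G h) c))"
    and "(a *\<^sub>A \<tau> g b) *\<^sub>A \<tau> (g *\<^sub>G h) c =
      (u g *\<^sub>A (u (g *\<^sub>G h) *\<^sub>A u (g *\<^sub>G (h *\<^sub>G t)))) *\<^sub>A (a *\<^sub>A (\<tau> g b *\<^sub>A \<tau> (g *\<^sub>G h) c))"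
proof -
  let ?c = "\<tau> (g *\<^sub>G h) c" and ?k = "g *\<^sub>G h" and ?l = "g *\<^sub>G (h *\<^sub>G t)"
  note [simp] = u_closed tau_closed
  have cl: "?c \<in> carrier A" "\<tau> g b \<in> carrier A" "a *\<^sub>A \<tau> g b \<in> carrier A" using assms by auto
  have "?c = u ?k *\<^sub>A (u ?l *\<^sub>A ?c)"
    using tau_mult[of ?k "u t" c] g h t c by (simp add: tau_u A.A.m_assoc G.m_assoc)
  moreover have "u ?k *\<^sub>A ?c = ?c" using g h c by (simp add: u_tau)
  ultimately have c1: "?c = u ?k *\<^sub>A (u ?l *\<^sub>A ?c)" by simp
  have "a *\<^sub>A (\<tau> g b *\<^sub>A ?c) = a *\<^sub>A (\<tau> g b *\<^sub>A (u ?k *\<^sub>A (u ?l *\<^sub>A ?c)))" using c1 by simp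
  also have "\<dots> = u ?k *\<^sub>A (u ?l *\<^sub>A (a *\<^sub>A (\<tau> g b *\<^sub>A ?c)))"
    using g h t a(1) cl u_comm[of ?k "\<tau> g b" "u ?l *\<^sub>A ?c"] u_comm[of ?l "\<tau> g b" ?c]
      u_comm[of ?k a "u ?l *\<^sub>A (\<tau> g b *\<^sub>A ?c)"] u_comm[of ?l a "\<tau> g b *\<^sub>A ?c"] by simp
  finally have 1: "a *\<^sub>A (\<tau> g b *\<^sub>A ?c) = u ?k *\<^sub>A (u ?l *\<^sub>A (a *\<^sub>A (\<tau> g b *\<^sub>A ?c)))" .
  have 2: "u g *\<^sub>A (a *\<^sub>A (\<tau> g b *\<^sub>A ?c)) = a *\<^sub>A (\<tau> g b *\<^sub>A ?c)"
    using g a cl A.A.m_assoc[of "u g" a "\<tau> g b *\<^sub>A ?c"] by simp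
  have "a *\<^sub>A (\<tau> g b *\<^sub>A ?c) = u g *\<^sub>A (u ?k *\<^sub>A (u ?l *\<^sub>A (a *\<^sub>A (\<tau> g b *\<^sub>A ?c))))"
    using 1 2 by simp
  also have "\<dots> = (u g *\<^sub>A (u ?k *\<^sub>A u ?l)) *\<^sub>A (a *\<^sub>A (\<tau> g b *\<^sub>A ?c))"
    using g h t a cl by (simp add: A.A.m_assoc)
  finally have 3: "a *\<^sub>A (\<tau> g b *\<^sub>A ?c) = (u g *\<^sub>A (u ?k *\<^sub>A u ?l)) *\<^sub>A (a *\<^sub>A (\<tau> g b *\<^sub>A ?c))" .
  show "(a *\<^sub>A \<tau> g b) *\<^sub>A ?c = (u g *\<^sub>A (u ?k *\<^sub>A u ?l)) *\<^sub>A (a *\<^sub>A (\<tau> g b *\<^sub>A ?c))"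
    using 3 a cl by (simp add: A.A.m_assoc)
  have "\<tau> g b *\<^sub>A (u g *\<^sub>A ?c) = \<tau> g b *\<^sub>A ?c"
    using g b cl u_comm[of g "\<tau> g b" ?c] A.A.m_assoc[of "u g" "\<tau> g b" ?c] by (simp add: u_tau)
  hence "a *\<^sub>A \<tau> g (b *\<^sub>A \<tau> h c) = a *\<^sub>A (\<tau> g b *\<^sub>A ?c)"
    using assms by (simp add: tau_mult tau_tau)
  thus "a *\<^sub>A \<tau> g (b *\<^sub>A \<tau> h c) = (u g *\<^sub>A (u ?k *\<^sub>A u ?l)) *\<^sub>A (a *\<^sub>A (\<tau> g b *\<^sub>A ?c))"
    using 3 by simp
qed

text \<open>The scalars of the two bracketings differ by the cocycle identity.\<close>

lemma mon_assoc:
  assumes g: "g \<in> carrier G" and a: "a \<in> carrier A" "u g *\<^sub>A a = a"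
    and h: "h \<in> carrier G" and b: "b \<in> carrier A" "u h *\<^sub>A b = b"
    and t: "t \<in> carrier G" and c: "c \<in> carrier A" "u t *\<^sub>A c = c"
  shows "(mon a g *\<^sub>L mon b h) *\<^sub>L mon c t = mon a g *\<^sub>L (mon b h *\<^sub>L mon c t)"
proof -
  let ?v = "u g *\<^sub>A (u (g *\<^sub>G h) *\<^sub>A u (g *\<^sub>G (h *\<^sub>G t)))"
  let ?x = "a *\<^sub>A (\<tau> g b *\<^sub>A \<tau> (g *\<^sub>G h) c)"
  note [simp] = u_closed tau_closed twist_closed A.smult_mult_left A.smult_mult_right
  note ab = mon_mult[OF g a h b] mon_mult_dom[OF g a h b]
  note bc = mon_mult[OF h b t c] mon_mult_dom[OF h b t c]
  have "(mon a g *\<^sub>L mon b h) *\<^sub>L mon c t =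
      mon (\<sigma> (g *\<^sub>G h) t \<odot>\<^sub>A ((\<sigma> g h \<odot>\<^sub>A (a *\<^sub>A \<tau> g b)) *\<^sub>A \<tau> (g *\<^sub>G h) c)) (g *\<^sub>G h *\<^sub>G t)"
    unfolding ab(1) by (rule mon_mult) (use assms ab(2) in auto)
  also have "\<dots> = mon ((\<sigma> g h *\<^sub>K \<sigma> (g *\<^sub>G h) t) \<odot>\<^sub>A ((a *\<^sub>A \<tau> g b) *\<^sub>A \<tau> (g *\<^sub>G h) c)) (g *\<^sub>G (h *\<^sub>G t))"
    using assms by (simp add: G.m_assoc K.m_comm flip: A.smult_assoc1)
  also have "\<dots> = mon (((\<sigma> g h *\<^sub>K \<sigma> (g *\<^sub>G h) t) \<odot>\<^sub>A ?v) *\<^sub>A ?x) (g *\<^sub>G (h *\<^sub>G t))"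
    unfolding tau_assoc(2)[OF assms] using assms by simp
  also have "\<dots> = mon (((\<sigma> h t *\<^sub>K \<sigma> g (h *\<^sub>G t)) \<odot>\<^sub>A ?v) *\<^sub>A ?x) (g *\<^sub>G (h *\<^sub>G t))"
    unfolding twist_cocycle'[OF g h t] ..
  also have "\<dots> = mon ((\<sigma> h t *\<^sub>K \<sigma> g (h *\<^sub>G t)) \<odot>\<^sub>A (a *\<^sub>A \<tau> g (b *\<^sub>A \<tau> h c))) (g *\<^sub>G (h *\<^sub>G t))"
    unfolding tau_assoc(1)[OF assms] using assms by simp
  also have "\<dots> = mon (\<sigma> g (h *\<^sub>G t) \<odot>\<^sub>A (a *\<^sub>A \<tau> g (\<sigma> h t \<odot>\<^sub>A (b *\<^sub>A \<tau> h c)))) (g *\<^sub>G (h *\<^sub>G t))"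
    using assms by (simp add: tau_smult K.m_comm flip: A.smult_assoc1)
  also have "\<dots> = mon a g *\<^sub>L (mon b h *\<^sub>L mon c t)"
    unfolding bc(1) by (rule mon_mult[symmetric]) (use assms bc(2) in auto)
  finally show ?thesis .
qed

lemma twist_absorb:
  assumes "g \<in> carrier G" "a \<in> carrier A" "u g *\<^sub>A a = a"
  shows "\<sigma> \<one>\<^bsub>G\<^esub> g \<odot>\<^sub>A a = a" "\<sigma> g \<one>\<^bsub>G\<^esub> \<odot>\<^sub>A a = a"
proof -
  have "\<sigma> \<one>\<^bsub>G\<^esub> g \<odot>\<^sub>A (u g *\<^sub>A a) = (\<sigma> \<one>\<^bsub>G\<^esub> g \<odot>\<^sub>A u g) *\<^sub>A a"
    "\<sigma> g \<one>\<^bsub>G\<^esub> \<odot>\<^sub>A (u g *\<^sub>A a) = (\<sigma> g \<one>\<^bsub>G\<^esub> \<odot>\<^sub>A u g) *\<^sub>A a"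
    using assms(1,2) by (simp_all add: A.smult_mult_left twist_closed u_closed)
  thus "\<sigma> \<one>\<^bsub>G\<^esub> g \<odot>\<^sub>A a = a" "\<sigma> g \<one>\<^bsub>G\<^esub> \<odot>\<^sub>A a = a"
    using assms by (simp_all add: twist_one_left' twist_one_right')
qed

lemma L_smult_mult:
  assumes c: "c \<in> carrier K" and f: "f \<in> carrier L" and h: "h \<in> carrier L"
  shows "(c \<odot>\<^sub>L f) *\<^sub>L h = c \<odot>\<^sub>L (f *\<^sub>L h)" "f *\<^sub>L (c \<odot>\<^sub>L h) = c \<odot>\<^sub>L (f *\<^sub>L h)"
proof -
  have "(c \<odot>\<^sub>L f) *\<^sub>L h = c \<odot>\<^sub>L (f *\<^sub>L h) \<and> f *\<^sub>L (c \<odot>\<^sub>L h) = c \<odot>\<^sub>L (f *\<^sub>L h)"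
    using f
  proof (induction f rule: L_induct)
    case (mon a g)
    have m: "mon a g \<in> carrier L" using mon by (rule mon_closed)
    from h show ?case
    proof (induction h rule: L_induct)
      case (mon b k)
      thus ?case using \<open>g \<in> carrier G\<close> \<open>a \<in> carrier A\<close> \<open>u g *\<^sub>A a = a\<close> c
        by (simp add: mon_mult tau_smult u_closed tau_closed twist_closed K.m_comm
            A.smult_mult_left A.smult_mult_right flip: mon_smult A.smult_assoc1)
    next
      case (add h h') thus ?case using c m by (simp add: L_distr L.smult_r_distr L_mult_closed)
    qed
  next
    case (add f f') thus ?case using c h by (simp add: L_distr L.smult_r_distr L_mult_closed)
  qed
  thus "(c \<odot>\<^sub>L f) *\<^sub>L h = c \<odot>\<^sub>L (f *\<^sub>L h)" "f *\<^sub>L (c \<odot>\<^sub>L h) = c \<odot>\<^sub>L (f *\<^sub>L h)" by auto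
qed

lemma unital_alg_L: "unital_alg K L"
proof (intro unital_alg.intro unital_alg_axioms.intro module_L)
  let ?S = "{mon a g | a g. g \<in> carrier G \<and> a \<in> carrier A \<and> u g *\<^sub>A a = a}"
  show "ring L"
  proof (rule ring_of_generators[where S = ?S])
    show "abelian_group L" by (rule L.M.abelian_group_axioms)
    show "\<one>\<^bsub>L\<^esub> \<in> carrier L" by (simp add: L_simps(5) mon_closed u_one)
    show "?S \<subseteq> carrier L" using mon_closed by auto
    fix Q assume s: "?S \<subseteq> Q" and a: "\<forall>x\<in>carrier L \<inter> Q. \<forall>y\<in>carrier L \<inter> Q. x \<oplus>\<^bsub>L\<^esub> y \<in> Q"
    show "carrier L \<subseteq> Q"
    proof
      fix x assume "x \<in> carrier L"
      thus "x \<in> Q"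
      proof (induction x rule: L_induct)
        case (mon b g) show ?case
          by (rule subsetD[OF s], rule CollectI, (rule exI)+, rule conjI[OF refl]) (use mon in simp)
      next
        case (add f g) thus ?case using a by simp
      qed
    qed
  next
    fix x y z assume "x \<in> ?S" "y \<in> ?S" "z \<in> ?S"
    thus "(x *\<^sub>L y) *\<^sub>L z = x *\<^sub>L (y *\<^sub>L z)" by (auto intro!: mon_assoc)
  next
    fix x assume "x \<in> ?S"
    then obtain a g where x: "x = mon a g" "g \<in> carrier G" "a \<in> carrier A" "u g *\<^sub>A a = a" by auto
    have "a *\<^sub>A u g = a" using x u_central[of g a] by simp
    thus "\<one>\<^bsub>L\<^esub> *\<^sub>L x = x" "x *\<^sub>L \<one>\<^bsub>L\<^esub> = x"
      using x by (simp_all add: L_simps(5) mon_mult u_one tau_one tau_unit twist_absorb)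
  qed (simp_all add: L_mult_closed L_distr)
qed (simp_all add: L_smult_mult)

end

section \<open>Subalgebras\<close>

lemma (in unital_alg) subringI':
  assumes "H \<subseteq> carrier R" "\<one>\<^bsub>R\<^esub> \<in> H" "\<And>x y. \<lbrakk>x \<in> H; y \<in> H\<rbrakk> \<Longrightarrow> x \<oplus>\<^bsub>R\<^esub> y \<in> H"
    "\<And>x y. \<lbrakk>x \<in> H; y \<in> H\<rbrakk> \<Longrightarrow> x \<otimes>\<^bsub>R\<^esub> y \<in> H" "\<And>c x. \<lbrakk>c \<in> carrier K; x \<in> H\<rbrakk> \<Longrightarrow> c \<odot>\<^bsub>R\<^esub> x \<in> H"
  shows "subring H R"
proof (rule A.subringI)
  fix h assume h: "h \<in> H"
  have "\<ominus>\<^bsub>R\<^esub> h = (\<ominus>\<^bsub>K\<^esub> \<one>\<^bsub>K\<^esub>) \<odot>\<^bsub>R\<^esub> h"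
    using h assms(1) by (auto simp: smult_l_minus subset_iff)
  thus "\<ominus>\<^bsub>R\<^esub> h \<in> H" using h assms(5) by simp
qed (use assms in auto)

lemma (in unital_alg) subalgebra_gen_minimal:
  assumes "H \<subseteq> carrier R" "\<one>\<^bsub>R\<^esub> \<in> H" "\<And>x y. \<lbrakk>x \<in> H; y \<in> H\<rbrakk> \<Longrightarrow> x \<oplus>\<^bsub>R\<^esub> y \<in> H"
    "\<And>x y. \<lbrakk>x \<in> H; y \<in> H\<rbrakk> \<Longrightarrow> x \<otimes>\<^bsub>R\<^esub> y \<in> H" "\<And>c x. \<lbrakk>c \<in> carrier K; x \<in> H\<rbrakk> \<Longrightarrow> c \<odot>\<^bsub>R\<^esub> x \<in> H"
    "S \<subseteq> H"
  shows "subalgebra_gen K R S \<subseteq> H"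
  using subringI'[OF assms(1-5)] assms(5,6) by (auto simp: subalgebra_gen_def)

lemma (in unital_alg) subalgebra_gen_closed:
  fixes S assumes "S \<subseteq> carrier R" defines "B \<equiv> subalgebra_gen K R S"
  shows "B \<subseteq> carrier R" "S \<subseteq> B" "\<one>\<^bsub>R\<^esub> \<in> B" "\<zero>\<^bsub>R\<^esub> \<in> B"
    "\<And>x y. \<lbrakk>x \<in> B; y \<in> B\<rbrakk> \<Longrightarrow> x \<oplus>\<^bsub>R\<^esub> y \<in> B" "\<And>x y. \<lbrakk>x \<in> B; y \<in> B\<rbrakk> \<Longrightarrow> x \<otimes>\<^bsub>R\<^esub> y \<in> B"
    "\<And>c x. \<lbrakk>c \<in> carrier K; x \<in> B\<rbrakk> \<Longrightarrow> c \<odot>\<^bsub>R\<^esub> x \<in> B" "\<And>x. x \<in> B \<Longrightarrow> \<ominus>\<^bsub>R\<^esub> x \<in> B"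
proof -
  show "B \<subseteq> carrier R" unfolding B_def by (rule subalgebra_gen_minimal) (use assms(1) in auto)
qed (auto simp: B_def subalgebra_gen_def intro: subringE)

lemma fold_module_hom:
  assumes "\<And>g. g \<in> S \<Longrightarrow> act g \<in> module_hom K V V" "w \<in> lists S"
  shows "foldr act w \<in> module_hom K V V" "fold act w \<in> module_hom K V V"
proof -
  have c: "(\<lambda>x. f (h x)) \<in> module_hom K V V" if "f \<in> module_hom K V V" "h \<in> module_hom K V V" for f h
    by (rule module_homI) (use that in \<open>auto simp: module_hom_closed module_hom_add module_hom_smult\<close>)
  have i: "(\<lambda>x. x) \<in> module_hom K V V" by (rule module_homI) auto
  show "foldr act w \<in> module_hom K V V" using assms(2)
  proof (induction w)
    case (Cons g w) thus ?case using c[OF assms(1), of g "foldr act w"] by (simp add: comp_def)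
  qed (simp add: id_def i)
  show "fold act w \<in> module_hom K V V" using assms(2)
  proof (induction w)
    case (Cons g w) thus ?case using c[OF _ assms(1), of "fold act w" g] by (simp add: comp_def)
  qed (simp add: id_def i)
qed

context twisted_partial_action
begin

sublocale Lam: unital_alg K L by (rule unital_alg_L)

section \<open>The canonical representation in the crossed product\<close>

text \<open>The homogeneous elements \<open>1\<^sub>g \<delta>\<^sub>g\<close>. Together with the image of \<open>A\<close> they generate the crossed product,
and they satisfy the relations of \<open>\<kappa>\<^sub>p\<^sub>a\<^sub>r G\<close> for the twist \<open>\<sigma>\<close>.\<close>

definition d :: "'g \<Rightarrow> 'g \<Rightarrow> 'a" where "d g = mon (u g) g"
definition \<iota> :: "'a \<Rightarrow> 'g \<Rightarrow> 'a" where "\<iota> a = mon a \<one>\<^bsub>G\<^esub>"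

lemma d_closed: "g \<in> carrier G \<Longrightarrow> d g \<in> carrier L"
  by (simp add: d_def mon_closed u_closed u_idem)

lemma iota_closed: "a \<in> carrier A \<Longrightarrow> \<iota> a \<in> carrier L"
  by (simp add: \<iota>_def mon_closed u_one)

lemma iota_one: "\<iota> \<one>\<^bsub>A\<^esub> = \<one>\<^bsub>L\<^esub>"
  by (simp add: \<iota>_def L_simps(5))

lemma d_one: "d \<one>\<^bsub>G\<^esub> = \<one>\<^bsub>L\<^esub>"
  by (simp add: d_def L_simps(5) u_one)

lemma iota_add: "\<lbrakk>a \<in> carrier A; b \<in> carrier A\<rbrakk> \<Longrightarrow> \<iota> (a \<oplus>\<^bsub>A\<^esub> b) = \<iota> a \<oplus>\<^bsub>L\<^esub> \<iota> b"
  by (simp add: \<iota>_def mon_add)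

lemma iota_smult: "c \<in> carrier K \<Longrightarrow> \<iota> (c \<odot>\<^sub>A a) = c \<odot>\<^sub>L \<iota> a"
  by (simp add: \<iota>_def mon_smult)

lemma iota_mult: "\<lbrakk>a \<in> carrier A; b \<in> carrier A\<rbrakk> \<Longrightarrow> \<iota> a *\<^sub>L \<iota> b = \<iota> (a *\<^sub>A b)"
  by (simp add: \<iota>_def mon_mult u_one tau_one twist_absorb)

lemma iota_d:
  assumes "a \<in> carrier A" "g \<in> carrier G"
  shows "\<iota> a *\<^sub>L d g = mon (u g *\<^sub>A a) g"
proof -
  have "\<iota> a *\<^sub>L d g = mon (\<sigma> \<one>\<^bsub>G\<^esub> g \<odot>\<^sub>A (a *\<^sub>A u g)) g"
    using assms by (simp add: \<iota>_def d_def mon_mult u_one tau_one u_closed u_idem)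
  also have "a *\<^sub>A u g = u g *\<^sub>A a" using assms by (intro u_central[symmetric])
  also have "\<sigma> \<one>\<^bsub>G\<^esub> g \<odot>\<^sub>A (u g *\<^sub>A a) = u g *\<^sub>A a"
    using assms by (intro twist_absorb(1)) (auto simp: u_closed u_idem')
  finally show ?thesis .
qed

text \<open>Moving an element of \<open>A\<close> past \<open>1\<^sub>g \<delta>\<^sub>g\<close> applies \<open>\<theta>\<^sub>g\<close>.\<close>

lemma d_iota: "\<lbrakk>a \<in> carrier A; g \<in> carrier G\<rbrakk> \<Longrightarrow> d g *\<^sub>L \<iota> a = \<iota> (\<tau> g a) *\<^sub>L d g"
  by (simp add: iota_d tau_closed u_tau)
    (simp add: \<iota>_def d_def mon_mult u_one u_closed u_idem u_tau tau_closed twist_absorb)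

lemma iota_u_d: "g \<in> carrier G \<Longrightarrow> \<iota> (u g) *\<^sub>L d g = d g"
  using iota_d[of "u g" g] by (simp add: u_closed u_idem d_def)

lemma d_iota_u: "g \<in> carrier G \<Longrightarrow> d g *\<^sub>L \<iota> (u (inv\<^sub>G g)) = d g"
  by (simp add: d_iota u_closed tau_u u_one iota_u_d)

lemma d_d: "\<lbrakk>g \<in> carrier G; h \<in> carrier G\<rbrakk> \<Longrightarrow>
    d g *\<^sub>L d h = \<sigma> g h \<odot>\<^sub>L (\<iota> (u g) *\<^sub>L d (g *\<^sub>G h))"
  by (simp add: iota_d u_closed)
    (simp add: d_def mon_mult u_closed u_idem tau_u u_idem' mon_smult twist_closed u_ac)

lemma d_inv: "g \<in> carrier G \<Longrightarrow> d g *\<^sub>L d (inv\<^sub>G g) = \<sigma> g (inv\<^sub>G g) \<odot>\<^sub>L \<iota> (u g)"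
  by (simp add: d_d d_one iota_closed u_closed)

text \<open>The product of two elements \<open>1\<^sub>g \<delta>\<^sub>g\<close> carries an idempotent \<open>1\<^sub>g\<close>, which is absorbed by a
third factor to the left or to the right; this is why the relations of \<open>\<kappa>\<^sub>p\<^sub>a\<^sub>r G\<close> have three factors.\<close>

lemma d_mult_left:
  assumes g: "g \<in> carrier G" and h: "h \<in> carrier G"
  shows "d (inv\<^sub>G g) *\<^sub>L (d g *\<^sub>L d h) = \<sigma> g h \<odot>\<^sub>L (d (inv\<^sub>G g) *\<^sub>L d (g *\<^sub>G h))"
proof -
  have "d (inv\<^sub>G g) *\<^sub>L (d g *\<^sub>L d h) =
      \<sigma> g h \<odot>\<^sub>L (d (inv\<^sub>G g) *\<^sub>L \<iota> (u (inv\<^sub>G (inv\<^sub>G g))) *\<^sub>L d (g *\<^sub>G h))"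
    using g h by (simp add: d_d[OF g h] Lam.smult_mult_right d_closed iota_closed u_closed twist_closed Lam.A.m_assoc)
  thus ?thesis using g by (simp only: d_iota_u G.inv_closed)
qed

lemma d_mult_right:
  assumes g: "g \<in> carrier G" and h: "h \<in> carrier G"
  shows "d g *\<^sub>L (d h *\<^sub>L d (inv\<^sub>G h)) = \<sigma> g h \<odot>\<^sub>L (d (g *\<^sub>G h) *\<^sub>L d (inv\<^sub>G h))"
proof -
  let ?c = "\<sigma> (g *\<^sub>G h) (inv\<^sub>G h)" and ?k = "g *\<^sub>G h"
  note [simp] = d_closed iota_closed u_closed twist_closed Lam.smult_mult_left Lam.smult_mult_right
  have dk: "d ?k *\<^sub>L d (inv\<^sub>G h) = ?c \<odot>\<^sub>L (\<iota> (u ?k) *\<^sub>L d g)"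
    using g h by (simp add: d_d G.m_assoc)
  have "d g *\<^sub>L (d h *\<^sub>L d (inv\<^sub>G h)) = \<sigma> g h \<odot>\<^sub>L (\<iota> (u g) *\<^sub>L (d ?k *\<^sub>L d (inv\<^sub>G h)))"
    using g h d_d[OF g h] by (simp flip: Lam.A.m_assoc)
  also have "\<iota> (u g) *\<^sub>L (d ?k *\<^sub>L d (inv\<^sub>G h)) = ?c \<odot>\<^sub>L (\<iota> (u ?k) *\<^sub>L (\<iota> (u g) *\<^sub>L d g))"
    unfolding dk using g h by (simp add: iota_mult u_ac flip: Lam.A.m_assoc)
  also have "\<dots> = d ?k *\<^sub>L d (inv\<^sub>G h)" unfolding dk using g by (simp add: iota_u_d)
  finally show ?thesis .
qed

lemma d_zero_left:
  assumes "g \<in> carrier G" "h \<in> carrier G" "\<sigma> g h = \<zero>\<^bsub>K\<^esub>"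
  shows "d (inv\<^sub>G g) *\<^sub>L d (g *\<^sub>G h) = \<zero>\<^bsub>L\<^esub>"
  using twist_zero_inv(1)[OF assms] assms by (simp add: d_d d_closed iota_closed u_closed)

lemma d_zero_right:
  assumes "g \<in> carrier G" "h \<in> carrier G" "\<sigma> g h = \<zero>\<^bsub>K\<^esub>"
  shows "d (g *\<^sub>G h) *\<^sub>L d (inv\<^sub>G h) = \<zero>\<^bsub>L\<^esub>"
  using twist_zero_inv(2)[OF assms] assms by (simp add: d_d d_closed iota_closed u_closed G.m_assoc)

lemma L_gen_induct [consumes 1, case_names iota_d add]:
  assumes "f \<in> carrier L"
    and "\<And>a g. \<lbrakk>g \<in> carrier G; a \<in> carrier A\<rbrakk> \<Longrightarrow> \<Phi> (\<iota> a *\<^sub>L d g)"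
    and "\<And>f g. \<lbrakk>f \<in> carrier L; g \<in> carrier L; \<Phi> f; \<Phi> g\<rbrakk> \<Longrightarrow> \<Phi> (f \<oplus>\<^bsub>L\<^esub> g)"
  shows "\<Phi> f"
  using assms(1)
proof (induction f rule: L_induct)
  case (mon a g) thus ?case using assms(2)[of g a] by (simp add: iota_d)
qed (rule assms(3))

sublocale S: kpar_data K G \<sigma>
  by unfold_locales (rule twist_closed)

abbreviation mult_P (infixl \<open>*\<^sub>P\<close> 70) where "x *\<^sub>P y \<equiv> x \<otimes>\<^bsub>S.P\<^esub> y"
abbreviation smult_P (infixl \<open>\<odot>\<^sub>P\<close> 70) where "c \<odot>\<^sub>P x \<equiv> c \<odot>\<^bsub>S.P\<^esub> x"

sublocale LA: word_action K G \<sigma> L "foldr (\<lambda>g x. d g *\<^sub>L x)"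
proof (rule word_action.intro[OF S.kpar_data_axioms module_L], unfold_locales)
  fix w assume w: "w \<in> lists (carrier G)"
  show "foldr (\<lambda>g x. d g *\<^sub>L x) w \<in> module_hom K L L"
    by (rule fold_module_hom(1)[OF _ w], rule module_homI)
      (auto simp: d_closed Lam.A.r_distr Lam.smult_mult_right)
next
  fix g h v assume g: "g \<in> carrier G" and h: "h \<in> carrier G" and v: "v \<in> carrier L"
  note [simp] = g h v d_closed twist_closed Lam.A.m_assoc Lam.smult_mult_left
  show "foldr (\<lambda>g x. d g *\<^sub>L x) [inv\<^sub>G g, g, h] v =
      \<sigma> g h \<odot>\<^sub>L foldr (\<lambda>g x. d g *\<^sub>L x) [inv\<^sub>G g, g *\<^sub>G h] v"
    using arg_cong[OF d_mult_left[OF g h], of "\<lambda>x. x *\<^sub>L v"] by simp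
  show "foldr (\<lambda>g x. d g *\<^sub>L x) [g, h, inv\<^sub>G h] v =
      \<sigma> g h \<odot>\<^sub>L foldr (\<lambda>g x. d g *\<^sub>L x) [g *\<^sub>G h, inv\<^sub>G h] v"
    using arg_cong[OF d_mult_right[OF g h], of "\<lambda>x. x *\<^sub>L v"] by simp
  assume z: "\<sigma> g h = \<zero>\<^bsub>K\<^esub>"
  show "foldr (\<lambda>g x. d g *\<^sub>L x) [inv\<^sub>G g, g *\<^sub>G h] v = \<zero>\<^bsub>L\<^esub>"
    using arg_cong[OF d_zero_left[OF g h z], of "\<lambda>x. x *\<^sub>L v"] by simp
  show "foldr (\<lambda>g x. d g *\<^sub>L x) [g *\<^sub>G h, inv\<^sub>G h] v = \<zero>\<^bsub>L\<^esub>"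
    using arg_cong[OF d_zero_right[OF g h z], of "\<lambda>x. x *\<^sub>L v"] by simp
qed (auto simp: d_closed d_one)

text \<open>The algebra homomorphism with \<open>[g] \<mapsto> 1\<^sub>g \<delta>\<^sub>g\<close>. It is obtained from the left module structure on the
crossed product by evaluating at the unit.\<close>

definition \<Psi> :: "('g list \<Rightarrow> 'k) set \<Rightarrow> 'g \<Rightarrow> 'a"
  where "\<Psi> X = LA.act X \<one>\<^bsub>L\<^esub>"

lemma Psi_hom: "\<Psi> \<in> module_hom K S.P L"
  using LA.act_hom_left[of "\<one>\<^bsub>L\<^esub>"] by (simp add: \<Psi>_def[abs_def])

lemmas Psi_closed = module_hom_closed[OF Psi_hom]
  and Psi_add = module_hom_add[OF Psi_hom]
  and Psi_smult = module_hom_smult[OF Psi_hom]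

lemma Psi_one: "\<Psi> \<one>\<^bsub>S.P\<^esub> = \<one>\<^bsub>L\<^esub>"
  by (simp add: \<Psi>_def S.one_P LA.act_word)

lemma foldr_d: "\<lbrakk>w \<in> lists (carrier G); v \<in> carrier L\<rbrakk> \<Longrightarrow>
    foldr (\<lambda>g x. d g *\<^sub>L x) w v = foldr (\<lambda>g x. d g *\<^sub>L x) w \<one>\<^bsub>L\<^esub> *\<^sub>L v"
proof (induction w)
  case (Cons g w)
  have "foldr (\<lambda>g x. d g *\<^sub>L x) w \<one>\<^bsub>L\<^esub> \<in> carrier L" using LA.ap_closed[of w "\<one>\<^bsub>L\<^esub>"] Cons.prems by simp
  thus ?case using Cons by (simp add: d_closed Lam.A.m_assoc)
qed simp

text \<open>Left multiplications commute with right multiplications, so the module structure on the crossed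
product is left multiplication by the value at the unit.\<close>

lemma act_Psi:
  assumes X: "X \<in> carrier S.P" and v: "v \<in> carrier L"
  shows "LA.act X v = \<Psi> X *\<^sub>L v"
  using X
proof (induction X rule: S.P_induct)
  case (word c w)
  note h = module_hom_smult[OF LA.act_hom_left word(1) S.word_closed[OF word(2)]]
  have "foldr (\<lambda>g x. d g *\<^sub>L x) w \<one>\<^bsub>L\<^esub> \<in> carrier L" using LA.ap_closed[of w "\<one>\<^bsub>L\<^esub>"] word by simp
  thus ?case using word v foldr_d[OF word(2) v]
    by (simp add: \<Psi>_def h LA.act_word Lam.smult_mult_left)
next
  case (add X Y)
  thus ?case using v Psi_closed
    by (simp add: module_hom_add[OF LA.act_hom_left] Psi_add Lam.A.l_distr)
qed

lemma Psi_mult: "\<lbrakk>X \<in> carrier S.P; Y \<in> carrier S.P\<rbrakk> \<Longrightarrow> \<Psi> (X *\<^sub>P Y) = \<Psi> X *\<^sub>L \<Psi> Y"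
  using act_Psi[of X "\<Psi> Y"] LA.act_mult_left[of X Y "\<one>\<^bsub>L\<^esub>"] Psi_closed by (simp add: \<Psi>_def)

lemma Psi_gen: "g \<in> carrier G \<Longrightarrow> \<Psi> (S.gen g) = d g"
  by (simp add: \<Psi>_def LA.act_gen d_closed)

end

section \<open>The scalars \<open>\<xi>\<close> and the twist \<open>\<sigma>''\<close>\<close>

locale normalized_twist = twisted_partial_action K G A u \<theta> \<sigma>
  for K :: "'k ring" and G :: "'g monoid" and A :: "('k, 'a) module"
    and u :: "'g \<Rightarrow> 'a" and \<theta> :: "'g \<Rightarrow> 'a \<Rightarrow> 'a" and \<sigma> :: "'g \<Rightarrow> 'g \<Rightarrow> 'k" +
  assumes norm: "\<lbrakk>g \<in> carrier G; g *\<^sub>G g \<noteq> \<one>\<^bsub>G\<^esub>\<rbrakk> \<Longrightarrow> \<sigma> g (inv\<^sub>G g) \<in> {\<zero>\<^bsub>K\<^esub>, \<one>\<^bsub>K\<^esub>}"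
begin

abbreviation \<xi> where "\<xi> \<equiv> xi K G \<sigma>"
abbreviation \<sigma>2 where "\<sigma>2 \<equiv> twist'' K G \<sigma>"

lemma xi_unit: "g \<in> carrier G \<Longrightarrow> \<xi> g \<in> Units K"
proof (cases "g *\<^sub>G g = \<one>\<^bsub>G\<^esub> \<and> \<sigma> g g \<noteq> \<zero>\<^bsub>K\<^esub>")
  case True
  assume "g \<in> carrier G"
  hence "\<sigma> g g \<in> Units K" using True by (simp add: K.field_Units twist_closed)
  thus ?thesis using True by (simp add: xi_def)
qed (auto simp: xi_def)

lemma xi_closed: "g \<in> carrier G \<Longrightarrow> \<xi> g \<in> carrier K"
  using xi_unit[of g] by (rule K.Units_closed)

lemma xi_nonzero: "g \<in> carrier G \<Longrightarrow> \<xi> g \<noteq> \<zero>\<^bsub>K\<^esub>"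
  using xi_unit[of g] by (simp add: K.field_Units)

lemma xi_one: "\<xi> \<one>\<^bsub>G\<^esub> = \<one>\<^bsub>K\<^esub>"
proof -
  have 1: "\<one>\<^bsub>A\<^esub> \<noteq> \<zero>\<^bsub>A\<^esub>" using algebra_A kalgebra.one_neq_zero by blast
  have "\<sigma> \<one>\<^bsub>G\<^esub> \<one>\<^bsub>G\<^esub> = \<one>\<^bsub>K\<^esub>"
    by (rule A.smult_cancel[OF field_K _ _ _ 1])
      (use twist_one_left'[of "\<one>\<^bsub>G\<^esub>"] in \<open>auto simp: twist_closed u_one\<close>)
  thus ?thesis by (simp add: xi_def)
qed

lemma xi_inv: "g \<in> carrier G \<Longrightarrow> \<xi> (inv\<^sub>G g) = \<xi> g"
proof (cases "g *\<^sub>G g = \<one>\<^bsub>G\<^esub>")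
  case True
  assume g: "g \<in> carrier G"
  hence "inv\<^sub>G g = g" using True by (intro G.inv_equality)
  thus ?thesis by simp
next
  case False
  assume g: "g \<in> carrier G"
  have "inv\<^sub>G g *\<^sub>G inv\<^sub>G g \<noteq> \<one>\<^bsub>G\<^esub>"
    using False g by (metis G.inv_closed G.inv_inv G.inv_mult_group G.inv_one G.m_closed)
  thus ?thesis using False by (simp add: xi_def)
qed

text \<open>This is where the normalisation of \<open>\<sigma>\<close> is used: for \<open>g\<^sup>2 \<noteq> 1\<close> a nonzero \<open>\<sigma>(g, g\<^sup>-\<^sup>1)\<close> is \<open>1\<close>, and for
\<open>g\<^sup>2 = 1\<close> it is cancelled by the definition of \<open>\<xi>\<close>.\<close>

lemma xi_norm:
  assumes g: "g \<in> carrier G" and u: "u g \<noteq> \<zero>\<^bsub>A\<^esub>"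
  shows "\<xi> g *\<^sub>K \<sigma> g (inv\<^sub>G g) = \<one>\<^bsub>K\<^esub>" "\<xi> g *\<^sub>K \<sigma> (inv\<^sub>G g) g = \<one>\<^bsub>K\<^esub>"
proof -
  have nz: "\<sigma> g (inv\<^sub>G g) \<noteq> \<zero>\<^bsub>K\<^esub>" using twist_inv_zero_iff[OF g] u by simp
  show "\<xi> g *\<^sub>K \<sigma> g (inv\<^sub>G g) = \<one>\<^bsub>K\<^esub>"
  proof (cases "g *\<^sub>G g = \<one>\<^bsub>G\<^esub>")
    case True
    hence "inv\<^sub>G g = g" using g by (intro G.inv_equality)
    thus ?thesis using True nz g twist_closed[of g g] by (simp add: xi_def K.field_Units)
  next
    case False
    hence "\<sigma> g (inv\<^sub>G g) = \<one>\<^bsub>K\<^esub>" using norm[OF g] nz by auto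
    thus ?thesis using False by (simp add: xi_def)
  qed
  thus "\<xi> g *\<^sub>K \<sigma> (inv\<^sub>G g) g = \<one>\<^bsub>K\<^esub>" using twist_inv_comm[OF g] by simp
qed

lemma twist2_closed: "\<lbrakk>g \<in> carrier G; h \<in> carrier G\<rbrakk> \<Longrightarrow> \<sigma>2 g h \<in> carrier K"
  using xi_unit[of "g *\<^sub>G h"] by (simp add: twist''_def twist'_def xi_closed twist_closed)

lemma twist2_eq:
  assumes "g \<in> carrier G" "h \<in> carrier G"
  shows "\<xi> (g *\<^sub>G h) *\<^sub>K \<sigma>2 g h = \<xi> g *\<^sub>K \<xi> h *\<^sub>K \<sigma> g h *\<^sub>K \<sigma> (inv\<^sub>G h) (inv\<^sub>G g)"
proof -
  let ?k = "\<xi> (g *\<^sub>G h)"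
  have k: "?k \<in> Units K" using assms by (simp add: xi_unit)
  have "?k *\<^sub>K \<sigma>2 g h = (?k *\<^sub>K inv\<^bsub>K\<^esub> ?k) *\<^sub>K (\<xi> g *\<^sub>K \<xi> h *\<^sub>K \<sigma> g h *\<^sub>K \<sigma> (inv\<^sub>G h) (inv\<^sub>G g))"
    using assms k K.Units_closed[OF k] by (simp add: twist''_def twist'_def xi_closed twist_closed K.m_ac del: K.Units_r_inv K.Units_l_inv)
  thus ?thesis using k assms by (simp add: xi_closed twist_closed)
qed

lemma twist2_zero:
  assumes g: "g \<in> carrier G" and h: "h \<in> carrier G" and z: "\<sigma>2 g h = \<zero>\<^bsub>K\<^esub>"
  shows "\<sigma> g h = \<zero>\<^bsub>K\<^esub>"
proof -
  have "\<xi> g *\<^sub>K \<xi> h *\<^sub>K \<sigma> g h *\<^sub>K \<sigma> (inv\<^sub>G h) (inv\<^sub>G g) = \<zero>\<^bsub>K\<^esub>"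
    using twist2_eq[OF g h] z g h by (simp add: xi_closed)
  hence "\<sigma> g h = \<zero>\<^bsub>K\<^esub> \<or> \<sigma> (inv\<^sub>G h) (inv\<^sub>G g) = \<zero>\<^bsub>K\<^esub>"
    using g h xi_nonzero by (simp add: K.integral_iff xi_closed twist_closed)
  thus ?thesis using twist_zero_inv(3)[of "inv\<^sub>G h" "inv\<^sub>G g"] g h by auto
qed

text \<open>The scalar that appears when two of three consecutive conjugations by generators are merged; \<open>c\<close> is
the scalar of the third one.\<close>

lemma twist2_scalar:
  assumes g: "g \<in> carrier G" and h: "h \<in> carrier G" and c: "c \<in> carrier K"
  shows "c *\<^sub>K (\<xi> g *\<^sub>K (\<xi> h *\<^sub>K (\<sigma> g h *\<^sub>K \<sigma> (inv\<^sub>G h) (inv\<^sub>G g)))) =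
    \<sigma>2 g h *\<^sub>K (c *\<^sub>K \<xi> (g *\<^sub>G h))"
proof -
  have "c *\<^sub>K (\<xi> g *\<^sub>K (\<xi> h *\<^sub>K (\<sigma> g h *\<^sub>K \<sigma> (inv\<^sub>G h) (inv\<^sub>G g)))) =
      c *\<^sub>K (\<xi> (g *\<^sub>G h) *\<^sub>K \<sigma>2 g h)"
    unfolding twist2_eq[OF g h] using g h c by (simp add: xi_closed twist_closed K.m_assoc)
  thus ?thesis using g h c by (simp add: xi_closed twist2_closed K.m_ac)
qed

sublocale S2: kpar_data K G \<sigma>2
  by unfold_locales (rule twist2_closed)

section \<open>The commuting idempotents\<close>

abbreviation gen where "gen \<equiv> par_gen K G \<sigma>"
abbreviation e where "e \<equiv> par_idem K G \<sigma>"

text \<open>If \<open>1\<^sub>g = 0\<close>, then \<open>\<sigma>(1, g) = 0\<close>, and one of the relations reads \<open>[1] [g] = 0\<close>.\<close>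

lemma gen_zero:
  assumes g: "g \<in> carrier G" and u: "u g = \<zero>\<^bsub>A\<^esub>"
  shows "gen g = \<zero>\<^bsub>S.P\<^esub>"
proof -
  have "\<sigma> \<one>\<^bsub>G\<^esub> g = \<zero>\<^bsub>K\<^esub>" using g u by (simp add: twist_zero_iff u_one)
  from S.gen_zero_left[OF _ g this] show ?thesis using g by (simp add: S.gen_one)
qed

text \<open>The scalar \<open>\<sigma>(g\<^sup>-\<^sup>1, g)\<^sup>-\<^sup>1\<close> in the definition of \<open>e\<^sub>g\<close> is \<open>\<xi>(g)\<close>; if \<open>1\<^sub>g = 0\<close>, the formula still holds
because then \<open>[g] = 0\<close>. It removes the case distinction from all later computations.\<close>

lemma e_eq:
  assumes g: "g \<in> carrier G"
  shows "e g = \<xi> g \<odot>\<^sub>P (gen g *\<^sub>P gen (inv\<^sub>G g))"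
proof (cases "u g = \<zero>\<^bsub>A\<^esub>")
  case True
  hence "\<sigma> (inv\<^sub>G g) g = \<zero>\<^bsub>K\<^esub>" using twist_inv_zero_iff[OF g] twist_inv_comm[OF g] by simp
  thus ?thesis using gen_zero[OF g True] g by (simp add: par_idem_def xi_closed S.gen_closed)
next
  case False
  hence nz: "\<sigma> (inv\<^sub>G g) g \<noteq> \<zero>\<^bsub>K\<^esub>" using twist_inv_zero_iff[OF g] twist_inv_comm[OF g] by simp
  hence "\<sigma> (inv\<^sub>G g) g \<in> Units K" using g by (simp add: K.field_Units twist_closed)
  hence "inv\<^bsub>K\<^esub> (\<sigma> (inv\<^sub>G g) g) = \<xi> g"
    using xi_norm(2)[OF g False] g K.comm_inv_char[of "\<sigma> (inv\<^sub>G g) g" "\<xi> g"]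
    by (simp add: xi_closed twist_closed K.m_comm)
  thus ?thesis using nz by (simp add: par_idem_def)
qed

lemma e_closed: "g \<in> carrier G \<Longrightarrow> e g \<in> carrier S.P"
  by (simp add: e_eq xi_closed S.gen_closed)

text \<open>Both sides are multiples of \<open>[g h] [h\<^sup>-\<^sup>1]\<close>. If \<open>\<sigma>(g, h) = 0\<close>, this product vanishes. Otherwise the
idempotents involved have a nonzero product, and the two scalars agree by the cocycle identity for
\<open>((g h)\<^sup>-\<^sup>1, g, h)\<close>.\<close>

lemma gen_e:
  assumes g: "g \<in> carrier G" and h: "h \<in> carrier G"
  shows "gen g *\<^sub>P e h = e (g *\<^sub>G h) *\<^sub>P gen g"
proof -
  let ?k = "g *\<^sub>G h" and ?x = "inv\<^sub>G (g *\<^sub>G h)"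
  note [simp] = xi_closed twist_closed S.gen_closed S.P.smult_mult_left S.P.smult_mult_right
  have x: "?x *\<^sub>G g = inv\<^sub>G h" "?x *\<^sub>G ?k = \<one>\<^bsub>G\<^esub>" using g h by (simp_all add: G.inv_mult_group G.m_assoc)
  have 1: "gen g *\<^sub>P e h = (\<xi> h *\<^sub>K \<sigma> g h) \<odot>\<^sub>P (gen ?k *\<^sub>P gen (inv\<^sub>G h))"
    using S.gen_mult_right[OF g h] g h by (simp add: e_eq S.P.A.m_assoc S.P.smult_assoc1)
  have 2: "e ?k *\<^sub>P gen g = (\<xi> ?k *\<^sub>K \<sigma> ?x g) \<odot>\<^sub>P (gen ?k *\<^sub>P gen (inv\<^sub>G h))"
    using S.gen_mult_left[of ?x g] g h by (simp add: e_eq S.P.smult_assoc1 x)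
  show ?thesis
  proof (cases "\<sigma> g h = \<zero>\<^bsub>K\<^esub>")
    case True
    thus ?thesis unfolding 1 2 using S.gen_zero_right[OF g h True] g h by simp
  next
    case False
    hence s: "\<sigma> (inv\<^sub>G h) (inv\<^sub>G g) \<noteq> \<zero>\<^bsub>K\<^esub>"
      using twist_zero_inv(3)[of "inv\<^sub>G h" "inv\<^sub>G g"] g h by auto
    hence nz: "u ?x *\<^sub>A u (inv\<^sub>G h) \<noteq> \<zero>\<^bsub>A\<^esub>"
      using g h u_ac(1)[of "inv\<^sub>G h" ?x] by (simp add: twist_zero_iff G.inv_mult_group)
    have uk: "u ?k \<noteq> \<zero>\<^bsub>A\<^esub>" and uh: "u h \<noteq> \<zero>\<^bsub>A\<^esub>"
      using nz u_zero_inv[of ?k] u_zero_inv[of h] g h by (auto simp: u_closed)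
    have co: "\<sigma> g h *\<^sub>K \<sigma> ?x ?k = \<sigma> ?x g *\<^sub>K \<sigma> (inv\<^sub>G h) h"
      using twist_cocycle_scalar[of ?x g h] nz g h by (simp add: x u_one u_closed)
    have "\<xi> h *\<^sub>K \<sigma> g h = (\<xi> h *\<^sub>K \<sigma> g h) *\<^sub>K (\<xi> ?k *\<^sub>K \<sigma> ?x ?k)"
      using g h xi_norm(2)[OF _ uk] by simp
    also have "\<dots> = \<xi> h *\<^sub>K \<xi> ?k *\<^sub>K (\<sigma> g h *\<^sub>K \<sigma> ?x ?k)" using g h by (simp add: K.m_ac)
    also have "\<dots> = (\<xi> ?k *\<^sub>K \<sigma> ?x g) *\<^sub>K (\<xi> h *\<^sub>K \<sigma> (inv\<^sub>G h) h)"
      unfolding co using g h by (simp add: K.m_ac)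
    also have "\<dots> = \<xi> ?k *\<^sub>K \<sigma> ?x g" using g h xi_norm(2)[OF _ uh] by simp
    finally show ?thesis unfolding 1 2 by simp
  qed
qed

lemma e_comm:
  assumes g: "g \<in> carrier G" and h: "h \<in> carrier G"
  shows "e g *\<^sub>P e h = e h *\<^sub>P e g"
proof -
  note [simp] = xi_closed S.gen_closed e_closed S.P.smult_mult_left S.P.smult_mult_right
  have "e g *\<^sub>P e h = \<xi> g \<odot>\<^sub>P (gen g *\<^sub>P (gen (inv\<^sub>G g) *\<^sub>P e h))"
    using g h by (simp add: e_eq[OF g] S.P.A.m_assoc)
  also have "\<dots> = \<xi> g \<odot>\<^sub>P (gen g *\<^sub>P e (inv\<^sub>G g *\<^sub>G h) *\<^sub>P gen (inv\<^sub>G g))"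
    using g h by (simp add: gen_e[of "inv\<^sub>G g" h] S.P.A.m_assoc)
  also have "\<dots> = \<xi> g \<odot>\<^sub>P (e h *\<^sub>P gen g *\<^sub>P gen (inv\<^sub>G g))"
    using g h by (simp add: gen_e)
  also have "\<dots> = e h *\<^sub>P e g" using g h by (simp add: e_eq[OF g] S.P.A.m_assoc)
  finally show ?thesis .
qed

lemma e_gen:
  assumes g: "g \<in> carrier G"
  shows "e g *\<^sub>P gen g = gen g"
proof (cases "u g = \<zero>\<^bsub>A\<^esub>")
  case True thus ?thesis using gen_zero[OF g True] g by (simp add: e_closed)
next
  case False
  have "e g *\<^sub>P gen g = (\<xi> g *\<^sub>K \<sigma> g (inv\<^sub>G g)) \<odot>\<^sub>P gen g"
    using S.gen_mult_right[of g "inv\<^sub>G g"] g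
    by (simp add: e_eq S.P.smult_mult_left S.P.smult_assoc1 xi_closed twist_closed S.gen_closed S.gen_one)
  thus ?thesis using g False by (simp add: xi_norm S.gen_closed)
qed

lemma e_idem: "g \<in> carrier G \<Longrightarrow> e g *\<^sub>P e g = e g"
  using e_gen[of g] by (simp add: e_eq[of g] S.P.smult_mult_right S.P.smult_mult_left xi_closed S.gen_closed
      flip: S.P.A.m_assoc)

lemma gen_gen_inv: "g \<in> carrier G \<Longrightarrow> \<xi> g \<odot>\<^sub>P (gen (inv\<^sub>G g) *\<^sub>P gen g) = e (inv\<^sub>G g)"
  by (simp add: e_eq xi_inv)

lemma Psi_e: "g \<in> carrier G \<Longrightarrow> \<Psi> (e g) = \<iota> (u g)"
proof (cases "u g = \<zero>\<^bsub>A\<^esub>")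
  case True
  assume g: "g \<in> carrier G"
  have "\<Psi> (e g) = \<xi> g \<odot>\<^sub>L (d g *\<^sub>L d (inv\<^sub>G g))"
    using g by (simp add: e_eq Psi_smult Psi_mult Psi_gen S.gen_closed xi_closed)
  moreover have "d g = \<zero>\<^bsub>L\<^esub>" "\<iota> (u g) = \<zero>\<^bsub>L\<^esub>" by (simp_all add: d_def \<iota>_def True mon_zero)
  ultimately show ?thesis using g by (simp add: d_closed xi_closed)
next
  case False
  assume g: "g \<in> carrier G"
  have "\<Psi> (e g) = (\<xi> g *\<^sub>K \<sigma> g (inv\<^sub>G g)) \<odot>\<^sub>L \<iota> (u g)"
    using g by (simp add: e_eq Psi_smult Psi_mult Psi_gen S.gen_closed xi_closed d_inv twist_closed
        iota_closed u_closed L.smult_assoc1)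
  thus ?thesis using g False by (simp add: xi_norm iota_closed u_closed)
qed

end

context normalized_twist
begin

section \<open>The right module of idempotents\<close>

abbreviation B where "B \<equiv> par_B K G \<sigma>"

lemma B_simps: "carrier B = subalgebra_gen K S.P (e ` carrier G)" "zero B = zero S.P" "add B = add S.P"
  "smult B = smult S.P" "monoid.mult B = monoid.mult S.P" "one B = one S.P"
  by (simp_all add: par_B_def)

lemma e_image: "e ` carrier G \<subseteq> carrier S.P"
  using e_closed by auto

lemma B_sub: "b \<in> carrier B \<Longrightarrow> b \<in> carrier S.P"
  using S.P.subalgebra_gen_closed(1)[OF e_image] by (auto simp: B_simps)

lemma B_e: "g \<in> carrier G \<Longrightarrow> e g \<in> carrier B"
  using S.P.subalgebra_gen_closed(2)[OF e_image] by (auto simp: B_simps)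

lemma B_closed: "\<one>\<^bsub>S.P\<^esub> \<in> carrier B" "\<zero>\<^bsub>S.P\<^esub> \<in> carrier B"
  "\<lbrakk>x \<in> carrier B; y \<in> carrier B\<rbrakk> \<Longrightarrow> x \<oplus>\<^bsub>S.P\<^esub> y \<in> carrier B"
  "\<lbrakk>x \<in> carrier B; y \<in> carrier B\<rbrakk> \<Longrightarrow> x *\<^sub>P y \<in> carrier B"
  "\<lbrakk>c \<in> carrier K; x \<in> carrier B\<rbrakk> \<Longrightarrow> c \<odot>\<^sub>P x \<in> carrier B"
  "x \<in> carrier B \<Longrightarrow> \<ominus>\<^bsub>S.P\<^esub> x \<in> carrier B"
  using S.P.subalgebra_gen_closed(3-)[OF e_image] by (simp_all add: B_simps)

lemma B_minimal:
  assumes "H \<subseteq> carrier S.P" "\<one>\<^bsub>S.P\<^esub> \<in> H" "\<And>x y. \<lbrakk>x \<in> H; y \<in> H\<rbrakk> \<Longrightarrow> x \<oplus>\<^bsub>S.P\<^esub> y \<in> H"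
    "\<And>x y. \<lbrakk>x \<in> H; y \<in> H\<rbrakk> \<Longrightarrow> x *\<^sub>P y \<in> H" "\<And>c x. \<lbrakk>c \<in> carrier K; x \<in> H\<rbrakk> \<Longrightarrow> c \<odot>\<^sub>P x \<in> H"
    "\<And>g. g \<in> carrier G \<Longrightarrow> e g \<in> H"
  shows "carrier B \<subseteq> H"
  unfolding B_simps by (rule S.P.subalgebra_gen_minimal[OF assms(1-5)]) (use assms(6) in auto)

lemma module_B: "module K B"
proof -
  have "submodule (carrier B) K S.P"
    by (rule S.P.submoduleI) (auto simp: B_closed B_sub)
  from submodule.submodule_is_module[OF this S.P.module_KR] show ?thesis
    by (rule module_cong) (simp_all add: B_simps)
qed

text \<open>As an algebra, \<open>B\<close> is spanned by the products of the \<open>e\<^sub>g\<close>: the elements that preserve a given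
property under right multiplication form a subalgebra.\<close>

lemma B_induct [consumes 1, case_names one mult add smult]:
  assumes "b \<in> carrier B"
    and one: "\<Phi> \<one>\<^bsub>S.P\<^esub>"
    and mult: "\<And>x g. \<lbrakk>x \<in> carrier B; \<Phi> x; g \<in> carrier G\<rbrakk> \<Longrightarrow> \<Phi> (x *\<^sub>P e g)"
    and add: "\<And>x y. \<lbrakk>x \<in> carrier B; y \<in> carrier B; \<Phi> x; \<Phi> y\<rbrakk> \<Longrightarrow> \<Phi> (x \<oplus>\<^bsub>S.P\<^esub> y)"
    and smult: "\<And>c x. \<lbrakk>c \<in> carrier K; x \<in> carrier B; \<Phi> x\<rbrakk> \<Longrightarrow> \<Phi> (c \<odot>\<^sub>P x)"
  shows "\<Phi> b"
proof -
  let ?H = "{y \<in> carrier B. \<forall>x\<in>carrier B. \<Phi> x \<longrightarrow> \<Phi> (x *\<^sub>P y)}"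
  have "carrier B \<subseteq> ?H"
  proof (rule B_minimal)
    fix y z assume "y \<in> ?H" "z \<in> ?H"
    hence y: "y \<in> carrier B" "\<And>x. \<lbrakk>x \<in> carrier B; \<Phi> x\<rbrakk> \<Longrightarrow> \<Phi> (x *\<^sub>P y)"
      and z: "z \<in> carrier B" "\<And>x. \<lbrakk>x \<in> carrier B; \<Phi> x\<rbrakk> \<Longrightarrow> \<Phi> (x *\<^sub>P z)" by simp_all
    have "\<Phi> (x *\<^sub>P (y \<oplus>\<^bsub>S.P\<^esub> z))" "\<Phi> (x *\<^sub>P (y *\<^sub>P z))" if x: "x \<in> carrier B" "\<Phi> x" for x
    proof -
      have "\<Phi> (x *\<^sub>P y \<oplus>\<^bsub>S.P\<^esub> x *\<^sub>P z)"
        by (rule add[OF B_closed(4)[OF x(1) y(1)] B_closed(4)[OF x(1) z(1)] y(2)[OF x] z(2)[OF x]])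
      thus "\<Phi> (x *\<^sub>P (y \<oplus>\<^bsub>S.P\<^esub> z))" using x y(1) z(1) by (simp add: S.P.A.r_distr B_sub)
      have "\<Phi> (x *\<^sub>P y *\<^sub>P z)" by (rule z(2)[OF B_closed(4)[OF x(1) y(1)] y(2)[OF x]])
      thus "\<Phi> (x *\<^sub>P (y *\<^sub>P z))" using x y(1) z(1) by (simp add: S.P.A.m_assoc B_sub)
    qed
    thus "y \<oplus>\<^bsub>S.P\<^esub> z \<in> ?H" "y *\<^sub>P z \<in> ?H" using y(1) z(1) B_closed(3,4) by simp_all
  next
    fix c y assume c: "c \<in> carrier K" and "y \<in> ?H"
    hence y: "y \<in> carrier B" "\<And>x. \<lbrakk>x \<in> carrier B; \<Phi> x\<rbrakk> \<Longrightarrow> \<Phi> (x *\<^sub>P y)" by simp_all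
    have "\<Phi> (x *\<^sub>P (c \<odot>\<^sub>P y))" if x: "x \<in> carrier B" "\<Phi> x" for x
      using smult[OF c B_closed(4)[OF x(1) y(1)] y(2)[OF x]] x y(1) c
      by (simp add: S.P.smult_mult_right B_sub)
    thus "c \<odot>\<^sub>P y \<in> ?H" using y(1) c B_closed(5) by simp
  next
    show "\<one>\<^bsub>S.P\<^esub> \<in> ?H" by (simp add: B_closed(1) B_sub)
  next
    fix g assume "g \<in> carrier G"
    thus "e g \<in> ?H" using mult B_e by simp
  next
    show "?H \<subseteq> carrier S.P" using B_sub by blast
  qed
  hence "b \<in> ?H" using assms(1) by (rule subsetD)
  hence "\<Phi> (\<one>\<^bsub>S.P\<^esub> *\<^sub>P b)" using one B_closed(1) by simp
  thus ?thesis using B_sub[OF assms(1)] by simp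
qed

lemma B_e_comm:
  assumes b: "b \<in> carrier B" and g: "g \<in> carrier G"
  shows "b *\<^sub>P e g = e g *\<^sub>P b"
  using b
proof (induction b rule: B_induct)
  case (mult x h)
  have "x *\<^sub>P e h *\<^sub>P e g = (x *\<^sub>P e g) *\<^sub>P e h"
    using mult.hyps g by (simp add: S.P.A.m_assoc B_sub e_closed e_comm)
  also have "\<dots> = e g *\<^sub>P (x *\<^sub>P e h)"
    using mult g by (simp add: S.P.A.m_assoc B_sub e_closed)
  finally show ?case .
qed (use g in \<open>auto simp: S.P.A.l_distr S.P.A.r_distr S.P.smult_mult_left S.P.smult_mult_right B_sub e_closed\<close>)

text \<open>The elements of \<open>B\<close> that can be moved past \<open>[g]\<close> form a subalgebra, and it contains the \<open>e\<^sub>h\<close>.\<close>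

lemma B_gen:
  assumes b: "b \<in> carrier B" and g: "g \<in> carrier G"
  shows "\<exists>y\<in>carrier B. b *\<^sub>P gen g = gen g *\<^sub>P y"
  using b
proof (induction b rule: B_induct)
  case one show ?case
    by (rule bexI[of _ "\<one>\<^bsub>S.P\<^esub>"]) (use g in \<open>auto simp: B_closed S.gen_closed\<close>)
next
  case (mult x h)
  then obtain y where y: "y \<in> carrier B" "x *\<^sub>P gen g = gen g *\<^sub>P y" by auto
  have "e h *\<^sub>P gen g = gen g *\<^sub>P e (inv\<^sub>G g *\<^sub>G h)" using g mult by (simp add: gen_e)
  hence "x *\<^sub>P e h *\<^sub>P gen g = (x *\<^sub>P gen g) *\<^sub>P e (inv\<^sub>G g *\<^sub>G h)"
    using mult.hyps g by (simp add: S.P.A.m_assoc B_sub e_closed S.gen_closed)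
  also have "\<dots> = gen g *\<^sub>P (y *\<^sub>P e (inv\<^sub>G g *\<^sub>G h))"
    using y mult.hyps g by (simp add: S.P.A.m_assoc B_sub e_closed S.gen_closed)
  finally show ?case using y g mult by (auto intro!: bexI[of _ "y *\<^sub>P e (inv\<^sub>G g *\<^sub>G h)"] B_closed B_e)
next
  case (add x x')
  then obtain y y' where y: "y \<in> carrier B" "x *\<^sub>P gen g = gen g *\<^sub>P y"
    "y' \<in> carrier B" "x' *\<^sub>P gen g = gen g *\<^sub>P y'" by auto
  thus ?case using add g by (intro bexI[of _ "y \<oplus>\<^bsub>S.P\<^esub> y'"])
      (auto simp: S.P.A.l_distr S.P.A.r_distr B_sub S.gen_closed B_closed)
next
  case (smult c x)
  then obtain y where "y \<in> carrier B" "x *\<^sub>P gen g = gen g *\<^sub>P y" by auto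
  thus ?case using smult g by (intro bexI[of _ "c \<odot>\<^sub>P y"])
      (auto simp: S.P.smult_mult_left S.P.smult_mult_right B_sub S.gen_closed B_closed)
qed

text \<open>\<open>\<Psi>\<close> sends \<open>e\<^sub>g\<close> to \<open>1\<^sub>g\<close>, which is central in \<open>A\<close>.\<close>

lemma Psi_B_comm:
  assumes b: "b \<in> carrier B" and a: "a \<in> carrier A"
  shows "\<Psi> b *\<^sub>L \<iota> a = \<iota> a *\<^sub>L \<Psi> b"
  using b
proof (induction b rule: B_induct)
  case (mult x g)
  have c: "\<iota> (u g) *\<^sub>L \<iota> a = \<iota> a *\<^sub>L \<iota> (u g)" using a mult by (simp add: iota_mult u_closed u_central)
  have "\<Psi> (x *\<^sub>P e g) = \<Psi> x *\<^sub>L \<iota> (u g)" using mult by (simp add: Psi_mult Psi_e B_sub e_closed)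
  moreover have "\<Psi> x *\<^sub>L \<iota> (u g) *\<^sub>L \<iota> a = (\<Psi> x *\<^sub>L \<iota> a) *\<^sub>L \<iota> (u g)"
    using mult.hyps a c by (simp add: Lam.A.m_assoc Psi_closed iota_closed u_closed B_sub)
  moreover have "\<dots> = \<iota> a *\<^sub>L (\<Psi> x *\<^sub>L \<iota> (u g))"
    using mult a by (simp add: Lam.A.m_assoc Psi_closed iota_closed u_closed B_sub)
  ultimately show ?case by simp
qed (use a in \<open>auto simp: Psi_one Psi_add Psi_smult Psi_closed iota_closed B_sub Lam.A.l_distr
    Lam.A.r_distr Lam.smult_mult_left Lam.smult_mult_right\<close>)

text \<open>The operator \<open>b \<mapsto> \<xi>(g) [g\<^sup>-\<^sup>1] b [g]\<close> by which \<open>[g]\<close> acts from the right.\<close>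

definition conj_B :: "'g \<Rightarrow> ('g list \<Rightarrow> 'k) set \<Rightarrow> ('g list \<Rightarrow> 'k) set"
  where "conj_B g b = \<xi> g \<odot>\<^bsub>B\<^esub> (gen (inv\<^sub>G g) \<otimes>\<^bsub>B\<^esub> b \<otimes>\<^bsub>B\<^esub> gen g)"

lemma conj_B_eq: "conj_B g b = \<xi> g \<odot>\<^sub>P (gen (inv\<^sub>G g) *\<^sub>P b *\<^sub>P gen g)"
  by (simp add: conj_B_def B_simps)

text \<open>Moving \<open>b\<close> past \<open>[g]\<close> leaves \<open>\<xi>(g) [g\<^sup>-\<^sup>1] [g]\<close>, which is an idempotent in \<open>B\<close>.\<close>

lemma conj_B_closed:
  assumes b: "b \<in> carrier B" and g: "g \<in> carrier G"
  shows "conj_B g b \<in> carrier B"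
proof -
  obtain y where y: "y \<in> carrier B" "b *\<^sub>P gen g = gen g *\<^sub>P y" using B_gen[OF b g] by auto
  have "conj_B g b = (\<xi> g \<odot>\<^sub>P (gen (inv\<^sub>G g) *\<^sub>P gen g)) *\<^sub>P y"
    using y b g by (simp add: conj_B_eq S.P.A.m_assoc S.gen_closed B_sub S.P.smult_mult_left xi_closed)
  also have "\<dots> = e (inv\<^sub>G g) *\<^sub>P y" using g by (simp add: gen_gen_inv)
  finally show ?thesis using y g by (simp add: B_closed B_e)
qed

lemma conj_B_hom: "g \<in> carrier G \<Longrightarrow> conj_B g \<in> module_hom K B B"
  by (rule module_homI) (simp_all only: conj_B_closed, simp_all add: conj_B_eq B_simps(2-) B_sub S.gen_closed
    S.P.A.l_distr S.P.A.r_distr S.P.smult_r_distr xi_closed S.P.smult_mult_left S.P.smult_mult_right K.m_comm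
    flip: S.P.smult_assoc1)

lemma sandwich_P:
  assumes "c \<in> carrier K" "c' \<in> carrier K" "X \<in> carrier S.P" "X' \<in> carrier S.P" "Y \<in> carrier S.P" "Y' \<in> carrier S.P"
    "b \<in> carrier S.P"
  shows "c \<odot>\<^sub>P (X *\<^sub>P (c' \<odot>\<^sub>P (X' *\<^sub>P b *\<^sub>P Y')) *\<^sub>P Y) =
    (c *\<^sub>K c') \<odot>\<^sub>P ((X *\<^sub>P X') *\<^sub>P b *\<^sub>P (Y' *\<^sub>P Y))"
  using assms by (simp add: S.P.smult_mult_left S.P.smult_mult_right S.P.A.m_assoc S.P.smult_assoc1)

text \<open>The relations for \<open>\<sigma>''\<close>. In a product of three conjugations the factors on either side of \<open>b\<close> are
merged by the relations for \<open>\<sigma>\<close>; this produces \<open>\<sigma>(g, h)\<close> on one side and \<open>\<sigma>(h\<^sup>-\<^sup>1, g\<^sup>-\<^sup>1)\<close> on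
the other, which together with the scalars \<open>\<xi>\<close> make up \<open>\<sigma>''(g, h)\<close>.\<close>

lemma conj_B_rel:
  assumes g: "g \<in> carrier G" and h: "h \<in> carrier G" and b: "b \<in> carrier S.P"
  shows "conj_B h (conj_B g (conj_B (inv\<^sub>G g) b)) = \<sigma>2 g h \<odot>\<^sub>P conj_B (g *\<^sub>G h) (conj_B (inv\<^sub>G g) b)"
    and "conj_B (inv\<^sub>G h) (conj_B h (conj_B g b)) = \<sigma>2 g h \<odot>\<^sub>P conj_B (inv\<^sub>G h) (conj_B (g *\<^sub>G h) b)"
    and "\<sigma>2 g h = \<zero>\<^bsub>K\<^esub> \<Longrightarrow> conj_B (g *\<^sub>G h) (conj_B (inv\<^sub>G g) b) = \<zero>\<^bsub>S.P\<^esub>"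
    and "\<sigma>2 g h = \<zero>\<^bsub>K\<^esub> \<Longrightarrow> conj_B (inv\<^sub>G h) (conj_B (g *\<^sub>G h) b) = \<zero>\<^bsub>S.P\<^esub>"
proof -
  let ?g = "inv\<^sub>G g" and ?h = "inv\<^sub>G h" and ?s = "\<sigma> (inv\<^sub>G h) (inv\<^sub>G g)"
  note [simp] = g h b xi_closed twist_closed twist2_closed S.gen_closed
  have ig: "inv\<^sub>G (g *\<^sub>G h) = ?h *\<^sub>G ?g" by (simp add: G.inv_mult_group)
  have "conj_B h (conj_B g (conj_B ?g b)) = (\<xi> h *\<^sub>K (\<xi> g *\<^sub>K \<xi> ?g)) \<odot>\<^sub>P
      ((gen ?h *\<^sub>P (gen ?g *\<^sub>P gen g)) *\<^sub>P b *\<^sub>P ((gen ?g *\<^sub>P gen g) *\<^sub>P gen h))"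
    by (simp add: conj_B_eq sandwich_P)
  also have "gen ?h *\<^sub>P (gen ?g *\<^sub>P gen g) = ?s \<odot>\<^sub>P (gen (?h *\<^sub>G ?g) *\<^sub>P gen g)"
    using S.gen_mult_right[of ?h ?g] by (simp add: S.P.A.m_assoc)
  also have "(gen ?g *\<^sub>P gen g) *\<^sub>P gen h = \<sigma> g h \<odot>\<^sub>P (gen ?g *\<^sub>P gen (g *\<^sub>G h))"
    by (rule S.gen_mult_left[OF g h])
  also have "(\<xi> h *\<^sub>K (\<xi> g *\<^sub>K \<xi> ?g)) \<odot>\<^sub>P ((?s \<odot>\<^sub>P (gen (?h *\<^sub>G ?g) *\<^sub>P gen g)) *\<^sub>P b *\<^sub>P
      (\<sigma> g h \<odot>\<^sub>P (gen ?g *\<^sub>P gen (g *\<^sub>G h)))) =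
      (\<xi> ?g *\<^sub>K (\<xi> g *\<^sub>K (\<xi> h *\<^sub>K (\<sigma> g h *\<^sub>K ?s)))) \<odot>\<^sub>P
      ((gen (?h *\<^sub>G ?g) *\<^sub>P gen g) *\<^sub>P b *\<^sub>P (gen ?g *\<^sub>P gen (g *\<^sub>G h)))"
    by (simp add: S.P.smult_mult_left S.P.smult_mult_right K.m_ac flip: S.P.smult_assoc1)
  also have "\<dots> = \<sigma>2 g h \<odot>\<^sub>P conj_B (g *\<^sub>G h) (conj_B ?g b)"
    by (simp add: twist2_scalar[OF g h] conj_B_eq sandwich_P ig S.P.smult_assoc1 K.m_comm[of "\<xi> ?g"])
  finally show "conj_B h (conj_B g (conj_B ?g b)) = \<sigma>2 g h \<odot>\<^sub>P conj_B (g *\<^sub>G h) (conj_B ?g b)" .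
  have "conj_B ?h (conj_B h (conj_B g b)) = (\<xi> ?h *\<^sub>K (\<xi> h *\<^sub>K \<xi> g)) \<odot>\<^sub>P
      ((gen h *\<^sub>P (gen ?h *\<^sub>P gen ?g)) *\<^sub>P b *\<^sub>P ((gen g *\<^sub>P gen h) *\<^sub>P gen ?h))"
    by (simp add: conj_B_eq sandwich_P)
  also have "gen h *\<^sub>P (gen ?h *\<^sub>P gen ?g) = ?s \<odot>\<^sub>P (gen h *\<^sub>P gen (?h *\<^sub>G ?g))"
    using S.gen_mult_left[of ?h ?g] by (simp add: S.P.A.m_assoc)
  also have "(gen g *\<^sub>P gen h) *\<^sub>P gen ?h = \<sigma> g h \<odot>\<^sub>P (gen (g *\<^sub>G h) *\<^sub>P gen ?h)"
    by (rule S.gen_mult_right[OF g h])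
  also have "(\<xi> ?h *\<^sub>K (\<xi> h *\<^sub>K \<xi> g)) \<odot>\<^sub>P ((?s \<odot>\<^sub>P (gen h *\<^sub>P gen (?h *\<^sub>G ?g))) *\<^sub>P b *\<^sub>P
      (\<sigma> g h \<odot>\<^sub>P (gen (g *\<^sub>G h) *\<^sub>P gen ?h))) =
      (\<xi> ?h *\<^sub>K (\<xi> g *\<^sub>K (\<xi> h *\<^sub>K (\<sigma> g h *\<^sub>K ?s)))) \<odot>\<^sub>P
      ((gen h *\<^sub>P gen (?h *\<^sub>G ?g)) *\<^sub>P b *\<^sub>P (gen (g *\<^sub>G h) *\<^sub>P gen ?h))"
    by (simp add: S.P.smult_mult_left S.P.smult_mult_right K.m_ac flip: S.P.smult_assoc1)
  also have "\<dots> = \<sigma>2 g h \<odot>\<^sub>P conj_B ?h (conj_B (g *\<^sub>G h) b)"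
    by (simp add: twist2_scalar[OF g h] conj_B_eq sandwich_P ig S.P.smult_assoc1)
  finally show "conj_B ?h (conj_B h (conj_B g b)) = \<sigma>2 g h \<odot>\<^sub>P conj_B ?h (conj_B (g *\<^sub>G h) b)" .
  assume z: "\<sigma>2 g h = \<zero>\<^bsub>K\<^esub>"
  show "conj_B (g *\<^sub>G h) (conj_B ?g b) = \<zero>\<^bsub>S.P\<^esub>" "conj_B ?h (conj_B (g *\<^sub>G h) b) = \<zero>\<^bsub>S.P\<^esub>"
    using S.gen_zero_left[OF g h twist2_zero[OF g h z]] S.gen_zero_right[OF g h twist2_zero[OF g h z]]
    by (simp_all add: conj_B_eq sandwich_P)
qed

lemma conj_B_one:
  assumes g: "g \<in> carrier G" and b: "b \<in> carrier S.P"
  shows "conj_B g (conj_B \<one>\<^bsub>G\<^esub> b) = conj_B g b" "conj_B \<one>\<^bsub>G\<^esub> (conj_B g b) = conj_B g b"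
proof -
  have "conj_B g (conj_B \<one>\<^bsub>G\<^esub> b) = \<xi> g \<odot>\<^sub>P ((gen (inv\<^sub>G g) *\<^sub>P gen \<one>\<^bsub>G\<^esub>) *\<^sub>P b *\<^sub>P (gen \<one>\<^bsub>G\<^esub> *\<^sub>P gen g))"
    "conj_B \<one>\<^bsub>G\<^esub> (conj_B g b) = \<xi> g \<odot>\<^sub>P ((gen \<one>\<^bsub>G\<^esub> *\<^sub>P gen (inv\<^sub>G g)) *\<^sub>P b *\<^sub>P (gen g *\<^sub>P gen \<one>\<^bsub>G\<^esub>))"
    using g b by (simp_all add: conj_B_eq sandwich_P xi_closed S.gen_closed) (simp_all add: xi_one xi_closed)
  thus "conj_B g (conj_B \<one>\<^bsub>G\<^esub> b) = conj_B g b" "conj_B \<one>\<^bsub>G\<^esub> (conj_B g b) = conj_B g b"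
    using g by (simp_all add: S.gen_one conj_B_eq)
qed

sublocale BA: word_action K G \<sigma>2 B "fold conj_B"
proof (rule word_action.intro[OF S2.kpar_data_axioms module_B], unfold_locales)
  fix w assume "w \<in> lists (carrier G)"
  thus "fold conj_B w \<in> module_hom K B B" by (rule fold_module_hom(2)[rotated]) (rule conj_B_hom)
qed (auto simp: conj_B_rel conj_B_one B_sub B_simps(2-))

lemma B_right_simps: "carrier (par_B_right K G \<sigma>) = carrier B" "zero (par_B_right K G \<sigma>) = zero B"
  "add (par_B_right K G \<sigma>) = add B" "smult (par_B_right K G \<sigma>) = BA.act"
proof -
  show "smult (par_B_right K G \<sigma>) = BA.act"
    by (intro ext, unfold BA.act_def) (simp add: par_B_right_def Let_def conj_B_def[abs_def])
qed (simp_all add: par_B_right_def Let_def)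

text \<open>\<open>B\<close> is generated by its unit as a right module.\<close>

lemma conj_B_one_elem: "g \<in> carrier G \<Longrightarrow> conj_B g \<one>\<^bsub>S.P\<^esub> = e (inv\<^sub>G g)"
  by (simp add: conj_B_eq S.gen_closed gen_gen_inv)

lemma B_act_mult: "\<lbrakk>X \<in> carrier S2.P; Y \<in> carrier S2.P; b \<in> carrier B\<rbrakk> \<Longrightarrow>
    BA.act (X \<otimes>\<^bsub>S2.P\<^esub> Y) b = BA.act Y (BA.act X b)"
  by (rule BA.act_mult_right) (auto simp: fold_append)

lemma B_act_scalar: "\<lbrakk>c \<in> carrier K; b \<in> carrier B\<rbrakk> \<Longrightarrow> BA.act (c \<odot>\<^bsub>S2.P\<^esub> \<one>\<^bsub>S2.P\<^esub>) b = c \<odot>\<^bsub>B\<^esub> b"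
  using module_hom_smult[OF BA.act_hom_left, of b c "\<one>\<^bsub>S2.P\<^esub>"] BA.act_word[of "[]" b] by (simp add: S2.one_P[symmetric])

text \<open>The two conjugations multiply \<open>b\<close> by \<open>e\<^sub>g\<close> on both sides, and \<open>B\<close> is commutative. So multiplication by
\<open>e\<^sub>g\<close> is part of the module structure and can be carried through a tensor product.\<close>

lemma B_act_e:
  assumes g: "g \<in> carrier G" and b: "b \<in> carrier B"
  shows "BA.act (S2.gen g \<otimes>\<^bsub>S2.P\<^esub> S2.gen (inv\<^sub>G g)) b = b *\<^sub>P e g"
proof -
  have 1: "\<And>x. x \<in> carrier B \<Longrightarrow> x \<in> carrier S.P" by (rule B_sub)
  have "BA.act (S2.gen g \<otimes>\<^bsub>S2.P\<^esub> S2.gen (inv\<^sub>G g)) b = conj_B (inv\<^sub>G g) (conj_B g b)"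
    using g b conj_B_closed[OF b g] by (simp add: B_act_mult S2.gen_closed BA.act_gen)
  also have "\<dots> = (\<xi> g \<odot>\<^sub>P (gen g *\<^sub>P gen (inv\<^sub>G g))) *\<^sub>P b *\<^sub>P (\<xi> g \<odot>\<^sub>P (gen g *\<^sub>P gen (inv\<^sub>G g)))"
    using g b by (simp add: conj_B_eq xi_closed S.gen_closed B_sub xi_inv S.P.smult_mult_left
        S.P.smult_mult_right S.P.A.m_assoc)
  also have "\<dots> = e g *\<^sub>P b *\<^sub>P e g" using g by (simp add: e_eq)
  also have "\<dots> = b *\<^sub>P e g"
    using g b by (simp add: B_e_comm[OF b g, symmetric] S.P.A.m_assoc B_sub e_closed e_idem)
  finally show ?thesis .
qed

end

section \<open>The partial group algebra action on \<open>A \<otimes>\<^bsub>A\<^sup>e\<^esub> M\<close>\<close>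

locale bimodule_setting = normalized_twist K G A u \<theta> \<sigma> + Mod: left_module "env K (crossed_product G A u \<theta> \<sigma>)" M
  for K :: "'k ring" and G :: "'g monoid" and A :: "('k, 'a) module"
    and u :: "'g \<Rightarrow> 'a" and \<theta> :: "'g \<Rightarrow> 'a \<Rightarrow> 'a" and \<sigma> :: "'g \<Rightarrow> 'g \<Rightarrow> 'k"
    and M :: "((('g \<Rightarrow> 'a) \<times> ('g \<Rightarrow> 'a) \<Rightarrow> 'k) set, 'm) module"
begin

sublocale M: bimodule K L M
  by (intro bimodule.intro Lam.unital_alg_axioms Mod.left_module_axioms)

abbreviation bi where "bi \<equiv> M.bi"
abbreviation et where "et \<equiv> env_tensor K L"
abbreviation res where "res \<equiv> restrict_env K L \<iota> M"

text \<open>The homomorphism of enveloping algebras induced by the inclusion of \<open>A\<close>.\<close>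

definition env_incl where "env_incl = quot_lift K (env K L) (\<lambda>(a, b). et (\<iota> a) (\<iota> b))"

lemma env_incl_balanced: "balanced_map K (self_algebra K) A (opp A) (env K L) (\<lambda>a b. et (\<iota> a) (\<iota> b))"
  by (rule A.bilinear_balanced)
    (auto simp: iota_closed iota_add iota_smult Lam.et_closed Lam.et_add_left Lam.et_add_right
      Lam.et_smult_left Lam.et_smult_right)

lemma env_incl_hom: "env_incl \<in> module_hom K (env K A) (env K L)"
  unfolding env_incl_def by (rule A.E_lift_hom[OF Lam.module_E env_incl_balanced])

lemma env_incl_et: "\<lbrakk>a \<in> carrier A; b \<in> carrier A\<rbrakk> \<Longrightarrow> env_incl (env_tensor K A a b) = et (\<iota> a) (\<iota> b)"
  unfolding env_incl_def by (rule A.E_lift_et[OF Lam.module_E env_incl_balanced])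

lemma res_simps: "carrier res = carrier M" "zero res = zero M" "add res = add M"
  "smult res = (\<lambda>X. smult M (env_incl X))"
  by (simp_all add: restrict_env_def env_incl_def)

sublocale R: env_module K A res
  by (intro env_module.intro env_module_axioms.intro A.unital_alg_axioms
      abelian_group_cong[OF Mod.M.abelian_group_axioms])
    (auto simp: res_simps module_hom_closed[OF env_incl_hom] module_hom_add[OF env_incl_hom]
      Mod.lsmult_closed Mod.lsmult_l_distr Mod.lsmult_r_distr)

text \<open>The class of \<open>m\<close> in \<open>M/[A, M]\<close>, realised as \<open>1 \<otimes> m\<close>.\<close>

abbreviation cls where "cls \<equiv> R.H.pure \<one>\<^bsub>A\<^esub>"

lemma res_et: "\<lbrakk>a \<in> carrier A; b \<in> carrier A\<rbrakk> \<Longrightarrow> env_tensor K A a b \<odot>\<^bsub>res\<^esub> m = bi (\<iota> a) m (\<iota> b)"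
  by (simp add: res_simps env_incl_et M.bi_def)

lemma cls_closed: "m \<in> carrier M \<Longrightarrow> cls m \<in> carrier R.H.T"
  by (simp add: R.H.pure_closed res_simps)

lemma cls_add: "\<lbrakk>m \<in> carrier M; m' \<in> carrier M\<rbrakk> \<Longrightarrow> cls (m \<oplus>\<^bsub>M\<^esub> m') = cls m \<oplus>\<^bsub>R.H.T\<^esub> cls m'"
  using R.H.pure_add_right[of "\<one>\<^bsub>A\<^esub>" m m'] by (simp add: res_simps)

lemma pure_cls: "\<lbrakk>a \<in> carrier A; m \<in> carrier M\<rbrakk> \<Longrightarrow> R.H.pure a m = cls (bi (\<iota> a) m \<one>\<^bsub>L\<^esub>)"
  using R.pure_one[of a m] by (simp add: res_simps(1) res_et iota_one)

lemma pure_cls': "\<lbrakk>a \<in> carrier A; m \<in> carrier M\<rbrakk> \<Longrightarrow> R.H.pure a m = cls (bi \<one>\<^bsub>L\<^esub> m (\<iota> a))"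
  using R.pure_one'[of a m] by (simp add: res_simps(1) res_et iota_one)

lemma cls_comm:
  assumes "a \<in> carrier A" "X \<in> carrier L" "Y \<in> carrier L" "m \<in> carrier M"
  shows "cls (bi (\<iota> a *\<^sub>L X) m Y) = cls (bi X m (Y *\<^sub>L \<iota> a))"
  using pure_cls[of a "bi X m Y"] pure_cls'[of a "bi X m Y"] assms
  by (simp add: M.bi_closed M.bi_bi iota_closed)

lemma cls_smult:
  assumes "c \<in> carrier K" "X \<in> carrier L" "Y \<in> carrier L" "m \<in> carrier M"
  shows "cls (bi (c \<odot>\<^sub>L X) m Y) = c \<odot>\<^bsub>R.H.T\<^esub> cls (bi X m Y)"
proof -
  have "c \<odot>\<^bsub>R.H.T\<^esub> cls (bi X m Y) = R.H.pure (c \<odot>\<^sub>A \<one>\<^bsub>A\<^esub>) (bi X m Y)"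
    using assms R.pure_smult[of c "\<one>\<^bsub>A\<^esub>" "bi X m Y"] by (simp add: M.bi_closed res_simps)
  also have "\<dots> = cls (bi (c \<odot>\<^sub>L X) m Y)"
    using assms by (subst pure_cls) (simp_all add: M.bi_closed M.bi_bi iota_smult iota_one Lam.smult_mult_left)
  finally show ?thesis by simp
qed

lemma cls_zero: "\<lbrakk>Y \<in> carrier L; m \<in> carrier M\<rbrakk> \<Longrightarrow> cls (bi \<zero>\<^bsub>L\<^esub> m Y) = \<zero>\<^bsub>R.H.T\<^esub>"
  using cls_smult[of "\<zero>\<^bsub>K\<^esub>" "\<zero>\<^bsub>L\<^esub>" Y m] cls_closed[of "bi \<zero>\<^bsub>L\<^esub> m Y"] by (simp add: M.bi_closed)

lemma T_cases:
  assumes "t \<in> carrier R.H.T"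
  obtains m where "m \<in> carrier M" "t = cls m"
  using R.H_cases[OF assms] by (auto simp: res_simps)

text \<open>The operator \<open>m \<mapsto> \<xi>(g) (1\<^sub>g \<delta>\<^sub>g) m (1\<^sub>g\<^sub>-\<^sub>1 \<delta>\<^sub>g\<^sub>-\<^sub>1)\<close>.\<close>

definition conj_M :: "'g \<Rightarrow> 'm \<Rightarrow> 'm" where "conj_M g m = bi (\<xi> g \<odot>\<^sub>L d g) m (d (inv\<^sub>G g))"

lemma conj_M_eq: "\<lbrakk>g \<in> carrier G; m \<in> carrier M\<rbrakk> \<Longrightarrow> bimodule_act K G A u \<theta> \<sigma> M g m = conj_M g m"
  using M.bi_scalar[of "\<xi> g" "d g" "d (inv\<^sub>G g)" m]
  by (simp add: bimodule_act_def Let_def conj_M_def xi_closed d_closed flip: M.bi_def d_def)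

lemma conj_M_closed: "\<lbrakk>g \<in> carrier G; m \<in> carrier M\<rbrakk> \<Longrightarrow> conj_M g m \<in> carrier M"
  by (simp add: conj_M_def M.bi_closed xi_closed d_closed)

lemma conj_M_add: "\<lbrakk>g \<in> carrier G; m \<in> carrier M; m' \<in> carrier M\<rbrakk> \<Longrightarrow> conj_M g (m \<oplus>\<^bsub>M\<^esub> m') = conj_M g m \<oplus>\<^bsub>M\<^esub> conj_M g m'"
  by (simp add: conj_M_def M.bi_add xi_closed d_closed)

text \<open>The mirror image of the rule for moving elements of \<open>A\<close> to the left of \<open>1\<^sub>g \<delta>\<^sub>g\<close>.\<close>

lemma iota_d_inv:
  assumes g: "g \<in> carrier G" and s: "s \<in> carrier A"
  shows "\<iota> s *\<^sub>L d (inv\<^sub>G g) = d (inv\<^sub>G g) *\<^sub>L \<iota> (\<tau> g s)"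
  using assms by (simp add: d_iota tau_closed tau_tau tau_one iota_d u_closed u_idem')

text \<open>Conjugation is semilinear with respect to \<open>\<theta>\<^sub>g\<close> on both sides, which makes the action on the tensor
product balanced.\<close>

lemma conj_M_bi:
  assumes g: "g \<in> carrier G" and r: "r \<in> carrier A" and s: "s \<in> carrier A" and m: "m \<in> carrier M"
  shows "conj_M g (bi (\<iota> r) m (\<iota> s)) = bi (\<iota> (\<tau> g r)) (conj_M g m) (\<iota> (\<tau> g s))"
  using assms by (simp add: conj_M_def M.bi_bi iota_closed d_closed xi_closed tau_closed Lam.smult_mult_left
      Lam.smult_mult_right d_iota iota_d_inv)

text \<open>The operator of \<open>[g]\<close> on \<open>A \<otimes> M\<close>; on classes it is simply conjugation.\<close>

definition conj_T :: "'g \<Rightarrow> ('a \<times> 'm \<Rightarrow> 'k) set \<Rightarrow> ('a \<times> 'm \<Rightarrow> 'k) set"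
  where "conj_T g = quot_lift K R.H.T (\<lambda>(a, m). R.H.pure (\<theta> g (u (inv\<^sub>G g) *\<^sub>A a)) (bimodule_act K G A u \<theta> \<sigma> M g m))"

lemma conj_T_balanced:
  assumes g: "g \<in> carrier G"
  shows "balanced_map K (env K A) (right_regular K A) res R.H.T
    (\<lambda>a m. R.H.pure (\<theta> g (u (inv\<^sub>G g) *\<^sub>A a)) (bimodule_act K G A u \<theta> \<sigma> M g m))"
proof (rule R.H_balanced[OF R.H.module_T])
  fix r s a m assume r: "r \<in> carrier A" and s: "s \<in> carrier A" and a: "a \<in> carrier A" and m: "m \<in> carrier res"
  have m': "m \<in> carrier M" using m by (simp add: res_simps)
  have "R.H.pure (\<tau> g a) (env_tensor K A (\<tau> g r) (\<tau> g s) \<odot>\<^bsub>res\<^esub> conj_M g m) =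
      R.H.pure (\<tau> g s *\<^sub>A \<tau> g a *\<^sub>A \<tau> g r) (conj_M g m)"
    using g r s a m' by (intro R.pure_regular) (auto simp: tau_closed conj_M_closed res_simps)
  hence "R.H.pure (\<tau> g (s *\<^sub>A a *\<^sub>A r)) (conj_M g m) = R.H.pure (\<tau> g a) (conj_M g (bi (\<iota> r) m (\<iota> s)))"
    using g r s a m' by (simp add: res_et tau_closed conj_M_bi tau_mult)
  thus "R.H.pure (\<theta> g (u (inv\<^sub>G g) *\<^sub>A (s *\<^sub>A a *\<^sub>A r))) (bimodule_act K G A u \<theta> \<sigma> M g m) =
      R.H.pure (\<theta> g (u (inv\<^sub>G g) *\<^sub>A a)) (bimodule_act K G A u \<theta> \<sigma> M g (env_tensor K A r s \<odot>\<^bsub>res\<^esub> m))"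
    using g r s m' by (simp add: res_et conj_M_eq M.bi_closed iota_closed flip: \<tau>_def)
next
  fix c a m assume "c \<in> carrier K" "a \<in> carrier A" "m \<in> carrier res"
  thus "R.H.pure (\<theta> g (u (inv\<^sub>G g) *\<^sub>A (c \<odot>\<^sub>A a))) (bimodule_act K G A u \<theta> \<sigma> M g m) =
      c \<odot>\<^bsub>R.H.T\<^esub> R.H.pure (\<theta> g (u (inv\<^sub>G g) *\<^sub>A a)) (bimodule_act K G A u \<theta> \<sigma> M g m)"
    using g by (simp add: res_simps(1) conj_M_eq tau_smult R.pure_smult tau_closed conj_M_closed flip: \<tau>_def)
next
  fix a n n' assume "a \<in> carrier A" "n \<in> carrier res" "n' \<in> carrier res"
  thus "R.H.pure (\<theta> g (u (inv\<^sub>G g) *\<^sub>A a)) (bimodule_act K G A u \<theta> \<sigma> M g (n \<oplus>\<^bsub>res\<^esub> n')) =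
      R.H.pure (\<theta> g (u (inv\<^sub>G g) *\<^sub>A a)) (bimodule_act K G A u \<theta> \<sigma> M g n) \<oplus>\<^bsub>R.H.T\<^esub>
      R.H.pure (\<theta> g (u (inv\<^sub>G g) *\<^sub>A a)) (bimodule_act K G A u \<theta> \<sigma> M g n')"
    using g R.H.pure_add_right[of "\<tau> g a" "conj_M g n" "conj_M g n'"]
    by (simp add: res_simps(1-3) conj_M_eq conj_M_add conj_M_closed tau_closed flip: \<tau>_def)
next
  fix a a' n assume "a \<in> carrier A" "a' \<in> carrier A" "n \<in> carrier res"
  thus "R.H.pure (\<theta> g (u (inv\<^sub>G g) *\<^sub>A (a \<oplus>\<^bsub>A\<^esub> a'))) (bimodule_act K G A u \<theta> \<sigma> M g n) =
      R.H.pure (\<theta> g (u (inv\<^sub>G g) *\<^sub>A a)) (bimodule_act K G A u \<theta> \<sigma> M g n) \<oplus>\<^bsub>R.H.T\<^esub>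
      R.H.pure (\<theta> g (u (inv\<^sub>G g) *\<^sub>A a')) (bimodule_act K G A u \<theta> \<sigma> M g n)"
    using g R.H.pure_add_left[of "\<tau> g a" "\<tau> g a'" "conj_M g n"]
    by (simp add: res_simps(1-3) conj_M_eq conj_M_closed tau_closed tau_add flip: \<tau>_def)
next
  fix a n assume "a \<in> carrier A" "n \<in> carrier res"
  thus "R.H.pure (\<theta> g (u (inv\<^sub>G g) *\<^sub>A a)) (bimodule_act K G A u \<theta> \<sigma> M g n) \<in> carrier R.H.T"
    using g by (simp add: res_simps(1-3) conj_M_eq conj_M_closed tau_closed R.H.pure_closed flip: \<tau>_def)
qed

lemma conj_T_hom: "g \<in> carrier G \<Longrightarrow> conj_T g \<in> module_hom K R.H.T R.H.T"
  unfolding conj_T_def by (rule R.H.lift_hom[OF R.H.module_T conj_T_balanced])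

lemma conj_T_cls:
  assumes g: "g \<in> carrier G" and m: "m \<in> carrier M"
  shows "conj_T g (cls m) = cls (conj_M g m)"
proof -
  have "conj_T g (cls m) = R.H.pure (u g) (conj_M g m)"
    unfolding conj_T_def using g m
    by (subst R.H.lift_pure[OF R.H.module_T conj_T_balanced[OF g]])
      (simp_all add: res_simps(1) conj_M_eq tau_unit flip: \<tau>_def)
  also have "\<dots> = cls (conj_M g m)"
    using g m by (subst pure_cls) (simp_all add: conj_M_closed u_closed, simp add: conj_M_def M.bi_bi iota_closed
      u_closed d_closed xi_closed Lam.smult_mult_right iota_u_d)
  finally show ?thesis .
qed

lemma sandwich_M:
  assumes "c \<in> carrier K" "c' \<in> carrier K" "X \<in> carrier L" "X' \<in> carrier L" "Y \<in> carrier L" "Y' \<in> carrier L"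
    "m \<in> carrier M"
  shows "bi (c \<odot>\<^sub>L X) (bi (c' \<odot>\<^sub>L X') m Y') Y = bi ((c *\<^sub>K c') \<odot>\<^sub>L (X *\<^sub>L X')) m (Y' *\<^sub>L Y)"
  using assms by (simp add: M.bi_bi Lam.smult_mult_left Lam.smult_mult_right K.m_comm flip: L.smult_assoc1)

text \<open>The relations hold for the same reason as for the right action on \<open>B\<close>: on each side of \<open>m\<close> the
elements \<open>1\<^sub>g \<delta>\<^sub>g\<close> satisfy the relations for \<open>\<sigma>\<close>.\<close>

lemma conj_M_rel:
  assumes g: "g \<in> carrier G" and h: "h \<in> carrier G" and m: "m \<in> carrier M"
  shows "cls (conj_M (inv\<^sub>G g) (conj_M g (conj_M h m))) = \<sigma>2 g h \<odot>\<^bsub>R.H.T\<^esub> cls (conj_M (inv\<^sub>G g) (conj_M (g *\<^sub>G h) m))"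
    and "cls (conj_M g (conj_M h (conj_M (inv\<^sub>G h) m))) = \<sigma>2 g h \<odot>\<^bsub>R.H.T\<^esub> cls (conj_M (g *\<^sub>G h) (conj_M (inv\<^sub>G h) m))"
    and "\<sigma>2 g h = \<zero>\<^bsub>K\<^esub> \<Longrightarrow> cls (conj_M (inv\<^sub>G g) (conj_M (g *\<^sub>G h) m)) = \<zero>\<^bsub>R.H.T\<^esub>"
    and "\<sigma>2 g h = \<zero>\<^bsub>K\<^esub> \<Longrightarrow> cls (conj_M (g *\<^sub>G h) (conj_M (inv\<^sub>G h) m)) = \<zero>\<^bsub>R.H.T\<^esub>"
proof -
  let ?g = "inv\<^sub>G g" and ?h = "inv\<^sub>G h" and ?s = "\<sigma> (inv\<^sub>G h) (inv\<^sub>G g)"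
  note [simp] = g h m xi_closed twist_closed twist2_closed d_closed
  have ig: "inv\<^sub>G (g *\<^sub>G h) = ?h *\<^sub>G ?g" by (simp add: G.inv_mult_group)
  have "conj_M ?g (conj_M g (conj_M h m)) = bi ((\<xi> ?g *\<^sub>K (\<xi> g *\<^sub>K \<xi> h)) \<odot>\<^sub>L (d ?g *\<^sub>L (d g *\<^sub>L d h))) m
      (d ?h *\<^sub>L d ?g *\<^sub>L d g)"
    by (simp add: conj_M_def sandwich_M)
  also have "d ?h *\<^sub>L d ?g *\<^sub>L d g = ?s \<odot>\<^sub>L (d (?h *\<^sub>G ?g) *\<^sub>L d g)"
    using d_mult_right[of ?h ?g] by (simp add: Lam.A.m_assoc)
  also have "d ?g *\<^sub>L (d g *\<^sub>L d h) = \<sigma> g h \<odot>\<^sub>L (d ?g *\<^sub>L d (g *\<^sub>G h))" by (rule d_mult_left[OF g h])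
  also have "bi ((\<xi> ?g *\<^sub>K (\<xi> g *\<^sub>K \<xi> h)) \<odot>\<^sub>L (\<sigma> g h \<odot>\<^sub>L (d ?g *\<^sub>L d (g *\<^sub>G h)))) m
      (?s \<odot>\<^sub>L (d (?h *\<^sub>G ?g) *\<^sub>L d g)) =
      bi ((\<xi> ?g *\<^sub>K (\<xi> g *\<^sub>K (\<xi> h *\<^sub>K (\<sigma> g h *\<^sub>K ?s)))) \<odot>\<^sub>L (d ?g *\<^sub>L d (g *\<^sub>G h))) m (d (?h *\<^sub>G ?g) *\<^sub>L d g)"
    by (simp add: M.bi_smult K.m_ac flip: L.smult_assoc1)
  also have "\<dots> = bi (\<sigma>2 g h \<odot>\<^sub>L ((\<xi> ?g *\<^sub>K \<xi> (g *\<^sub>G h)) \<odot>\<^sub>L (d ?g *\<^sub>L d (g *\<^sub>G h)))) m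
      (d (?h *\<^sub>G ?g) *\<^sub>L d g)"
    by (simp add: twist2_scalar[OF g h] L.smult_assoc1)
  finally have eq: "conj_M ?g (conj_M g (conj_M h m)) = bi (\<sigma>2 g h \<odot>\<^sub>L ((\<xi> ?g *\<^sub>K \<xi> (g *\<^sub>G h)) \<odot>\<^sub>L (d ?g *\<^sub>L d (g *\<^sub>G h)))) m
      (d (?h *\<^sub>G ?g) *\<^sub>L d g)" .
  show "cls (conj_M ?g (conj_M g (conj_M h m))) = \<sigma>2 g h \<odot>\<^bsub>R.H.T\<^esub> cls (conj_M ?g (conj_M (g *\<^sub>G h) m))"
    unfolding eq by (simp add: cls_smult conj_M_def sandwich_M ig)
  have "conj_M g (conj_M h (conj_M ?h m)) = bi ((\<xi> g *\<^sub>K (\<xi> h *\<^sub>K \<xi> ?h)) \<odot>\<^sub>L (d g *\<^sub>L (d h *\<^sub>L d ?h))) m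
      (d h *\<^sub>L d ?h *\<^sub>L d ?g)"
    by (simp add: conj_M_def sandwich_M)
  also have "d h *\<^sub>L d ?h *\<^sub>L d ?g = ?s \<odot>\<^sub>L (d h *\<^sub>L d (?h *\<^sub>G ?g))"
    using d_mult_left[of ?h ?g] by (simp add: Lam.A.m_assoc)
  also have "d g *\<^sub>L (d h *\<^sub>L d ?h) = \<sigma> g h \<odot>\<^sub>L (d (g *\<^sub>G h) *\<^sub>L d ?h)" by (rule d_mult_right[OF g h])
  also have "bi ((\<xi> g *\<^sub>K (\<xi> h *\<^sub>K \<xi> ?h)) \<odot>\<^sub>L (\<sigma> g h \<odot>\<^sub>L (d (g *\<^sub>G h) *\<^sub>L d ?h))) m
      (?s \<odot>\<^sub>L (d h *\<^sub>L d (?h *\<^sub>G ?g))) =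
      bi ((\<xi> ?h *\<^sub>K (\<xi> g *\<^sub>K (\<xi> h *\<^sub>K (\<sigma> g h *\<^sub>K ?s)))) \<odot>\<^sub>L (d (g *\<^sub>G h) *\<^sub>L d ?h)) m (d h *\<^sub>L d (?h *\<^sub>G ?g))"
    by (simp add: M.bi_smult K.m_ac flip: L.smult_assoc1)
  also have "\<dots> = bi (\<sigma>2 g h \<odot>\<^sub>L ((\<xi> (g *\<^sub>G h) *\<^sub>K \<xi> ?h) \<odot>\<^sub>L (d (g *\<^sub>G h) *\<^sub>L d ?h))) m
      (d h *\<^sub>L d (?h *\<^sub>G ?g))"
    by (simp add: twist2_scalar[OF g h] L.smult_assoc1 K.m_comm[of "\<xi> ?h"])
  finally have eq: "conj_M g (conj_M h (conj_M ?h m)) = bi (\<sigma>2 g h \<odot>\<^sub>L ((\<xi> (g *\<^sub>G h) *\<^sub>K \<xi> ?h) \<odot>\<^sub>L (d (g *\<^sub>G h) *\<^sub>L d ?h))) m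
      (d h *\<^sub>L d (?h *\<^sub>G ?g))" .
  show "cls (conj_M g (conj_M h (conj_M ?h m))) = \<sigma>2 g h \<odot>\<^bsub>R.H.T\<^esub> cls (conj_M (g *\<^sub>G h) (conj_M ?h m))"
    unfolding eq by (simp add: cls_smult conj_M_def sandwich_M ig)
  assume z: "\<sigma>2 g h = \<zero>\<^bsub>K\<^esub>"
  show "cls (conj_M ?g (conj_M (g *\<^sub>G h) m)) = \<zero>\<^bsub>R.H.T\<^esub>" "cls (conj_M (g *\<^sub>G h) (conj_M ?h m)) = \<zero>\<^bsub>R.H.T\<^esub>"
    using d_zero_left[OF g h twist2_zero[OF g h z]] d_zero_right[OF g h twist2_zero[OF g h z]]
    by (simp_all add: conj_M_def sandwich_M cls_zero)
qed

lemma conj_M_one: "m \<in> carrier M \<Longrightarrow> conj_M \<one>\<^bsub>G\<^esub> m = m"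
  by (simp add: conj_M_def d_one xi_one M.bi_one)

sublocale TA: word_action K G \<sigma>2 R.H.T "foldr conj_T"
proof (rule word_action.intro[OF S2.kpar_data_axioms R.H.module_T], unfold_locales)
  fix w assume "w \<in> lists (carrier G)"
  thus "foldr conj_T w \<in> module_hom K R.H.T R.H.T" by (rule fold_module_hom(1)[rotated]) (rule conj_T_hom)
qed (auto elim!: T_cases simp: conj_T_cls conj_M_closed conj_M_rel conj_M_one)

lemma TA_mult: "\<lbrakk>X \<in> carrier S2.P; Y \<in> carrier S2.P; t \<in> carrier R.H.T\<rbrakk> \<Longrightarrow>
    TA.act (X \<otimes>\<^bsub>S2.P\<^esub> Y) t = TA.act X (TA.act Y t)"
  by (rule TA.act_mult_left) auto

lemma TA_one: "t \<in> carrier R.H.T \<Longrightarrow> TA.act \<one>\<^bsub>S2.P\<^esub> t = t"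
  using TA.act_word[of "[]" t] by (simp add: S2.one_P)

abbreviation F1M where "F1M \<equiv> obj_map (functor_F1 K G A u \<theta> \<sigma>) M"

lemma F1M_simps: "carrier F1M = carrier R.H.T" "zero F1M = zero R.H.T" "add F1M = add R.H.T"
  "smult F1M = TA.act"
proof -
  have r: "restrict_env K L (\<lambda>a. hom_elem A a \<one>\<^bsub>G\<^esub>) M = res" by (simp add: \<iota>_def[abs_def])
  show "smult F1M = TA.act"
    by (intro ext, unfold TA.act_def) (simp add: functor_F1_def Let_def r conj_T_def[abs_def])
qed (simp_all add: functor_F1_def Let_def \<iota>_def[abs_def])

lemma left_module_F1M: "left_module S2.P F1M"
  by (intro left_module.intro left_module_axioms.intro S2.ring_P abelian_group_cong[OF R.H.T.M.abelian_group_axioms])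
    (auto simp: F1M_simps TA.act_closed TA_mult TA_one module_hom_add[OF TA.act_hom_left]
      module_hom_add[OF TA.act_hom_right])

end

section \<open>The natural isomorphism\<close>

lemma (in normalized_twist) B_tensor_data:
  assumes "left_module S2.P V"
  shows "tensor_data K S2.P (par_B_right K G \<sigma>) V"
proof -
  interpret V: left_module S2.P V by fact
  show ?thesis
    by (rule tensor_data.intro)
      (auto simp: B_right_simps BA.act_closed V.lsmult_closed K.is_cring V.M.abelian_group_axioms
        intro: abelian_group_cong[OF BA.V.M.abelian_group_axioms])
qed

context bimodule_setting
begin

abbreviation BR where "BR \<equiv> par_B_right K G \<sigma>"

sublocale BT: tensor_data K S2.P BR F1M
  by (rule B_tensor_data[OF left_module_F1M])

abbreviation "TF \<equiv> M.H.T"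
abbreviation "pF \<equiv> M.H.pure"

lemma BT_balanced: "\<lbrakk>X \<in> carrier S2.P; b \<in> carrier B; t \<in> carrier R.H.T\<rbrakk> \<Longrightarrow>
    BT.pure (BA.act X b) t = BT.pure b (TA.act X t)"
  using BT.pure_balanced[of X b t] by (simp add: B_right_simps F1M_simps)

lemma BT_closed: "\<lbrakk>b \<in> carrier B; t \<in> carrier R.H.T\<rbrakk> \<Longrightarrow> BT.pure b t \<in> carrier BT.T"
  by (simp add: BT.pure_closed B_right_simps F1M_simps)

lemma BT_add_left: "\<lbrakk>b \<in> carrier B; b' \<in> carrier B; t \<in> carrier R.H.T\<rbrakk> \<Longrightarrow>
    BT.pure (b \<oplus>\<^bsub>S.P\<^esub> b') t = BT.pure b t \<oplus>\<^bsub>BT.T\<^esub> BT.pure b' t"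
  using BT.pure_add_left[of b b' t] by (simp add: B_right_simps F1M_simps B_simps(3))

lemma BT_add_right: "\<lbrakk>b \<in> carrier B; t \<in> carrier R.H.T; t' \<in> carrier R.H.T\<rbrakk> \<Longrightarrow>
    BT.pure b (t \<oplus>\<^bsub>R.H.T\<^esub> t') = BT.pure b t \<oplus>\<^bsub>BT.T\<^esub> BT.pure b t'"
  using BT.pure_add_right[of b t t'] by (simp add: B_right_simps F1M_simps)

lemma BT_smult: "\<lbrakk>c \<in> carrier K; b \<in> carrier B; t \<in> carrier R.H.T\<rbrakk> \<Longrightarrow>
    BT.pure (c \<odot>\<^sub>P b) t = c \<odot>\<^bsub>BT.T\<^esub> BT.pure b t"
  using BT.pure_scalar[of c b t] by (simp add: B_right_simps F1M_simps B_act_scalar B_simps(4))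

lemma TA_scalar: "\<lbrakk>c \<in> carrier K; t \<in> carrier R.H.T\<rbrakk> \<Longrightarrow> TA.act (c \<odot>\<^bsub>S2.P\<^esub> \<one>\<^bsub>S2.P\<^esub>) t = c \<odot>\<^bsub>R.H.T\<^esub> t"
  using module_hom_smult[OF TA.act_hom_left, of t c "\<one>\<^bsub>S2.P\<^esub>"] by (simp add: TA_one)

lemma BT_smult_right: "\<lbrakk>c \<in> carrier K; b \<in> carrier B; t \<in> carrier R.H.T\<rbrakk> \<Longrightarrow>
    BT.pure b (c \<odot>\<^bsub>R.H.T\<^esub> t) = c \<odot>\<^bsub>BT.T\<^esub> BT.pure b t"
  using BT_balanced[of "c \<odot>\<^bsub>S2.P\<^esub> \<one>\<^bsub>S2.P\<^esub>" b t]
  by (simp add: TA_scalar B_act_scalar BT_smult B_simps(4))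

text \<open>The homomorphism \<open>\<Psi>\<close> transports the formula for \<open>e\<^sub>g\<close>.\<close>

lemma xi_d_inv: "g \<in> carrier G \<Longrightarrow> \<xi> g \<odot>\<^sub>L (d g *\<^sub>L d (inv\<^sub>G g)) = \<iota> (u g)"
  using Psi_e[of g] by (simp add: e_eq Psi_smult Psi_mult Psi_gen S.gen_closed xi_closed)

text \<open>The idempotent \<open>e\<^sub>g\<close> crosses the tensor sign as \<open>[g] [g\<^sup>-\<^sup>1]\<close>, which multiplies \<open>m\<close> by \<open>1\<^sub>g\<close> on both
sides; modulo commutators with \<open>A\<close>, once is enough.\<close>

lemma BT_e:
  assumes b: "b \<in> carrier B" and g: "g \<in> carrier G" and m: "m \<in> carrier M"
  shows "BT.pure (b *\<^sub>P e g) (cls m) = BT.pure b (cls (bi (\<iota> (u g)) m \<one>\<^bsub>L\<^esub>))"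
proof -
  have "conj_M g (conj_M (inv\<^sub>G g) m) = bi (\<xi> g \<odot>\<^sub>L (d g *\<^sub>L d (inv\<^sub>G g))) m (\<xi> g \<odot>\<^sub>L (d g *\<^sub>L d (inv\<^sub>G g)))"
    using g m by (simp add: conj_M_def sandwich_M xi_closed d_closed xi_inv M.bi_smult L.smult_assoc1)
  hence conj_M: "conj_M g (conj_M (inv\<^sub>G g) m) = bi (\<iota> (u g)) m (\<iota> (u g))" using g by (simp add: xi_d_inv)
  have "BT.pure (b *\<^sub>P e g) (cls m) = BT.pure b (TA.act (S2.gen g \<otimes>\<^bsub>S2.P\<^esub> S2.gen (inv\<^sub>G g)) (cls m))"
    using BT_balanced[of "S2.gen g \<otimes>\<^bsub>S2.P\<^esub> S2.gen (inv\<^sub>G g)" b "cls m"] b g m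
    by (simp add: B_act_e S2.gen_closed cls_closed)
  also have "\<dots> = BT.pure b (cls (bi (\<iota> (u g)) m (\<iota> (u g))))"
    using g m by (simp add: TA_mult S2.gen_closed cls_closed TA.act_gen conj_T_cls conj_M_closed conj_M)
  also have "cls (bi (\<iota> (u g)) m (\<iota> (u g))) = cls (bi (\<iota> (u g)) m \<one>\<^bsub>L\<^esub>)"
    using cls_comm[of "u g" "\<iota> (u g)" "\<one>\<^bsub>L\<^esub>" m] g m by (simp add: u_closed iota_closed iota_mult u_idem)
  finally show ?thesis .
qed

text \<open>The class of \<open>m\<close> in \<open>F\<^sub>2 F\<^sub>1 M\<close>, realised as \<open>1 \<otimes> (1 \<otimes> m)\<close>. It turns out to depend on \<open>m\<close> only modulo
\<open>[\<Lambda>, M]\<close>.\<close>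

definition cls2 :: "'m \<Rightarrow> (('g list \<Rightarrow> 'k) set \<times> ('a \<times> 'm \<Rightarrow> 'k) set \<Rightarrow> 'k) set"
  where "cls2 m = BT.pure \<one>\<^bsub>S.P\<^esub> (cls m)"

lemma cls2_closed: "m \<in> carrier M \<Longrightarrow> cls2 m \<in> carrier BT.T"
  by (simp add: cls2_def BT_closed B_closed cls_closed)

lemma cls2_add: "\<lbrakk>m \<in> carrier M; m' \<in> carrier M\<rbrakk> \<Longrightarrow> cls2 (m \<oplus>\<^bsub>M\<^esub> m') = cls2 m \<oplus>\<^bsub>BT.T\<^esub> cls2 m'"
  by (simp add: cls2_def cls_add BT_add_right B_closed cls_closed)

text \<open>Conjugation by \<open>[g]\<close> crosses the tensor sign and becomes \<open>1 \<cdot> [g] = e\<^sub>h\<close> with \<open>h = g\<^sup>-\<^sup>1\<close>, which crosses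
back as multiplication by \<open>1\<^sub>h\<close>.\<close>

lemma cls2_conj_M:
  assumes g: "g \<in> carrier G" and m: "m \<in> carrier M"
  shows "cls2 (conj_M g m) = cls2 (bi (\<iota> (u (inv\<^sub>G g))) m \<one>\<^bsub>L\<^esub>)"
proof -
  have "cls2 (conj_M g m) = BT.pure (e (inv\<^sub>G g)) (cls m)"
    using BT_balanced[of "S2.gen g" "\<one>\<^bsub>S.P\<^esub>" "cls m"] g m
    by (simp add: cls2_def S2.gen_closed B_closed cls_closed BA.act_gen TA.act_gen conj_T_cls conj_B_one_elem)
  also have "\<dots> = cls2 (bi (\<iota> (u (inv\<^sub>G g))) m \<one>\<^bsub>L\<^esub>)"
    using BT_e[of "\<one>\<^bsub>S.P\<^esub>" "inv\<^sub>G g" m] g m by (simp add: cls2_def B_closed e_closed)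
  finally show ?thesis .
qed

lemma cls2_iota: "\<lbrakk>a \<in> carrier A; X \<in> carrier L; Y \<in> carrier L; m \<in> carrier M\<rbrakk> \<Longrightarrow>
    cls2 (bi (\<iota> a *\<^sub>L X) m Y) = cls2 (bi X m (Y *\<^sub>L \<iota> a))"
  by (simp add: cls2_def cls_comm)

text \<open>The key computation: \<open>1\<^sub>g \<delta>\<^sub>g\<close> may be moved from the left to the right of \<open>m\<close>. Conjugating
\<open>n = X m Y (1\<^sub>g \<delta>\<^sub>g)\<close> by \<open>[g]\<close> produces \<open>(1\<^sub>g \<delta>\<^sub>g) X m Y\<close> up to an idempotent, because
\<open>\<xi>(g) (1\<^sub>g \<delta>\<^sub>g) (1\<^sub>h \<delta>\<^sub>h) = 1\<^sub>g\<close> for \<open>h = g\<^sup>-\<^sup>1\<close>; but the class of this conjugate is that of \<open>n\<close> up to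
an idempotent. Both idempotents are absorbed after moving them to the other side of \<open>m\<close>.\<close>

lemma cls2_d:
  assumes g: "g \<in> carrier G" and X: "X \<in> carrier L" and Y: "Y \<in> carrier L" and m: "m \<in> carrier M"
  shows "cls2 (bi (d g *\<^sub>L X) m Y) = cls2 (bi X m (Y *\<^sub>L d g))"
proof -
  let ?n = "bi X m (Y *\<^sub>L d g)" and ?u = "u (inv\<^sub>G g)"
  note [simp] = g X Y m d_closed iota_closed u_closed xi_closed M.bi_closed
  have "cls2 (bi (d g *\<^sub>L X) m Y) = cls2 (bi (\<iota> (u g) *\<^sub>L (d g *\<^sub>L X)) m Y)"
    by (simp add: iota_u_d flip: Lam.A.m_assoc)
  also have "\<dots> = cls2 (bi (d g *\<^sub>L X) m (Y *\<^sub>L \<iota> (u g)))" by (simp add: cls2_iota)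
  also have "bi (d g *\<^sub>L X) m (Y *\<^sub>L \<iota> (u g)) = conj_M g ?n"
    by (simp add: conj_M_def M.bi_bi Lam.smult_mult_left Lam.smult_mult_right M.bi_smult Lam.A.m_assoc flip: xi_d_inv)
  also have "cls2 (conj_M g ?n) = cls2 (bi (\<iota> ?u) ?n \<one>\<^bsub>L\<^esub>)" by (rule cls2_conj_M) auto
  also have "\<dots> = cls2 (bi (\<iota> ?u *\<^sub>L X) m (Y *\<^sub>L d g))" by (simp add: M.bi_bi)
  also have "\<dots> = cls2 (bi X m (Y *\<^sub>L (d g *\<^sub>L \<iota> ?u)))" by (simp add: cls2_iota Lam.A.m_assoc)
  also have "\<dots> = cls2 ?n" by (simp add: d_iota_u)
  finally show ?thesis .
qed

text \<open>The crossed product is additively spanned by the products \<open>a (1\<^sub>g \<delta>\<^sub>g)\<close>, and both factors can be moved.\<close>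

lemma cls2_comm:
  assumes s: "s \<in> carrier L" and X: "X \<in> carrier L" and m: "m \<in> carrier M"
  shows "cls2 (bi (s *\<^sub>L X) m \<one>\<^bsub>L\<^esub>) = cls2 (bi X m s)"
  using s
proof (induction s rule: L_gen_induct)
  case (iota_d a g)
  have "cls2 (bi (\<iota> a *\<^sub>L d g *\<^sub>L X) m \<one>\<^bsub>L\<^esub>) = cls2 (bi (d g *\<^sub>L X) m (\<one>\<^bsub>L\<^esub> *\<^sub>L \<iota> a))"
    using iota_d X m cls2_iota[of a "d g *\<^sub>L X" "\<one>\<^bsub>L\<^esub>" m] by (simp add: Lam.A.m_assoc iota_closed d_closed)
  also have "\<dots> = cls2 (bi X m (\<iota> a *\<^sub>L d g))" using iota_d X m by (simp add: cls2_d iota_closed)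
  finally show ?case .
next
  case (add s t)
  thus ?case using X m by (simp add: Lam.A.l_distr M.bi_add_left M.bi_add_right cls2_add M.bi_closed)
qed

text \<open>The inverse isomorphism \<open>l \<otimes> m \<mapsto> 1 \<otimes> (1 \<otimes> l m)\<close>.\<close>

definition \<zeta> where "\<zeta> = quot_lift K BT.T (\<lambda>(l, m). cls2 (bi l m \<one>\<^bsub>L\<^esub>))"

lemma zeta_balanced: "balanced_map K (env K L) (right_regular K L) M BT.T (\<lambda>l m. cls2 (bi l m \<one>\<^bsub>L\<^esub>))"
proof (rule M.H_balanced[OF BT.module_T])
  fix r s l m assume "r \<in> carrier L" "s \<in> carrier L" "l \<in> carrier L" "m \<in> carrier M"
  thus "cls2 (bi (s *\<^sub>L l *\<^sub>L r) m \<one>\<^bsub>L\<^esub>) = cls2 (bi l (et r s \<odot>\<^bsub>M\<^esub> m) \<one>\<^bsub>L\<^esub>)"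
    using cls2_comm[of s "l *\<^sub>L r" m] by (simp add: Lam.A.m_assoc M.bi_bi flip: M.bi_def)
next
  fix c l m assume "c \<in> carrier K" "l \<in> carrier L" "m \<in> carrier M"
  thus "cls2 (bi (c \<odot>\<^sub>L l) m \<one>\<^bsub>L\<^esub>) = c \<odot>\<^bsub>BT.T\<^esub> cls2 (bi l m \<one>\<^bsub>L\<^esub>)"
    by (simp add: cls2_def cls_smult BT_smult_right B_closed cls_closed M.bi_closed)
qed (auto simp: cls2_closed M.bi_closed M.bi_add_left M.bi_add cls2_add)

lemma zeta_hom: "\<zeta> \<in> module_hom K TF BT.T"
  unfolding \<zeta>_def by (rule M.H.lift_hom[OF BT.module_T zeta_balanced])

lemma zeta_pure: "\<lbrakk>l \<in> carrier L; m \<in> carrier M\<rbrakk> \<Longrightarrow> \<zeta> (pF l m) = cls2 (bi l m \<one>\<^bsub>L\<^esub>)"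
  unfolding \<zeta>_def by (rule M.H.lift_pure[OF BT.module_T zeta_balanced]) simp_all

text \<open>The map \<open>a \<otimes> m \<mapsto> \<Psi>(b) a \<otimes> m\<close> for fixed \<open>b\<close>; balanced over \<open>A\<^sup>e\<close> since \<open>\<Psi>(b)\<close> commutes with \<open>A\<close>.\<close>

definition \<eta>_at where "\<eta>_at b = quot_lift K TF (\<lambda>(a, m). pF (\<Psi> b *\<^sub>L \<iota> a) m)"

lemma eta_at_balanced:
  assumes b: "b \<in> carrier B"
  shows "balanced_map K (env K A) (right_regular K A) res TF (\<lambda>a m. pF (\<Psi> b *\<^sub>L \<iota> a) m)"
proof (rule R.H_balanced[OF M.H.module_T])
  have Pb: "\<Psi> b \<in> carrier L" using b by (simp add: Psi_closed B_sub)
  fix r s a m assume r: "r \<in> carrier A" and s: "s \<in> carrier A" and a: "a \<in> carrier A" and m: "m \<in> carrier res"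
  note [simp] = iota_closed Pb
  have m': "m \<in> carrier M" using m by (simp add: res_simps)
  have "pF (\<Psi> b *\<^sub>L \<iota> a) (et (\<iota> r) (\<iota> s) \<odot>\<^bsub>M\<^esub> m) = pF (\<iota> s *\<^sub>L (\<Psi> b *\<^sub>L \<iota> a) *\<^sub>L \<iota> r) m"
    using r s a m' by (intro M.pure_regular) auto
  also have "\<iota> s *\<^sub>L (\<Psi> b *\<^sub>L \<iota> a) *\<^sub>L \<iota> r = (\<Psi> b *\<^sub>L \<iota> s) *\<^sub>L (\<iota> a *\<^sub>L \<iota> r)"
    unfolding Psi_B_comm[OF b s] using r s a by (simp add: Lam.A.m_assoc del: iota_mult)
  also have "\<dots> = \<Psi> b *\<^sub>L \<iota> (s *\<^sub>A a *\<^sub>A r)"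
    using r s a by (simp add: Lam.A.m_assoc iota_mult A.A.m_assoc)
  finally show "pF (\<Psi> b *\<^sub>L \<iota> (s *\<^sub>A a *\<^sub>A r)) m = pF (\<Psi> b *\<^sub>L \<iota> a) (env_tensor K A r s \<odot>\<^bsub>res\<^esub> m)"
    using r s by (simp add: res_et M.bi_def)
next
  fix c a m assume "c \<in> carrier K" "a \<in> carrier A" "m \<in> carrier res"
  thus "pF (\<Psi> b *\<^sub>L \<iota> (c \<odot>\<^sub>A a)) m = c \<odot>\<^bsub>TF\<^esub> pF (\<Psi> b *\<^sub>L \<iota> a) m"
    using b by (simp add: iota_smult Lam.smult_mult_right M.pure_smult iota_closed Psi_closed B_sub res_simps(1))
next
  fix a a' n assume "a \<in> carrier A" "a' \<in> carrier A" "n \<in> carrier res"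
  thus "pF (\<Psi> b *\<^sub>L \<iota> (a \<oplus>\<^bsub>A\<^esub> a')) n = pF (\<Psi> b *\<^sub>L \<iota> a) n \<oplus>\<^bsub>TF\<^esub> pF (\<Psi> b *\<^sub>L \<iota> a') n"
    using b M.H.pure_add_left[of "\<Psi> b *\<^sub>L \<iota> a" "\<Psi> b *\<^sub>L \<iota> a'" n]
    by (simp add: iota_add Lam.A.r_distr iota_closed Psi_closed B_sub res_simps(1))
next
  fix a n n' assume "a \<in> carrier A" "n \<in> carrier res" "n' \<in> carrier res"
  thus "pF (\<Psi> b *\<^sub>L \<iota> a) (n \<oplus>\<^bsub>res\<^esub> n') = pF (\<Psi> b *\<^sub>L \<iota> a) n \<oplus>\<^bsub>TF\<^esub> pF (\<Psi> b *\<^sub>L \<iota> a) n'"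
    using b by (simp add: M.H.pure_add_right iota_closed Psi_closed B_sub res_simps(1-3))
next
  fix a n assume "a \<in> carrier A" "n \<in> carrier res"
  thus "pF (\<Psi> b *\<^sub>L \<iota> a) n \<in> carrier TF"
    using b by (simp add: M.H.pure_closed iota_closed Psi_closed B_sub res_simps(1-3))
qed

lemma eta_at_hom: "b \<in> carrier B \<Longrightarrow> \<eta>_at b \<in> module_hom K R.H.T TF"
  unfolding \<eta>_at_def by (rule R.H.lift_hom[OF M.H.module_T eta_at_balanced])

lemma eta_at_cls: "\<lbrakk>b \<in> carrier B; m \<in> carrier M\<rbrakk> \<Longrightarrow> \<eta>_at b (cls m) = pF (\<Psi> b) m"
  unfolding \<eta>_at_def
  by (subst R.H.lift_pure[OF M.H.module_T eta_at_balanced]) (simp_all add: res_simps(1) iota_one Psi_closed B_sub)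

lemma eta_at_add: "\<lbrakk>b \<in> carrier B; b' \<in> carrier B; t \<in> carrier R.H.T\<rbrakk> \<Longrightarrow>
    \<eta>_at (b \<oplus>\<^bsub>S.P\<^esub> b') t = \<eta>_at b t \<oplus>\<^bsub>TF\<^esub> \<eta>_at b' t"
  using M.H.pure_add_left
  by (auto elim!: T_cases simp: eta_at_cls Psi_add B_sub B_closed Psi_closed)

lemma eta_at_smult: "\<lbrakk>c \<in> carrier K; b \<in> carrier B; t \<in> carrier R.H.T\<rbrakk> \<Longrightarrow>
    \<eta>_at (c \<odot>\<^sub>P b) t = c \<odot>\<^bsub>TF\<^esub> \<eta>_at b t"
  by (auto elim!: T_cases simp: eta_at_cls Psi_smult B_sub B_closed Psi_closed M.pure_smult)

text \<open>In \<open>\<Lambda> \<otimes> M\<close> the right factor of a conjugate of \<open>m\<close> moves to the far left and the left factor to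
the right of \<open>\<Psi>(b)\<close>, so that conjugating \<open>m\<close> one way conjugates \<open>b\<close> the other way.\<close>

lemma eta_at_conj_B:
  assumes b: "b \<in> carrier B" and g: "g \<in> carrier G" and t: "t \<in> carrier R.H.T"
  shows "\<eta>_at (conj_B g b) t = \<eta>_at b (conj_T g t)"
proof -
  obtain m where m: "m \<in> carrier M" "t = cls m" by (rule T_cases[OF t])
  note [simp] = d_closed xi_closed B_sub[OF b] Psi_closed S.gen_closed g m(1)
  have "\<eta>_at b (conj_T g t) = pF (\<Psi> b) (et (\<xi> g \<odot>\<^sub>L d g) (d (inv\<^sub>G g)) \<odot>\<^bsub>M\<^esub> m)"
    using b m g by (simp add: conj_T_cls eta_at_cls conj_M_closed) (simp add: conj_M_def M.bi_def)
  also have "\<dots> = pF (d (inv\<^sub>G g) *\<^sub>L \<Psi> b *\<^sub>L (\<xi> g \<odot>\<^sub>L d g)) m"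
    by (rule M.pure_regular) auto
  also have "d (inv\<^sub>G g) *\<^sub>L \<Psi> b *\<^sub>L (\<xi> g \<odot>\<^sub>L d g) = \<Psi> (conj_B g b)"
    by (simp add: conj_B_eq Psi_smult Psi_mult Psi_gen Lam.smult_mult_right)
  finally show ?thesis using b g m by (simp add: eta_at_cls conj_B_closed)
qed

lemma eta_at_fold:
  assumes "w \<in> lists (carrier G)" "b \<in> carrier B" "t \<in> carrier R.H.T"
  shows "\<eta>_at (fold conj_B w b) t = \<eta>_at b (foldr conj_T w t)"
  using assms
proof (induction w arbitrary: b)
  case (Cons g w)
  note w = Cons.hyps
  have "foldr conj_T w t \<in> carrier R.H.T" by (rule TA.ap_closed[OF w(2) assms(3)])
  thus ?case using Cons.IH[OF conj_B_closed[OF Cons.prems(1) w(1)] assms(3)] w(1) Cons.prems(1)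
    by (simp add: eta_at_conj_B)
qed simp

lemma eta_at_act:
  assumes X: "X \<in> carrier S2.P" and b: "b \<in> carrier B" and t: "t \<in> carrier R.H.T"
  shows "\<eta>_at (BA.act X b) t = \<eta>_at b (TA.act X t)"
  using X
proof (induction X rule: S2.P_induct)
  case (word c w)
  have "\<eta>_at (fold conj_B w b) t = \<eta>_at b (foldr conj_T w t)" by (rule eta_at_fold[OF word(2) b t])
  moreover have "BA.act (c \<odot>\<^bsub>S2.P\<^esub> S2.word w) b = c \<odot>\<^sub>P fold conj_B w b"
    using module_hom_smult[OF BA.act_hom_left[OF b] word(1) S2.word_closed[OF word(2)]] word b
    by (simp add: BA.act_word B_simps(4))
  moreover have "TA.act (c \<odot>\<^bsub>S2.P\<^esub> S2.word w) t = c \<odot>\<^bsub>R.H.T\<^esub> foldr conj_T w t"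
    using module_hom_smult[OF TA.act_hom_left[OF t] word(1) S2.word_closed[OF word(2)]] word t
    by (simp add: TA.act_word)
  ultimately show ?case
    using word b t BA.ap_closed[of w b] TA.ap_closed[of w t]
    by (simp add: eta_at_smult module_hom_smult[OF eta_at_hom])
next
  case (add X Y)
  thus ?case using b t eta_at_add[of "BA.act X b" "BA.act Y b" t]
    by (simp add: module_hom_add[OF BA.act_hom_left] module_hom_add[OF TA.act_hom_left] BA.act_closed
        TA.act_closed module_hom_add[OF eta_at_hom] B_simps(3))
qed

definition \<eta> where "\<eta> = quot_lift K TF (\<lambda>(b, t). \<eta>_at b t)"

lemma eta_balanced: "balanced_map K S2.P BR F1M TF \<eta>_at"
  by (rule balanced_mapI)
    (simp_all add: B_right_simps F1M_simps B_act_scalar eta_at_act module_hom_closed[OF eta_at_hom]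
      module_hom_add[OF eta_at_hom] eta_at_add eta_at_smult B_simps(3,4))

lemma eta_hom: "\<eta> \<in> module_hom K BT.T TF"
  unfolding \<eta>_def by (rule BT.lift_hom[OF M.H.module_T eta_balanced])

lemma eta_pure: "\<lbrakk>b \<in> carrier B; m \<in> carrier M\<rbrakk> \<Longrightarrow> \<eta> (BT.pure b (cls m)) = pF (\<Psi> b) m"
  unfolding \<eta>_def
  by (subst BT.lift_pure[OF M.H.module_T eta_balanced]) (simp_all add: B_right_simps F1M_simps cls_closed eta_at_cls)

lemma BT_induct [consumes 1, case_names pure add]:
  assumes "z \<in> carrier BT.T"
    and "\<And>b m. \<lbrakk>b \<in> carrier B; m \<in> carrier M\<rbrakk> \<Longrightarrow> \<Phi> (BT.pure b (cls m))"
    and "\<And>y z. \<lbrakk>y \<in> carrier BT.T; z \<in> carrier BT.T; \<Phi> y; \<Phi> z\<rbrakk> \<Longrightarrow> \<Phi> (y \<oplus>\<^bsub>BT.T\<^esub> z)"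
  shows "\<Phi> z"
  using assms(1)
proof (induction z rule: BT.tensor_induct)
  case (pure b t)
  hence "t \<in> carrier R.H.T" by (simp add: F1M_simps)
  then obtain m where "m \<in> carrier M" "t = cls m" by (rule T_cases)
  thus ?case using pure assms(2) by (simp add: B_right_simps)
qed (rule assms(3))

text \<open>The identity \<open>\<zeta> \<circ> \<eta> = id\<close> on \<open>b \<otimes> (1 \<otimes> m)\<close>. It is trivial for \<open>b = 1\<close>, and a factor \<open>e\<^sub>g\<close> of \<open>b\<close> can be
carried over to \<open>m\<close> as \<open>1\<^sub>g = \<Psi>(e\<^sub>g)\<close>.\<close>

lemma BT_Psi:
  assumes b: "b \<in> carrier B" and m: "m \<in> carrier M"
  shows "cls2 (bi (\<Psi> b) m \<one>\<^bsub>L\<^esub>) = BT.pure b (cls m)"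
  using b m
proof (induction b arbitrary: m rule: B_induct)
  case one thus ?case by (simp add: Psi_one M.bi_one cls2_def)
next
  case (mult x g)
  have "BT.pure (x *\<^sub>P e g) (cls m) = cls2 (bi (\<Psi> x) (bi (\<iota> (u g)) m \<one>\<^bsub>L\<^esub>) \<one>\<^bsub>L\<^esub>)"
    using mult by (simp add: BT_e M.bi_closed iota_closed u_closed)
  thus ?case using mult
    by (simp add: M.bi_bi iota_closed u_closed Psi_closed B_sub Psi_mult e_closed Psi_e)
next
  case (add x y)
  thus ?case by (simp add: Psi_add B_sub M.bi_add_left Psi_closed cls2_add M.bi_closed BT_add_left cls_closed)
next
  case (smult c x)
  thus ?case using cls_smult[of c "\<Psi> x" "\<one>\<^bsub>L\<^esub>" m]
    by (simp add: Psi_smult B_sub cls2_def Psi_closed BT_smult BT_smult_right B_closed cls_closed M.bi_closed)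
qed

lemma zeta_eta: "z \<in> carrier BT.T \<Longrightarrow> \<zeta> (\<eta> z) = z"
proof (induction z rule: BT_induct)
  case (pure b m) thus ?case by (simp add: eta_pure zeta_pure Psi_closed B_sub BT_Psi)
next
  case (add y z) thus ?case
    by (simp add: module_hom_add[OF eta_hom] module_hom_add[OF zeta_hom] module_hom_closed[OF eta_hom])
qed

lemma eta_zeta: "t \<in> carrier TF \<Longrightarrow> \<eta> (\<zeta> t) = t"
proof (induction t rule: M.H.tensor_induct)
  case (pure l m)
  hence "l \<in> carrier L" "m \<in> carrier M" by simp_all
  thus ?case using M.pure_one[of l m]
    by (simp add: zeta_pure cls2_def eta_pure B_closed M.bi_closed M.bi_one Psi_one flip: M.bi_def)
next
  case (add y z) thus ?case
    by (simp add: module_hom_add[OF eta_hom] module_hom_add[OF zeta_hom] module_hom_closed[OF zeta_hom])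
qed

lemma eta_bij: "bij_betw \<eta> (carrier BT.T) (carrier TF)"
  by (rule bij_betwI[where g = \<zeta>])
    (auto simp: zeta_eta eta_zeta module_hom_closed[OF eta_hom] module_hom_closed[OF zeta_hom])

end

section \<open>Functoriality and naturality\<close>

text \<open>Both functors are evaluated on a bimodule homomorphism \<open>f\<close>, with the constructions for its source
prefixed by \<open>x\<close> and those for its target by \<open>y\<close>.\<close>

locale bimodule_map = normalized_twist K G A u \<theta> \<sigma> +
    x: bimodule_setting K G A u \<theta> \<sigma> M + y: bimodule_setting K G A u \<theta> \<sigma> M'
  for K :: "'k ring" and G :: "'g monoid" and A :: "('k, 'a) module"
    and u :: "'g \<Rightarrow> 'a" and \<theta> :: "'g \<Rightarrow> 'a \<Rightarrow> 'a" and \<sigma> :: "'g \<Rightarrow> 'g \<Rightarrow> 'k"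
    and M :: "((('g \<Rightarrow> 'a) \<times> ('g \<Rightarrow> 'a) \<Rightarrow> 'k) set, 'm) module" and M' :: "((('g \<Rightarrow> 'a) \<times> ('g \<Rightarrow> 'a) \<Rightarrow> 'k) set, 'm) module" +
  fixes f
  assumes f_hom: "f \<in> module_hom (env K L) M M'"
begin

lemma f_bi: "\<lbrakk>r \<in> carrier L; s \<in> carrier L; m \<in> carrier M\<rbrakk> \<Longrightarrow> f (x.bi r m s) = y.bi r (f m) s"
  by (simp add: x.M.bi_def y.M.bi_def module_hom_smult[OF f_hom] Lam.et_closed)

sublocale f1: tensor_map_data K "env K A" "right_regular K A" x.res y.res f
proof (intro tensor_map_data.intro tensor_map_data_axioms.intro x.R.H.tensor_data_axioms
    y.R.H.tensor_data_axioms module_homI)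
qed (simp_all add: x.res_simps y.res_simps module_hom_closed[OF f_hom] module_hom_add[OF f_hom]
    module_hom_smult[OF f_hom] module_hom_closed[OF x.env_incl_hom] x.env_incl_def y.env_incl_def[symmetric] flip: x.env_incl_def)

abbreviation "F1f \<equiv> tensor_map K (env K A) (right_regular K A) y.res f"

lemma F1f_cls: "m \<in> carrier M \<Longrightarrow> F1f (x.cls m) = y.cls (f m)"
  by (simp add: f1.tensor_map_pure x.res_simps)

lemma F1f_conj_T:
  assumes "g \<in> carrier G" "t \<in> carrier x.R.H.T"
  shows "F1f (x.conj_T g t) = y.conj_T g (F1f t)"
proof -
  obtain m where m: "m \<in> carrier M" "t = x.cls m" by (rule x.T_cases[OF assms(2)])
  thus ?thesis using assms module_hom_closed[OF f_hom, of m]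
    by (simp add: x.conj_T_cls F1f_cls x.conj_M_closed y.conj_T_cls)
      (simp add: x.conj_M_def y.conj_M_def f_bi xi_closed d_closed)
qed

lemma F1f_foldr:
  assumes "w \<in> lists (carrier G)" "t \<in> carrier x.R.H.T"
  shows "F1f (foldr x.conj_T w t) = foldr y.conj_T w (F1f t)"
  using assms
proof (induction w)
  case (Cons g w)
  thus ?case using x.TA.ap_closed[of w t] by (simp add: F1f_conj_T)
qed simp

lemma F1f_act:
  assumes X: "X \<in> carrier S2.P" and t: "t \<in> carrier x.R.H.T"
  shows "F1f (x.TA.act X t) = y.TA.act X (F1f t)"
  using X
proof (induction X rule: S2.P_induct)
  case (word c w)
  have t': "F1f t \<in> carrier y.R.H.T" by (rule module_hom_closed[OF f1.tensor_map_hom t])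
  show ?case using word t t' x.TA.ap_closed[of w t]
    by (simp add: module_hom_smult[OF x.TA.act_hom_left] module_hom_smult[OF y.TA.act_hom_left] S2.word_closed
        x.TA.act_word y.TA.act_word module_hom_smult[OF f1.tensor_map_hom] F1f_foldr)
next
  case (add X Y)
  have t': "F1f t \<in> carrier y.R.H.T" by (rule module_hom_closed[OF f1.tensor_map_hom t])
  thus ?case using add t
    by (simp add: module_hom_add[OF x.TA.act_hom_left] module_hom_add[OF y.TA.act_hom_left]
        module_hom_add[OF f1.tensor_map_hom] x.TA.act_closed)
qed

lemma F1f_hom: "F1f \<in> module_hom S2.P x.F1M y.F1M"
  by (rule module_homI) (simp_all add: x.F1M_simps y.F1M_simps F1f_act module_hom_add[OF f1.tensor_map_hom]
    module_hom_closed[OF f1.tensor_map_hom])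

sublocale f2: tensor_map_data K S2.P "par_B_right K G \<sigma>" x.F1M y.F1M F1f
  by (intro tensor_map_data.intro tensor_map_data_axioms.intro x.BT.tensor_data_axioms y.BT.tensor_data_axioms F1f_hom)

sublocale fF: tensor_map_data K "env K L" "right_regular K L" M M' f
  by (intro tensor_map_data.intro tensor_map_data_axioms.intro x.M.H.tensor_data_axioms y.M.H.tensor_data_axioms f_hom)

text \<open>On \<open>b \<otimes> (1 \<otimes> m)\<close> both sides are \<open>\<Psi>(b) \<otimes> f(m)\<close>.\<close>

lemma naturality:
  assumes "z \<in> carrier x.BT.T"
  shows "y.\<eta> (tensor_map K S2.P (par_B_right K G \<sigma>) y.F1M F1f z) = tensor_map K (env K L) (right_regular K L) M' f (x.\<eta> z)"
  using assms
proof (induction z rule: x.BT_induct)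
  case (pure b m)
  thus ?case
    by (simp add: f2.tensor_map_pure fF.tensor_map_pure B_right_simps x.F1M_simps x.cls_closed F1f_cls x.eta_pure
        y.eta_pure module_hom_closed[OF f_hom] Psi_closed B_sub)
next
  case (add z z')
  thus ?case
    by (simp add: module_hom_add[OF f2.tensor_map_hom] module_hom_add[OF fF.tensor_map_hom]
        module_hom_add[OF x.eta_hom] module_hom_add[OF y.eta_hom] module_hom_closed[OF x.eta_hom]
        module_hom_closed[OF f2.tensor_map_hom])
qed

end

context normalized_twist
begin

lemma bimodule_settingI: "left_module (env K L) M \<Longrightarrow> bimodule_setting K G A u \<theta> \<sigma> M"
  by (intro bimodule_setting.intro normalized_twist_axioms)

lemma bimodule_mapI: "\<lbrakk>left_module (env K L) M; left_module (env K L) M'; f \<in> module_hom (env K L) M M'\<rbrakk> \<Longrightarrow>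
    bimodule_map K G A u \<theta> \<sigma> M M' f"
  by (intro bimodule_map.intro bimodule_map_axioms.intro normalized_twist_axioms bimodule_settingI)

lemma F1_mor: "mor_map (functor_F1 K G A u \<theta> \<sigma>) M M' f =
    tensor_map K (env K A) (right_regular K A) (restrict_env K L \<iota> M') f"
  by (simp add: functor_F1_def Let_def \<iota>_def[abs_def])

lemma F1_is_functor: "is_functor (env K L) S2.P (functor_F1 K G A u \<theta> \<sigma> ::
    ((('g \<Rightarrow> 'a) \<times> ('g \<Rightarrow> 'a) \<Rightarrow> 'k) set, 'm, ('g list \<Rightarrow> 'k) set, ('a \<times> 'm \<Rightarrow> 'k) set) mod_functor)"
  unfolding is_functor_def F1_mor
proof (intro conjI allI impI ballI; (elim conjE)?)
  fix M :: "((('g \<Rightarrow> 'a) \<times> ('g \<Rightarrow> 'a) \<Rightarrow> 'k) set, 'm) module"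
  assume M: "left_module (env K L) M"
  interpret x: bimodule_setting K G A u \<theta> \<sigma> M by (rule bimodule_settingI[OF M])
  show "left_module S2.P x.F1M" by (rule x.left_module_F1M)
  fix y assume "y \<in> carrier x.F1M"
  thus "tensor_map K (env K A) (right_regular K A) x.res (\<lambda>x. x) y = y"
    by (intro tensor_map_id x.R.H.tensor_data_axioms) (simp add: x.F1M_simps)
next
  fix M M' :: "((('g \<Rightarrow> 'a) \<times> ('g \<Rightarrow> 'a) \<Rightarrow> 'k) set, 'm) module" and f
  assume "left_module (env K L) M" "left_module (env K L) M'" "f \<in> module_hom (env K L) M M'"
  then interpret f: bimodule_map K G A u \<theta> \<sigma> M M' f by (rule bimodule_mapI)
  show "f.F1f \<in> module_hom S2.P f.x.F1M f.y.F1M" by (rule f.F1f_hom)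
next
  fix M M' :: "((('g \<Rightarrow> 'a) \<times> ('g \<Rightarrow> 'a) \<Rightarrow> 'k) set, 'm) module" and f g y
  assume a: "left_module (env K L) M" "left_module (env K L) M'" "f \<in> module_hom (env K L) M M'"
    "\<forall>x\<in>carrier M. f x = g x" "y \<in> carrier (obj_map (functor_F1 K G A u \<theta> \<sigma>) M)"
  interpret f: bimodule_map K G A u \<theta> \<sigma> M M' f by (rule bimodule_mapI[OF a(1-3)])
  interpret g: bimodule_map K G A u \<theta> \<sigma> M M' g
    by (rule bimodule_mapI[OF a(1,2) module_hom_cong[OF a(1,3)]]) (use a(4) in auto)
  show "f.F1f y = g.F1f y"
    by (rule tensor_map_cong[OF f.f1.tensor_map_data_axioms g.f1.tensor_map_data_axioms])
      (use a(4,5) in \<open>auto simp: f.x.res_simps f.x.F1M_simps\<close>)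
next
  fix M M' M'' :: "((('g \<Rightarrow> 'a) \<times> ('g \<Rightarrow> 'a) \<Rightarrow> 'k) set, 'm) module" and f g y
  assume a: "left_module (env K L) M" "left_module (env K L) M'" "left_module (env K L) M''"
    "f \<in> module_hom (env K L) M M'" "g \<in> module_hom (env K L) M' M''"
    "y \<in> carrier (obj_map (functor_F1 K G A u \<theta> \<sigma>) M)"
  interpret f: bimodule_map K G A u \<theta> \<sigma> M M' f by (rule bimodule_mapI[OF a(1,2,4)])
  interpret g: bimodule_map K G A u \<theta> \<sigma> M' M'' g by (rule bimodule_mapI[OF a(2,3,5)])
  show "tensor_map K (env K A) (right_regular K A) g.y.res (\<lambda>x. g (f x)) y = g.F1f (f.F1f y)"
    by (rule tensor_map_comp[OF f.f1.tensor_map_data_axioms g.f1.tensor_map_data_axioms])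
      (use a(6) in \<open>simp add: f.x.F1M_simps\<close>)
qed

lemma F2_is_functor: "is_functor S2.P K (functor_F2 K G \<sigma>)"
  unfolding functor_F2_def by (rule tensor_functor_is_functor[OF B_tensor_data])

lemma F_is_functor: "is_functor (env K L) K (functor_F K L)"
  unfolding functor_F_def
proof (rule tensor_functor_is_functor)
  fix M :: "((('g \<Rightarrow> 'a) \<times> ('g \<Rightarrow> 'a) \<Rightarrow> 'k) set, 'n) module"
  assume "left_module (env K L) M"
  then interpret bimodule K L M by (intro bimodule.intro Lam.unital_alg_axioms)
  show "tensor_data K (env K L) (right_regular K L) M" by (rule H.tensor_data_axioms)
qed

lemma F2_F1_iso_F: "naturally_isomorphic (env K L) K
    (comp_functor (functor_F2 K G \<sigma>) (functor_F1 K G A u \<theta> \<sigma> ::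
      ((('g \<Rightarrow> 'a) \<times> ('g \<Rightarrow> 'a) \<Rightarrow> 'k) set, 'm, ('g list \<Rightarrow> 'k) set, ('a \<times> 'm \<Rightarrow> 'k) set) mod_functor))
    (functor_F K L)"
  unfolding naturally_isomorphic_def comp_functor_def functor_F2_def functor_F_def tensor_functor_def
    mod_functor.simps F1_mor
proof (intro exI[of _ "\<lambda>M. bimodule_setting.\<eta> K G A u \<theta> \<sigma> M"] conjI allI impI ballI; (elim conjE)?)
  fix M :: "((('g \<Rightarrow> 'a) \<times> ('g \<Rightarrow> 'a) \<Rightarrow> 'k) set, 'm) module"
  assume "left_module (env K L) M"
  then interpret x: bimodule_setting K G A u \<theta> \<sigma> M by (rule bimodule_settingI)
  show "x.\<eta> \<in> module_hom K x.BT.T x.TF" by (rule x.eta_hom)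
  show "bij_betw x.\<eta> (carrier x.BT.T) (carrier x.TF)" by (rule x.eta_bij)
next
  fix M M' :: "((('g \<Rightarrow> 'a) \<times> ('g \<Rightarrow> 'a) \<Rightarrow> 'k) set, 'm) module" and f z
  assume "left_module (env K L) M" "left_module (env K L) M'" "f \<in> module_hom (env K L) M M'"
    and z: "z \<in> carrier (tensor K S2.P (par_B_right K G \<sigma>) (obj_map (functor_F1 K G A u \<theta> \<sigma>) M))"
  then interpret f: bimodule_map K G A u \<theta> \<sigma> M M' f by (intro bimodule_mapI)
  show "f.y.\<eta> (tensor_map K S2.P (par_B_right K G \<sigma>) f.y.F1M f.F1f z) =
      tensor_map K (env K L) (right_regular K L) M' f (f.x.\<eta> z)"
    by (rule f.naturality[OF z])
qed

end

theorem corollary5p12: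
  fixes K :: "'k ring" and G :: "'g monoid" and A :: "('k, 'a) module"
    and u :: "'g \<Rightarrow> 'a" and \<theta> :: "'g \<Rightarrow> 'a \<Rightarrow> 'a" and \<sigma> :: "'g \<Rightarrow> 'g \<Rightarrow> 'k"
    and \<Lambda> :: "('k, 'g \<Rightarrow> 'a) module"
    and F1 :: "((('g \<Rightarrow> 'a) \<times> ('g \<Rightarrow> 'a) \<Rightarrow> 'k) set, 'm,
                ('g list \<Rightarrow> 'k) set, ('a \<times> 'm \<Rightarrow> 'k) set) mod_functor"
  assumes "field K" and "group G" and "kalgebra K A"
    and "twisted_partial_action K G A u \<theta> \<sigma>"
    and "\<And>g. \<lbrakk>g \<in> carrier G; g \<otimes>\<^bsub>G\<^esub> g \<noteq> \<one>\<^bsub>G\<^esub>\<rbrakk> \<Longrightarrow> \<sigma> g (inv\<^bsub>G\<^esub> g) \<in> {\<zero>\<^bsub>K\<^esub>, \<one>\<^bsub>K\<^esub>}"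
    and "\<Lambda> = crossed_product G A u \<theta> \<sigma>"
    and "F1 = functor_F1 K G A u \<theta> \<sigma>"
    and "F2 = functor_F2 K G \<sigma>"
    and "F = functor_F K \<Lambda>"
  shows "is_functor (env K \<Lambda>) (kpar K G (twist'' K G \<sigma>)) F1 \<and>
    is_functor (kpar K G (twist'' K G \<sigma>)) K F2 \<and>
    is_functor (env K \<Lambda>) K F \<and>
    naturally_isomorphic (env K \<Lambda>) K (comp_functor F2 F1) F"
proof -
  interpret normalized_twist K G A u \<theta> \<sigma>
    by (intro normalized_twist.intro normalized_twist_axioms.intro assms(4,5))
  show ?thesis
    unfolding assms(6-9)
    by (intro conjI F1_is_functor F2_is_functor F_is_functor F2_F1_iso_F)
qed

end
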